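(* For any integer $n\geq 2$ and all $t\ge 0$, $$\frac{d}{dt} F_n^N(t) = -nF_n^N(t) -n\sum_{p=1}^{n-1}\mathbb{E}\left[\mathrm{tr}\big((A_t^N)^{p}\big)\,\mathrm{tr}\big((A_t^N)^{n-p}\big)\right] + \begin{cases} n^2\alpha^N\beta^N & \text{if } n \text{ is odd},\\[2mm] \dfrac{n^2}{2}\big((\alpha^N)^2+(\beta^N)^2\big) & \text{if } n \text{ is even},\end{cases}$$ where $\alpha^N = \frac{1}{N}\mathrm{Tr}(R^N)$ and $\beta^N = \frac{1}{N}\mathrm{Tr}(S^N)$.
   Context: Fix an integer $N\ge 1$. $\mathcal{M}_N$ is the space of $N\times N$ complex matrices, $\mathrm{Tr}$ is the usual trace and $\mathrm{tr}=\frac1N\mathrm{Tr}$ on $\mathcal{M}_N$; $I$ is the identity matrix and $E_{k,l}$ are the matrix units. Unitary Brownian motion: let $\mathrm{u}_N$ be the real vector space of $N\times N$ skew-Hermitian matrices with inner product $\langle A,B\rangle=-N\,\mathrm{Tr}(AB)$, and let $\mathcal{B}$ be the orthonormal basis consisting of $\frac{1}{\sqrt{2N}}(E_{k,l}-E_{l,k})$ and $\frac{i}{\sqrt{2N}}(E_{k,l}+E_{l,k})$ for $1\le k<l\le N$, and $\frac{i}{\sqrt N}E_{k,k}$ for $1\le k\le N$. Let $X_t=\sum_{\xi\in\mathcal{B}}B_\xi(t)\,\xi$ where the $B_\xi$ are i.i.d. standard real Brownian motions. The Brownian motion $(U_t^N)_{t\ge0}$ on the unitary group $\mathbb{U}_N$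 is the unique strong solution of the Itô equation $dU_t^N=U_t^N\,dX_t-\frac12U_t^N\,dt$, $U_0^N=I$. $R^N,S^N\in\mathcal{M}_N$ are deterministic self-adjoint symmetries, i.e. $(R^N)^\star=R^N$, $(R^N)^2=I$, and likewise for $S^N$. Set $A_t^N=R^NU_t^NS^N(U_t^N)^\star$ for $t\ge0$, and $F_n^N(t)=\frac1N\mathbb{E}\left[\mathrm{Tr}\big((A_t^N)^n\big)\right]$ for $n\ge1$. *)

theory Defs
  imports "HOL-Probability.Probability"
begin

type_synonym 'n cmat = "complex^'n^'n"

text \<open>On \<open>'n cmat\<close> the class operations \<open>*\<close> and \<open>^\<close> act entrywise; the matrix product is \<open>**\<close>.\<close>

definition cmat_scale :: "complex \<Rightarrow> 'n::finite cmat \<Rightarrow> 'n cmat" where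
  "cmat_scale c A = (\<chi> i j. c * A $ i $ j)"

definition cadjoint :: "'n::finite cmat \<Rightarrow> 'n cmat" where
  "cadjoint A = (\<chi> i j. cnj (A $ j $ i))"

primrec matpow :: "'n::finite cmat \<Rightarrow> nat \<Rightarrow> 'n cmat" where
  "matpow A 0 = mat 1"
| "matpow A (Suc k) = A ** matpow A k"

definition ntrace :: "'n::finite cmat \<Rightarrow> complex" where
  "ntrace A = trace A / of_nat CARD('n)"

definition self_adjoint_symmetry :: "'n::finite cmat \<Rightarrow> bool" where
  "self_adjoint_symmetry A \<longleftrightarrow> cadjoint A = A \<and> A ** A = mat 1"

definition matrix_unit :: "'n \<Rightarrow> 'n \<Rightarrow> 'n::finite cmat" where
  "matrix_unit k l = (\<chi> i j. if i = k \<and> j = l then 1 else 0)"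

text \<open>
  The orthonormal basis of the skew-Hermitian matrices for the inner product
  \<open>- N Tr (A B)\<close>, with \<open>N = CARD('n)\<close>. The linear order on the index type only serves to
  select one of the pairs \<open>(k, l)\<close>, \<open>(l, k)\<close>.
\<close>

definition skew_basis :: "('n::{finite,linorder} cmat) set" where
  "skew_basis =
     {cmat_scale (1 / of_real (sqrt (2 * real CARD('n)))) (matrix_unit k l - matrix_unit l k) | k l. k < l}
   \<union> {cmat_scale (\<i> / of_real (sqrt (2 * real CARD('n)))) (matrix_unit k l + matrix_unit l k) | k l. k < l}
   \<union> {cmat_scale (\<i> / of_real (sqrt (real CARD('n)))) (matrix_unit k k) | k. True}"

definition past_sets :: "'a measure \<Rightarrow> (real \<Rightarrow> 'a \<Rightarrow> real) \<Rightarrow> real \<Rightarrow> 'a set set" where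
  "past_sets M W s = sigma_sets (space M)
     {W u -` A \<inter> space M | u A. 0 \<le> u \<and> u \<le> s \<and> A \<in> sets borel}"

text \<open>The second parameter of \<^const>\<open>normal_density\<close> is the standard deviation.\<close>

definition std_brownian_motion :: "'a measure \<Rightarrow> (real \<Rightarrow> 'a \<Rightarrow> real) \<Rightarrow> bool" where
  "std_brownian_motion M W \<longleftrightarrow>
     (\<forall>t\<ge>0. W t \<in> borel_measurable M) \<and>
     (AE \<omega> in M. W 0 \<omega> = 0) \<and>
     (AE \<omega> in M. continuous_on {0..} (\<lambda>t. W t \<omega>)) \<and>
     (\<forall>s t. 0 \<le> s \<and> s < t \<longrightarrow>
        distributed M lborel (\<lambda>\<omega>. W t \<omega> - W s \<omega>) (normal_density 0 (sqrt (t - s))) \<and>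
        prob_space.indep_set M (past_sets M W s)
          {(\<lambda>\<omega>. W t \<omega> - W s \<omega>) -` A \<inter> space M | A. A \<in> sets borel})"

text \<open>
  Independence of the family of processes is independence of the associated random elements of
  the path space \<open>\<real>\<^bsup>[0,\<infinity>)\<^esup>\<close> with the product sigma algebra.
\<close>

definition iid_brownian_motions ::
    "'a measure \<Rightarrow> 'i set \<Rightarrow> ('i \<Rightarrow> real \<Rightarrow> 'a \<Rightarrow> real) \<Rightarrow> bool" where
  "iid_brownian_motions M J B \<longleftrightarrow>
     (\<forall>\<xi>\<in>J. std_brownian_motion M (B \<xi>)) \<and>
     prob_space.indep_vars M (\<lambda>_. PiM {0..} (\<lambda>_. borel)) (\<lambda>\<xi> \<omega>. \<lambda>t\<in>{0..}. B \<xi> t \<omega>) J"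

text \<open>The filtration generated by the family, augmented by the null sets.\<close>

definition brownian_filtration ::
    "'a measure \<Rightarrow> 'i set \<Rightarrow> ('i \<Rightarrow> real \<Rightarrow> 'a \<Rightarrow> real) \<Rightarrow> real \<Rightarrow> 'a measure" where
  "brownian_filtration M J B t = sigma (space M)
     ({B \<xi> s -` A \<inter> space M | \<xi> s A. \<xi> \<in> J \<and> 0 \<le> s \<and> s \<le> t \<and> A \<in> sets borel} \<union> null_sets M)"

definition skew_brownian_motion ::
    "('n::{finite,linorder} cmat \<Rightarrow> real \<Rightarrow> 'a \<Rightarrow> real) \<Rightarrow> real \<Rightarrow> 'a \<Rightarrow> 'n cmat" where
  "skew_brownian_motion B t \<omega> = (\<Sum>\<xi>\<in>skew_basis. B \<xi> t \<omega> *\<^sub>R \<xi>)"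

text \<open>
  A bounded simple process on \<open>[0, t]\<close> is given by a partition \<open>0 = \<tau> 0 < \<dots> < \<tau> m = t\<close> and bounded
  matrices \<open>Z i\<close> measurable at time \<open>\<tau> i\<close>; its value on \<open>(\<tau> i, \<tau> (i + 1)]\<close> is \<open>Z i\<close>.
\<close>

definition is_simple_process ::
    "(real \<Rightarrow> 'a measure) \<Rightarrow> real \<Rightarrow> nat \<Rightarrow> (nat \<Rightarrow> real) \<Rightarrow> (nat \<Rightarrow> 'a \<Rightarrow> 'n::finite cmat) \<Rightarrow> bool" where
  "is_simple_process F t m \<tau> Z \<longleftrightarrow>
     \<tau> 0 = 0 \<and> \<tau> m = t \<and> strict_mono_on {..m} \<tau> \<and>
     (\<forall>i<m. Z i \<in> borel_measurable (F (\<tau> i)) \<and> (\<exists>C. \<forall>\<omega>\<in>space (F (\<tau> i)). norm (Z i \<omega>) \<le> C))"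

definition simple_process ::
    "nat \<Rightarrow> (nat \<Rightarrow> real) \<Rightarrow> (nat \<Rightarrow> 'a \<Rightarrow> 'n::finite cmat) \<Rightarrow> real \<Rightarrow> 'a \<Rightarrow> 'n cmat" where
  "simple_process m \<tau> Z s \<omega> = (\<Sum>i<m. indicator {\<tau> i<..\<tau> (Suc i)} s *\<^sub>R Z i \<omega>)"

definition simple_integral ::
    "(real \<Rightarrow> 'a \<Rightarrow> 'n::finite cmat) \<Rightarrow> nat \<Rightarrow> (nat \<Rightarrow> real) \<Rightarrow> (nat \<Rightarrow> 'a \<Rightarrow> 'n cmat) \<Rightarrow>
     'a \<Rightarrow> 'n cmat" where
  "simple_integral X m \<tau> Z \<omega> = (\<Sum>i<m. Z i \<omega> ** (X (\<tau> (Suc i)) \<omega> - X (\<tau> i) \<omega>))"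

text \<open>
  \<open>has_ito_integral M F X H t J\<close> states that \<open>J\<close> is (a version of) the Ito integral of \<open>H dX\<close> over
  \<open>[0, t]\<close>, where \<open>H\<close> is measurable and adapted: \<open>J\<close> is the limit in \<open>L\<^sup>2(M)\<close> of the integrals of
  bounded simple processes that converge to \<open>H\<close> in \<open>L\<^sup>2([0, t] \<times> M)\<close>. The definition is meant
  for a Brownian motion \<open>X\<close> with respect to \<open>F\<close>, where the Ito isometry makes \<open>J\<close> exist and be
  almost surely unique for each measurable adapted \<open>H\<close> with \<open>E \<integral> norm (H s)\<^sup>2 ds < \<infinity>\<close>.
\<close>

definition has_ito_integral ::
    "'a measure \<Rightarrow> (real \<Rightarrow> 'a measure) \<Rightarrow> (real \<Rightarrow> 'a \<Rightarrow> 'n::finite cmat) \<Rightarrow>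
     (real \<Rightarrow> 'a \<Rightarrow> 'n cmat) \<Rightarrow> real \<Rightarrow> ('a \<Rightarrow> 'n cmat) \<Rightarrow> bool" where
  "has_ito_integral M F X H t J \<longleftrightarrow>
     (\<lambda>(s, \<omega>). H s \<omega>) \<in> borel_measurable (restrict_space borel {0..t} \<Otimes>\<^sub>M M) \<and>
     (\<forall>s\<in>{0..t}. H s \<in> borel_measurable (F s)) \<and>
     J \<in> borel_measurable M \<and>
     (\<exists>m \<tau> Z. (\<forall>k. is_simple_process F t (m k) (\<tau> k) (Z k)) \<and>
        (\<lambda>k. \<integral>\<^sup>+\<omega>. (\<integral>\<^sup>+s\<in>{0..t}. ennreal ((norm (simple_process (m k) (\<tau> k) (Z k) s \<omega> - H s \<omega>))\<^sup>2)
               \<partial>lborel) \<partial>M) \<longlonglongrightarrow> 0 \<and>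
        (\<lambda>k. \<integral>\<^sup>+\<omega>. ennreal ((norm (simple_integral X (m k) (\<tau> k) (Z k) \<omega> - J \<omega>))\<^sup>2) \<partial>M) \<longlonglongrightarrow> 0)"

text \<open>
  \<open>U\<close> is a strong solution, driven by the Brownian motions \<open>B \<xi>\<close>, of
  \<open>dU = U dX - 1/2 U dt\<close>, \<open>U 0 = I\<close>: continuous, adapted to the augmented filtration of the driving
  Brownian motions, and satisfying the integrated equation. That \<open>U\<close> takes unitary values almost
  surely is a consequence and not part of the definition.
\<close>

definition unitary_brownian_motion ::
    "'a measure \<Rightarrow> ('n::{finite,linorder} cmat \<Rightarrow> real \<Rightarrow> 'a \<Rightarrow> real) \<Rightarrow>
     (real \<Rightarrow> 'a \<Rightarrow> 'n cmat) \<Rightarrow> bool" where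
  "unitary_brownian_motion M B U \<longleftrightarrow>
     iid_brownian_motions M skew_basis B \<and>
     (AE \<omega> in M. U 0 \<omega> = mat 1) \<and>
     (AE \<omega> in M. continuous_on {0..} (\<lambda>t. U t \<omega>)) \<and>
     (\<forall>t\<ge>0. U t \<in> borel_measurable (brownian_filtration M skew_basis B t)) \<and>
     (\<forall>t\<ge>0. \<exists>J. has_ito_integral M (brownian_filtration M skew_basis B) (skew_brownian_motion B) U t J \<and>
        (AE \<omega> in M. U t \<omega> = U 0 \<omega> + J \<omega> - (1/2) *\<^sub>R integral {0..t} (\<lambda>s. U s \<omega>)))"

definition sym_process ::
    "'n::finite cmat \<Rightarrow> 'n cmat \<Rightarrow> (real \<Rightarrow> 'a \<Rightarrow> 'n cmat) \<Rightarrow> real \<Rightarrow> 'a \<Rightarrow> 'n cmat" where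
  "sym_process R S U t \<omega> = R ** U t \<omega> ** S ** cadjoint (U t \<omega>)"

definition trace_moment ::
    "'a measure \<Rightarrow> 'n::finite cmat \<Rightarrow> 'n cmat \<Rightarrow> (real \<Rightarrow> 'a \<Rightarrow> 'n cmat) \<Rightarrow> nat \<Rightarrow> real \<Rightarrow> complex" where
  "trace_moment M R S U n t =
     (1 / of_nat CARD('n)) * (\<integral>\<omega>. trace (matpow (sym_process R S U t \<omega>) n) \<partial>M)"

end

theory Submission
  imports Defs
begin

text \<open>
  The moments are computed along an approximation of the unitary Brownian motion by a random walk on
  the unitary group, so that the only piece of stochastic calculus that enters is the Ito isometry.

  Fix a mesh \<open>\<delta>\<close> and let \<open>x k\<close> be the increment of the driving
  process \<open>X\<close> over \<open>[k \<delta>, (k + 1) \<delta>]\<close>. The Cayley transform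
  \<open>(1 + x/2) (1 - x/2)\<^sup>-\<^sup>1\<close> of a skew-Hermitian matrix is unitary and
  agrees with \<open>1 + x + x\<^sup>2/2\<close> up to an error of third order; multiplying the
  Cayley transforms of the increments gives a walk \<open>V k\<close> (\<open>scheme\<close>) in the
  unitary group. As \<open>x\<^sup>2\<close> has mean \<open>- \<delta>\<close>, its second order
  term reproduces the drift \<open>- U/2 dt\<close>. Subtracting the telescoped walk from the
  equation of \<open>U\<close> leaves a stochastic integral of \<open>U - V\<close>, a time integral
  of \<open>U - V\<close>, an orthogonal sum of the fluctuations \<open>x\<^sup>2 + \<delta>\<close>
  and a sum of third order remainders. The isometry (\<open>ito_isometry\<close>,
  \<open>ito_comparison\<close>) bounds the first of these by the time integral of the mean square
  of \<open>U - V\<close>, and a Gronwall argument gives a mean square error of order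
  \<open>\<delta>\<close> (\<open>scheme_error\<close>). In particular \<open>U t\<close> is a mean
  square limit of unitary matrices, hence almost surely unitary (\<open>U_unitary\<close>).

  For the walk one step of the computation is algebra. Put \<open>R' = V\<^sup>* R V\<close> and
  \<open>A = R' S\<close>; the trace of the \<open>n\<close>-th power of \<open>R V c S c\<^sup>*
  V\<^sup>*\<close>, with \<open>c\<close> the Cayley transform of \<open>x\<close>, is expanded to
  second order in \<open>x\<close> (\<open>jet_conjugated_power\<close>). The first order term has
  mean zero, because \<open>x\<close> is centered and independent of the past. In the second order
  term every summand has the form \<open>Tr (P x Q x)\<close>, whose conditional mean is \<open>-
  \<delta>/N Tr P Tr Q\<close> by the contraction identity of the basis
  (\<open>skew_basis_contraction\<close>). The sum of the contracted terms is \<open>\<delta>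
  N\<close> times the right-hand side of the theorem (\<open>second_order_form_drift\<close>): two
  distinct factors \<open>A\<close> produce the products \<open>tr (A\<^sup>p) tr
  (A\<^sup>n\<^sup>-\<^sup>p)\<close>, while the words \<open>A\<^sup>p R'\<close> and \<open>S
  A\<^sup>p\<close> are palindromes in two involutions and so have the trace of their middle letter,
  which is where \<open>\<alpha>\<close> and \<open>\<beta>\<close> and the dependence on the parity
  of \<open>n\<close> come from.

  Summing over the steps and letting \<open>\<delta>\<close> tend to zero gives the integrated
  identity (\<open>trace_power_integral\<close>). Its integrand is continuous in time by dominated
  convergence, so the fundamental theorem of calculus yields the derivative.
\<close>

section \<open>Trace, adjoint and Frobenius norm of complex matrices\<close>

lemma norm_cmat_power2: "(norm (A :: 'n::finite cmat))\<^sup>2 = (\<Sum>i\<in>UNIV. \<Sum>j\<in>UNIV. (norm (A $ i $ j))\<^sup>2)"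
  by (simp add: norm_vec_def L2_set_def sum_nonneg)

lemma norm_matrix_mult_le: "norm (A ** B) \<le> norm A * norm B" for A B :: "'n::finite cmat"
proof (rule power2_le_imp_le)
  have entry: "(norm ((A ** B) $ i $ j))\<^sup>2
      \<le> (\<Sum>k\<in>UNIV. (norm (A $ i $ k))\<^sup>2) * (\<Sum>k\<in>UNIV. (norm (B $ k $ j))\<^sup>2)" for i j
  proof -
    have "norm ((A ** B) $ i $ j) \<le> (\<Sum>k\<in>UNIV. norm (A $ i $ k) * norm (B $ k $ j))"
      unfolding matrix_matrix_mult_def by (simp add: sum_norm_le norm_mult)
    then have "(norm ((A ** B) $ i $ j))\<^sup>2 \<le> (\<Sum>k\<in>UNIV. norm (A $ i $ k) * norm (B $ k $ j))\<^sup>2"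
      by (intro power_mono) auto
    also have "\<dots> \<le> (\<Sum>k\<in>UNIV. (norm (A $ i $ k))\<^sup>2) * (\<Sum>k\<in>UNIV. (norm (B $ k $ j))\<^sup>2)"
      by (rule Cauchy_Schwarz_ineq_sum)
    finally show ?thesis .
  qed
  have "(norm (A ** B))\<^sup>2
      \<le> (\<Sum>i\<in>UNIV. \<Sum>j\<in>UNIV. (\<Sum>k\<in>UNIV. (norm (A $ i $ k))\<^sup>2) * (\<Sum>k\<in>UNIV. (norm (B $ k $ j))\<^sup>2))"
    unfolding norm_cmat_power2 by (intro sum_mono entry)
  also have "\<dots> = (\<Sum>i\<in>UNIV. \<Sum>k\<in>UNIV. (norm (A $ i $ k))\<^sup>2)
      * (\<Sum>j\<in>UNIV. \<Sum>k\<in>UNIV. (norm (B $ k $ j))\<^sup>2)"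
    by (simp add: sum_product)
  also have "(\<Sum>j\<in>UNIV. \<Sum>k\<in>UNIV. (norm (B $ k $ j))\<^sup>2) = (\<Sum>k\<in>UNIV. \<Sum>j\<in>UNIV. (norm (B $ k $ j))\<^sup>2)"
    by (rule sum.swap)
  finally show "(norm (A ** B))\<^sup>2 \<le> (norm A * norm B)\<^sup>2"
    by (simp add: norm_cmat_power2 power_mult_distrib)
qed simp

interpretation matmul: bounded_bilinear "(**) :: 'n::finite cmat \<Rightarrow> 'n cmat \<Rightarrow> 'n cmat"
proof
  fix a a' b b' :: "'n cmat" and r :: real
  show "(a + a') ** b = a ** b + a' ** b"
    by (simp add: matrix_matrix_mult_def vec_eq_iff sum.distrib distrib_right)
  show "a ** (b + b') = a ** b + a ** b'"
    by (rule matrix_add_ldistrib)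
  show "(r *\<^sub>R a) ** b = r *\<^sub>R (a ** b)"
    by (simp add: matrix_matrix_mult_def vec_eq_iff scaleR_sum_right)
  show "a ** (r *\<^sub>R b) = r *\<^sub>R (a ** b)"
    by (simp add: matrix_matrix_mult_def vec_eq_iff scaleR_sum_right)
  show "\<exists>K. \<forall>(a :: 'n cmat) (b :: 'n cmat). norm (a ** b) \<le> norm a * norm b * K"
    by (rule exI[of _ 1]) (simp add: norm_matrix_mult_le)
qed

lemmas matmul_simps = matmul.add_left matmul.add_right matmul.diff_left matmul.diff_right
  matmul.scaleR_left matmul.scaleR_right matmul.minus_left matmul.minus_right
  matmul.zero_left matmul.zero_right

lemma matmul_mono: "norm A \<le> a \<Longrightarrow> norm B \<le> b \<Longrightarrow> norm (A ** B) \<le> a * b" for A B :: "'n::finite cmat"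
  using norm_matrix_mult_le[of A B] mult_mono[of "norm A" a "norm B" b] norm_ge_zero[of A]
  by (smt (verit) norm_ge_zero)

lemma bounded_linear_trace: "bounded_linear (trace :: 'n::finite cmat \<Rightarrow> complex)"
  unfolding linear_conv_bounded_linear[symmetric]
  by (rule linearI) (simp_all add: trace_def sum.distrib scaleR_sum_right)

lemmas trace_simps = linear_simps[OF bounded_linear_trace]
lemmas trace_sum = bounded_linear.linear[OF bounded_linear_trace, THEN linear_sum]

lemma norm_entry_le: "norm ((A :: 'n::finite cmat) $ i $ j) \<le> norm A"
  by (rule order_trans[OF Finite_Cartesian_Product.norm_nth_le Finite_Cartesian_Product.norm_nth_le])

lemma norm_trace_le: "norm (trace (A :: 'n::finite cmat)) \<le> of_nat CARD('n) * norm A"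
proof -
  have "norm (trace A) \<le> (\<Sum>i\<in>(UNIV :: 'n set). norm A)"
    unfolding trace_def by (intro sum_norm_le norm_entry_le)
  then show ?thesis by simp
qed

lemma bounded_linear_cadjoint: "bounded_linear (cadjoint :: 'n::finite cmat \<Rightarrow> 'n cmat)"
  unfolding linear_conv_bounded_linear[symmetric]
  by (rule linearI) (simp_all add: cadjoint_def vec_eq_iff)

lemmas cadjoint_simps = linear_simps[OF bounded_linear_cadjoint]
lemmas cadjoint_sum = bounded_linear.linear[OF bounded_linear_cadjoint, THEN linear_sum]

lemma cadjoint_cadjoint [simp]: "cadjoint (cadjoint A) = A"
  by (simp add: cadjoint_def vec_eq_iff)

lemma cadjoint_mult: "cadjoint (A ** B) = cadjoint B ** cadjoint A"
  by (simp add: cadjoint_def vec_eq_iff matrix_matrix_mult_def mult.commute)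

lemma cadjoint_one [simp]: "cadjoint (mat 1) = mat 1"
  by (auto simp: cadjoint_def vec_eq_iff mat_def)

lemma norm_cadjoint [simp]: "norm (cadjoint A) = norm (A :: 'n::finite cmat)"
proof -
  have "(norm (cadjoint A))\<^sup>2 = (norm A)\<^sup>2"
    unfolding norm_cmat_power2 cadjoint_def by (simp, subst sum.swap, simp)
  then show ?thesis by simp
qed

lemma inner_cmat: "inner A B = Re (trace (A ** cadjoint B))" for A B :: "'n::finite cmat"
  by (simp add: inner_vec_def trace_def matrix_matrix_mult_def cadjoint_def inner_complex_def)

lemma continuous_on_matpow [continuous_intros]:
  "continuous_on S f \<Longrightarrow> continuous_on S (\<lambda>x. matpow (f x :: 'n::finite cmat) n)"
  by (induction n) (auto intro!: continuous_intros matmul.continuous_on)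

lemma continuous_on_trace [continuous_intros]:
  "continuous_on S f \<Longrightarrow> continuous_on S (\<lambda>x. trace (f x :: 'n::finite cmat))"
  by (rule bounded_linear.continuous_on[OF bounded_linear_trace])

lemma continuous_on_cadjoint [continuous_intros]:
  "continuous_on S f \<Longrightarrow> continuous_on S (\<lambda>x. cadjoint (f x :: 'n::finite cmat))"
  by (rule bounded_linear.continuous_on[OF bounded_linear_cadjoint])

lemma borel_measurable_cadjoint [measurable]:
  "f \<in> borel_measurable M \<Longrightarrow> (\<lambda>x. cadjoint (f x :: 'n::finite cmat)) \<in> borel_measurable M"
  by (rule borel_measurable_continuous_on[OF continuous_on_cadjoint[OF continuous_on_id]])

lemma borel_measurable_matmul [measurable]:
  "f \<in> borel_measurable M \<Longrightarrow> g \<in> borel_measurable M \<Longrightarrow>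
    (\<lambda>x. f x ** g x) \<in> borel_measurable M" for f g :: "'a \<Rightarrow> 'n::finite cmat"
  by (rule borel_measurable_continuous_Pair[where H = "(**)"])
     (assumption | intro matmul.continuous_on continuous_intros)+

lemma borel_measurable_entry [measurable]:
  "f \<in> borel_measurable M \<Longrightarrow> (\<lambda>x. (f x :: 'n::finite cmat) $ i $ j) \<in> borel_measurable M"
  by (rule borel_measurable_continuous_on[where f = "\<lambda>A. A $ i $ j"]) (intro continuous_intros)

section \<open>Unitary matrices\<close>

definition unitary :: "'n::finite cmat \<Rightarrow> bool" where
  "unitary A \<longleftrightarrow> A ** cadjoint A = mat 1"

lemma unitary_cadjoint_mult: "unitary A \<Longrightarrow> cadjoint A ** A = mat 1"
  using matrix_left_right_inverse unfolding unitary_def by blast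

lemma unitary_one: "unitary (mat 1)"
  by (simp add: unitary_def)

lemma unitary_mult: "unitary A \<Longrightarrow> unitary B \<Longrightarrow> unitary (A ** B)"
proof -
  assume "unitary A" "unitary B"
  have "(A ** B) ** cadjoint (A ** B) = A ** (B ** cadjoint B) ** cadjoint A"
    by (simp add: cadjoint_mult matrix_mul_assoc)
  then show ?thesis
    using \<open>unitary A\<close> \<open>unitary B\<close> by (simp add: unitary_def)
qed

lemma norm_unitary_mult: "unitary A \<Longrightarrow> norm (A ** B) = norm B" for A B :: "'n::finite cmat"
proof -
  assume A: "unitary A"
  have "trace ((A ** B) ** cadjoint (A ** B)) = trace (A ** (B ** cadjoint B ** cadjoint A))"
    by (simp add: cadjoint_mult matrix_mul_assoc)
  also have "\<dots> = trace (B ** cadjoint B ** (cadjoint A ** A))"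
    by (subst trace_mul_sym) (simp add: matrix_mul_assoc)
  also have "\<dots> = trace (B ** cadjoint B)"
    using A by (simp add: unitary_cadjoint_mult)
  finally show ?thesis
    by (simp add: norm_eq_sqrt_inner inner_cmat)
qed

lemma norm_mat_one: "(norm (mat 1 :: 'n::finite cmat))\<^sup>2 = CARD('n)"
  unfolding power2_norm_eq_inner inner_cmat by (simp, simp add: trace_def mat_def)

lemma norm_unitary: "unitary A \<Longrightarrow> norm A = sqrt CARD('n)" for A :: "'n::finite cmat"
  using norm_unitary_mult[of A "mat 1"] norm_mat_one[where 'n = 'n]
  by (metis matrix_mul_rid norm_ge_zero real_sqrt_unique)

lemma norm_unitary_le: "unitary A \<Longrightarrow> norm A \<le> CARD('n)" for A :: "'n::finite cmat"
proof -
  assume "unitary A"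
  have "1 \<le> real CARD('n)"
    by (simp add: Suc_le_eq)
  then have "sqrt CARD('n) \<le> real CARD('n)"
    using real_sqrt_le_iff[of "real CARD('n)" "(real CARD('n))\<^sup>2"] self_le_power[of "real CARD('n)" 2] by simp
  then show ?thesis
    using norm_unitary[OF \<open>unitary A\<close>] by simp
qed

lemma closed_unitary: "closed {A :: 'n::finite cmat. unitary A}"
  unfolding unitary_def
  by (intro closed_Collect_eq continuous_intros matmul.continuous_on)

lemma matpow_commute: "matpow A n ** A = A ** matpow A n"
  by (induction n) (simp_all add: matrix_mul_assoc[symmetric])

lemma matpow_add: "matpow A (m + n) = matpow A m ** matpow A n"
  by (induction m) (simp_all add: matrix_mul_assoc)

text \<open>
  Conjugation by a unitary matrix passes through powers. It moves the current position of the walk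
  onto \<open>R\<close>, so that a single step only multiplies \<open>S\<close>.
\<close>

lemma matpow_conj:
  assumes "cadjoint V ** V = mat 1"
  shows "matpow (V ** A ** cadjoint V) n = V ** matpow A n ** cadjoint V"
proof (induction n)
  case 0
  show ?case
    using assms matrix_left_right_inverse[of "cadjoint V" V] by simp
next
  case (Suc n)
  have "matpow (V ** A ** cadjoint V) (Suc n) = V ** A ** (cadjoint V ** V) ** matpow A n ** cadjoint V"
    using Suc by (simp add: matrix_mul_assoc)
  also have "\<dots> = V ** matpow A (Suc n) ** cadjoint V"
    unfolding assms by (simp add: matrix_mul_assoc)
  finally show ?case .
qed

section \<open>The Cayley transform\<close>

definition skew :: "'n::finite cmat \<Rightarrow> bool" where
  "skew x \<longleftrightarrow> cadjoint x = - x"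

text \<open>
  For skew-Hermitian \<open>x\<close> the matrix \<open>1 - x/2\<close> does not decrease the norm
  of the matrices that it multiplies, hence is invertible with a bound on the inverse that is
  uniform in \<open>x\<close>. All estimates on the Cayley transform below rest on this.
\<close>

definition resolvent :: "'n::finite cmat \<Rightarrow> 'n cmat" where
  "resolvent x = matrix_inv (mat 1 - (1/2) *\<^sub>R x)"

text \<open>
  Since \<open>2 - (1 - x/2) = 1 + x/2\<close>, this is the usual \<open>(1 + x/2) (1 -
  x/2)\<^sup>-\<^sup>1\<close>. Unlike the exponential, it is a rational function of
  \<open>x\<close>, and its Taylor remainders are again products of \<open>x\<close> and the
  resolvent.
\<close>

definition cayley :: "'n::finite cmat \<Rightarrow> 'n cmat" where
  "cayley x = 2 *\<^sub>R resolvent x - mat 1"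

text \<open>
  The cross term vanishes because \<open>x\<close> is skew with respect to the real inner product.
\<close>

lemma skew_norm_resolvent:
  fixes x Z :: "'n::finite cmat"
  assumes "skew x"
  shows "(norm ((mat 1 - (1/2) *\<^sub>R x) ** Z))\<^sup>2 = (norm Z)\<^sup>2 + (norm (x ** Z))\<^sup>2 / 4"
proof -
  have "inner Z (x ** Z) = 0"
  proof -
    have "inner Z (x ** Z) = Re (trace (Z ** cadjoint Z ** cadjoint x))"
      by (simp add: inner_cmat cadjoint_mult matrix_mul_assoc)
    also have "\<dots> = - Re (trace ((Z ** cadjoint Z) ** x))"
      using assms by (simp add: skew_def matmul_simps trace_simps)
    also have "\<dots> = - Re (trace (x ** Z ** cadjoint Z))"
      by (subst trace_mul_sym) (simp add: matrix_mul_assoc)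
    also have "\<dots> = - inner (x ** Z) Z"
      by (simp add: inner_cmat)
    finally show ?thesis by (simp add: inner_commute)
  qed
  then show ?thesis
    by (simp add: power2_norm_eq_inner matmul_simps inner_diff_left inner_diff_right inner_commute)
qed

lemma
  assumes "skew x"
  shows resolvent_left: "resolvent x ** (mat 1 - (1/2) *\<^sub>R x) = mat 1"
    and resolvent_right: "(mat 1 - (1/2) *\<^sub>R x) ** resolvent x = mat 1"
proof -
  let ?A = "mat 1 - (1/2) *\<^sub>R x"
  have "v = 0" if "?A *v v = 0" for v
  proof -
    define Z :: "'a cmat" where "Z = (\<chi> i j. v $ i)"
    have "?A ** Z = 0"
      using that by (simp add: Z_def matrix_matrix_mult_def matrix_vector_mult_def vec_eq_iff)
    then have "Z = 0"
      using skew_norm_resolvent[OF assms, of Z] by (simp add: sum_power2_eq_zero_iff add_nonneg_eq_0_iff)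
    then show "v = 0" by (simp add: Z_def vec_eq_iff)
  qed
  then have "\<exists>B. B ** ?A = mat 1"
    using matrix_left_invertible_ker by blast
  then have "invertible ?A"
    using matrix_left_right_inverse unfolding invertible_def by blast
  then show "resolvent x ** ?A = mat 1" "?A ** resolvent x = mat 1"
    unfolding resolvent_def invertible_def matrix_inv_def
    by (metis (mono_tags, lifting) someI_ex)+
qed

lemma resolvent_eq: 
  assumes "skew x"
  shows "resolvent x = mat 1 + (1/2) *\<^sub>R (x ** resolvent x)"
  using resolvent_right[OF assms] by (simp add: matmul_simps algebra_simps)

lemma norm_resolvent_le:
  fixes x :: "'n::finite cmat"
  assumes "skew x"
  shows "norm (resolvent x) \<le> CARD('n)"
proof (rule order_trans)
  have "(norm (resolvent x))\<^sup>2 \<le> (norm (mat 1 :: 'n cmat))\<^sup>2"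
    using skew_norm_resolvent[OF assms, of "resolvent x"] resolvent_right[OF assms] by simp
  then show "norm (resolvent x) \<le> norm (mat 1 :: 'n cmat)"
    by (rule power2_le_imp_le) simp
qed (rule norm_unitary_le[OF unitary_one])

text \<open>
  Sandwiching \<open>(1 - x/2) + (1 + x/2) = 2\<close> between the resolvent and its adjoint gives
  \<open>2 D D\<^sup>* = D + D\<^sup>*\<close>, which is unitarity of \<open>2 D - 1\<close>.
\<close>

lemma cayley_unitary:
  assumes "skew x"
  shows "unitary (cayley x)"
proof -
  let ?D = "resolvent x" and ?A = "mat 1 - (1/2) *\<^sub>R x"
  have adj: "cadjoint ?A = mat 1 + (1/2) *\<^sub>R x"
    using assms by (simp add: cadjoint_simps skew_def)
  have 1: "?A ** ?D = mat 1" "?D ** ?A = mat 1"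
    using resolvent_left resolvent_right assms by auto
  then have 2: "cadjoint ?D ** cadjoint ?A = mat 1" "cadjoint ?A ** cadjoint ?D = mat 1"
    by (metis cadjoint_mult cadjoint_one)+
  have "?A + cadjoint ?A = 2 *\<^sub>R mat 1"
    by (simp add: adj scaleR_2)
  then have "2 *\<^sub>R (?D ** cadjoint ?D) = ?D ** (?A + cadjoint ?A) ** cadjoint ?D"
    by (simp only: matmul.scaleR_left matmul.scaleR_right matrix_mul_rid)
  also have "\<dots> = (?D ** ?A) ** cadjoint ?D + ?D ** (cadjoint ?A ** cadjoint ?D)"
    by (simp add: matmul.add_left matmul.add_right matrix_mul_assoc)
  also have "\<dots> = ?D + cadjoint ?D"
    by (simp add: 1 2 add.commute)
  finally have "2 *\<^sub>R (2 *\<^sub>R (?D ** cadjoint ?D)) = 2 *\<^sub>R ?D + 2 *\<^sub>R cadjoint ?D"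
    by (simp only: scaleR_right_distrib)
  moreover have "cayley x ** cadjoint (cayley x)
      = 2 *\<^sub>R (2 *\<^sub>R (?D ** cadjoint ?D)) - 2 *\<^sub>R ?D - 2 *\<^sub>R cadjoint ?D + mat 1"
    unfolding cayley_def by (simp add: cadjoint_simps matmul_simps scaleR_right_diff_distrib)
  ultimately show ?thesis
    by (simp add: unitary_def)
qed

text \<open>
  Each order is obtained by substituting the resolvent equation into the previous one.
\<close>

lemma
  assumes "skew x"
  shows cayley_expand1: "cayley x - mat 1 = x ** resolvent x"
    and cayley_expand2: "cayley x - mat 1 - x = (1/2) *\<^sub>R (x ** x ** resolvent x)"
    and cayley_expand3: "cayley x - mat 1 - x - (1/2) *\<^sub>R (x ** x) = (1/4) *\<^sub>R (x ** x ** x ** resolvent x)"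
proof -
  let ?D = "resolvent x"
  have D: "?D = mat 1 + (1/2) *\<^sub>R (x ** ?D)"
    by (rule resolvent_eq[OF assms])
  show 1: "cayley x - mat 1 = x ** ?D"
    unfolding cayley_def by (subst D) (simp add: scaleR_right_distrib scaleR_2)
  have "x ** ?D = x + (1/2) *\<^sub>R (x ** x ** ?D)"
    by (subst D) (simp add: matmul_simps matrix_mul_assoc)
  with 1 show 2: "cayley x - mat 1 - x = (1/2) *\<^sub>R (x ** x ** ?D)"
    by simp
  have "x ** x ** ?D = x ** x + (1/2) *\<^sub>R (x ** x ** x ** ?D)"
    by (subst D) (simp add: matmul_simps matrix_mul_assoc)
  with 2 show "cayley x - mat 1 - x - (1/2) *\<^sub>R (x ** x) = (1/4) *\<^sub>R (x ** x ** x ** resolvent x)"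
    by (simp add: scaleR_right_distrib)
qed

lemma norm_cayley_expand3:
  fixes x :: "'n::finite cmat"
  assumes "skew x"
  shows "norm (cayley x - mat 1 - x - (1/2) *\<^sub>R (x ** x)) \<le> CARD('n) * norm x ^ 3"
proof -
  have "norm (x ** x ** x ** resolvent x) \<le> norm x * norm x * norm x * CARD('n)"
    by (intro matmul_mono norm_resolvent_le assms order_refl)
  then have "norm (x ** x ** x ** resolvent x) \<le> CARD('n) * norm x ^ 3"
    by (simp add: power3_eq_cube mult.commute mult.left_commute)
  moreover have "norm (x ** x ** x ** resolvent x) / 4 \<le> norm (x ** x ** x ** resolvent x)"
    by simp
  ultimately have "norm (x ** x ** x ** resolvent x) / 4 \<le> CARD('n) * norm x ^ 3"
    by linarith
  then show ?thesis
    unfolding cayley_expand3[OF assms] by simp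
qed

lemma resolvent_diff:
  assumes "skew x" "skew y"
  shows "resolvent x - resolvent y = (1/2) *\<^sub>R (resolvent x ** (x - y) ** resolvent y)"
proof -
  let ?A = "\<lambda>x. mat 1 - (1/2) *\<^sub>R x"
  have "(1/2) *\<^sub>R (resolvent x ** (x - y) ** resolvent y) = resolvent x ** (?A y - ?A x) ** resolvent y"
    by (simp add: matmul_simps algebra_simps)
  also have "\<dots> = resolvent x ** (?A y ** resolvent y) - (resolvent x ** ?A x) ** resolvent y"
    by (simp add: matmul.diff_left matmul.diff_right matrix_mul_assoc)
  finally show ?thesis
    using assms by (simp add: resolvent_left resolvent_right)
qed

lemma continuous_on_cayley: "continuous_on {x :: 'n::finite cmat. skew x} cayley"
proof -
  have "dist (resolvent x) (resolvent y) \<le> (real CARD('n))\<^sup>2 * dist x y"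
    if "skew x" "skew y" for x y :: "'n cmat"
  proof -
    have "norm (resolvent x ** (x - y) ** resolvent y) \<le> CARD('n) * norm (x - y) * CARD('n)"
      by (intro matmul_mono norm_resolvent_le that order_refl)
    moreover have "dist (resolvent x) (resolvent y) \<le> norm (resolvent x ** (x - y) ** resolvent y)"
      unfolding dist_norm resolvent_diff[OF that] by simp
    ultimately show ?thesis
      by (simp add: power2_eq_square dist_norm mult.commute mult.left_commute)
  qed
  then have "((real CARD('n))\<^sup>2)-lipschitz_on {x :: 'n cmat. skew x} resolvent"
    by (intro lipschitz_onI) auto
  then have "continuous_on {x :: 'n cmat. skew x} resolvent"
    by (rule lipschitz_on_continuous_on)
  then show ?thesis
    unfolding cayley_def by (intro continuous_intros)
qed

text \<open>
  The Cayley transform is continuous on the skew-Hermitian matrices only; composing it with the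
  projection onto them extends it continuously to all matrices.
\<close>

lemma borel_measurable_cayley:
  fixes f :: "'a \<Rightarrow> 'n::finite cmat"
  assumes "f \<in> borel_measurable M" "\<And>\<omega>. skew (f \<omega>)"
  shows "(\<lambda>\<omega>. cayley (f \<omega>)) \<in> borel_measurable M"
proof -
  have "continuous_on UNIV (\<lambda>A :: 'n cmat. cayley ((1/2) *\<^sub>R (A - cadjoint A)))"
    by (rule continuous_on_compose2[OF continuous_on_cayley])
       (auto intro!: continuous_intros simp: skew_def cadjoint_simps algebra_simps)
  from borel_measurable_continuous_on[OF this assms(1)] show ?thesis
    using assms(2) by (simp add: skew_def scaleR_2[symmetric])
qed

section \<open>The basis of the skew-Hermitian matrices\<close>

lemma sum_pairs_split:
  fixes g :: "'n::{finite,linorder} \<Rightarrow> 'n \<Rightarrow> 'b::comm_monoid_add"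
  shows "(\<Sum>k\<in>UNIV. \<Sum>l\<in>UNIV. g k l) = (\<Sum>(k, l)\<in>{(k, l). k < l}. g k l + g l k) + (\<Sum>k\<in>UNIV. g k k)"
proof -
  have "(\<Sum>k\<in>UNIV. \<Sum>l\<in>UNIV. g k l) = (\<Sum>(k, l)\<in>UNIV. g k l)"
    by (simp add: sum.cartesian_product)
  also have "(UNIV :: ('n \<times> 'n) set) = {(k, l). k < l} \<union> ({(k, l). l < k} \<union> {(k, l). k = l})"
    by auto
  also have "(\<Sum>(k, l)\<in>\<dots>. g k l) = (\<Sum>(k, l)\<in>{(k, l). k < l}. g k l)
      + ((\<Sum>(k, l)\<in>{(k, l). l < k}. g k l) + (\<Sum>(k, l)\<in>{(k, l). k = l}. g k l))"
    by (subst sum.union_disjoint, simp, simp, force, subst sum.union_disjoint) auto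
  also have "(\<Sum>(k, l)\<in>{(k, l). l < k}. g k l) = (\<Sum>(k, l)\<in>{(k, l). k < l}. g l k)"
    by (rule sum.reindex_bij_witness[of _ prod.swap prod.swap]) auto
  also have "(\<Sum>(k, l)\<in>{(k, l). k = l}. g k l) = (\<Sum>k\<in>UNIV. g k k)"
    by (rule sum.reindex_bij_witness[of _ "\<lambda>k. (k, k)" fst]) auto
  finally show ?thesis
    by (simp add: sum.distrib case_prod_unfold add.assoc)
qed

lemma skew_basis_eq:
  fixes c :: complex
  assumes c: "c = 1 / of_real (sqrt (2 * real CARD('n::{finite,linorder})))"
  and d: "d = \<i> / of_real (sqrt (real CARD('n)))"
  shows "skew_basis = (\<lambda>(k, l). cmat_scale c (matrix_unit k l - matrix_unit l k :: 'n cmat)) ` {(k, l). k < l}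
   \<union> (\<lambda>(k, l). cmat_scale (\<i> * c) (matrix_unit k l + matrix_unit l k)) ` {(k, l). k < l}
   \<union> range (\<lambda>k. cmat_scale d (matrix_unit k k))"
proof -
  have set2: "{f k l | k l. P k l} = (\<lambda>(k, l). f k l) ` {(k, l). P k l}"
    for f :: "'n \<Rightarrow> 'n \<Rightarrow> 'n cmat" and P
    by auto
  have set1: "{f k | k. True} = range f" for f :: "'n \<Rightarrow> 'n cmat"
    by auto
  have "\<i> / of_real (sqrt (2 * real CARD('n))) = \<i> * c"
    by (simp add: c)
  then show ?thesis
    unfolding skew_basis_def set2 set1 by (simp only: c d)
qed

lemma finite_skew_basis: "finite (skew_basis :: 'n::{finite,linorder} cmat set)"
  unfolding skew_basis_eq[OF refl refl] by simp

text \<open>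
  The basis is given as a set, so sums over it can be written as sums over indices only after
  checking that different indices give different elements. Entries above the diagonal tell the
  off-diagonal elements apart.
\<close>

lemma sum_skew_basis:
  fixes c :: complex and f :: "'n::{finite,linorder} cmat \<Rightarrow> 'b::comm_monoid_add"
  assumes c: "c = 1 / of_real (sqrt (2 * real CARD('n)))" and d: "d = \<i> / of_real (sqrt (real CARD('n)))"
  shows "(\<Sum>\<xi>\<in>skew_basis. f \<xi>) =
     (\<Sum>(k, l)\<in>{(k, l). k < l}. f (cmat_scale c (matrix_unit k l - matrix_unit l k))
        + f (cmat_scale (\<i> * c) (matrix_unit k l + matrix_unit l k)))
     + (\<Sum>k\<in>UNIV. f (cmat_scale d (matrix_unit k k)))"
proof -
  define fa fb :: "'n \<times> 'n \<Rightarrow> 'n cmat" where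
    "fa = (\<lambda>(k, l). cmat_scale c (matrix_unit k l - matrix_unit l k))" and
    "fb = (\<lambda>(k, l). cmat_scale (\<i> * c) (matrix_unit k l + matrix_unit l k))"
  define fc :: "'n \<Rightarrow> 'n cmat" where "fc = (\<lambda>k. cmat_scale d (matrix_unit k k))"
  define P :: "('n \<times> 'n) set" where "P = {(k, l). k < l}"
  have nz: "c \<noteq> 0" "d \<noteq> 0"
    by (simp_all add: c d)
  have a: "fa (k, l) $ i $ j = c * ((if i = k \<and> j = l then 1 else 0) - (if i = l \<and> j
      = k then 1 else 0))" for k l i j
    by (simp add: fa_def cmat_scale_def matrix_unit_def)
  have b: "fb (k, l) $ i $ j = \<i> * c * ((if i = k \<and> j = l then 1 else 0) + (if i = l \<and> j
      = k then 1 else 0))" for k l i j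
    by (simp add: fb_def cmat_scale_def matrix_unit_def)
  have cc: "fc k $ i $ j = (if i = k \<and> j = k then d else 0)" for k i j
    by (simp add: fc_def cmat_scale_def matrix_unit_def)
  have neq: "c \<noteq> \<i> * c" "c \<noteq> - c" "\<i> * c \<noteq> - c"
  proof -
    have "c = of_real (1 / sqrt (2 * real CARD('n)))"
      by (simp add: c)
    then have "Re c \<noteq> 0" "Im c = 0"
      by simp_all
    then show "c \<noteq> \<i> * c" "c \<noteq> - c" "\<i> * c \<noteq> - c"
      by (auto simp: complex_eq_iff)
  qed
  have a': "fa (k', l') $ k $ l = (if k = k' \<and> l = l' then c else 0)" if "k < l" "k' < l'" for k l k' l'
  proof -
    have no_swap: "\<not> (k = l' \<and> l = k')" using that less_asym by metis
    show ?thesis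
      unfolding a if_not_P[OF no_swap] by (cases "k = k' \<and> l = l'") auto
  qed
  have b': "fb (k', l') $ k $ l = (if k = k' \<and> l = l' then \<i> * c else 0)" if "k < l" "k' < l'" for k l k' l'
  proof -
    have no_swap: "\<not> (k = l' \<and> l = k')" using that less_asym by metis
    show ?thesis
      unfolding b if_not_P[OF no_swap] by (cases "k = k' \<and> l = l'") auto
  qed
  have c': "fc m $ k $ l = 0" if "k < l" for k l m
  proof -
    have "\<not> (k = m \<and> l = m)" using that less_irrefl by metis
    then show ?thesis unfolding cc by (rule if_not_P)
  qed
  have inj_a: "inj_on fa P"
  proof (rule inj_onI, clarify)
    fix k l k' l' assume "(k, l) \<in> P" "(k', l') \<in> P" and "fa (k, l) = fa (k', l')"
    then show "k = k' \<and> l = l'"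
      using a'[of k l k l] a'[of k l k' l'] nz(1) unfolding P_def by (metis mem_Collect_eq case_prod_conv)
  qed
  have inj_b: "inj_on fb P"
  proof (rule inj_onI, clarify)
    fix k l k' l' assume "(k, l) \<in> P" "(k', l') \<in> P" and "fb (k, l) = fb (k', l')"
    then show "k = k' \<and> l = l'"
      using b'[of k l k l] b'[of k l k' l'] nz(1) unfolding P_def
      by (metis mem_Collect_eq case_prod_conv mult_eq_0_iff complex_i_not_zero)
  qed
  have inj_c: "inj fc"
  proof (rule injI)
    fix k k' assume "fc k = fc k'"
    then have "fc k $ k $ k = fc k' $ k $ k" by simp
    then show "k = k'"
      using nz(2) unfolding cc by metis
  qed
  have disj_ab: "fa ` P \<inter> fb ` P = {}"
  proof (rule equals0I, clarify)
    fix k l k' l' assume kl: "(k, l) \<in> P" "(k', l') \<in> P" and eq: "fa (k, l) = fb (k', l')"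
    then have "c = \<i> * c \<or> c = 0"
      using a'[of k l k l] b'[of k l k' l'] unfolding P_def by (metis mem_Collect_eq case_prod_conv)
    then show False
      using nz neq by blast
  qed
  have disj_c: "(fa ` P \<union> fb ` P) \<inter> range fc = {}"
  proof (rule equals0I, clarify)
    fix m assume "fc m \<in> fa ` P \<union> fb ` P"
    then obtain k l where k: "k < l" "fc m = fa (k, l) \<or> fc m = fb (k, l)"
      unfolding P_def by blast
    then have "0 = c \<or> 0 = \<i> * c"
      using a'[of k l k l] b'[of k l k l] c'[of k l m] by metis
    then show False
      using nz by simp
  qed
  have "(\<Sum>\<xi>\<in>skew_basis. f \<xi>) = (\<Sum>\<xi>\<in>fa ` P \<union> fb ` P \<union> range fc. f \<xi>)"
    unfolding skew_basis_eq[OF c d] fa_def fb_def fc_def P_def ..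
  also have "\<dots> = (\<Sum>p\<in>P. f (fa p)) + (\<Sum>p\<in>P. f (fb p)) + (\<Sum>k\<in>UNIV. f (fc k))"
    using disj_ab disj_c by (simp add: sum.union_disjoint sum.reindex inj_a inj_b inj_c)
  finally show ?thesis
    by (simp add: sum.distrib P_def fa_def fb_def fc_def case_prod_unfold)
qed

text \<open>
  The covariance of the entries of the driving process. Antisymmetric and symmetric elements
  contribute with opposite signs, so that only the products of \<open>E k l\<close> with \<open>E l
  k\<close> survive, and together with the diagonal elements these run over all pairs of indices.
\<close>

lemma skew_basis_contraction:
  fixes i j r s :: "'n::{finite,linorder}"
  shows "(\<Sum>\<xi>\<in>skew_basis. \<xi> $ i $ j * \<xi> $ r $ s)
      = (if i = s \<and> j = r then - 1 / of_nat CARD('n) else (0 :: complex))"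
proof -
  define N where "N = CARD('n)"
  define c :: complex where "c = 1 / of_real (sqrt (2 * real N))"
  define d :: complex where "d = \<i> / of_real (sqrt (real N))"
  define e :: "'n \<Rightarrow> 'n \<Rightarrow> complex" where "e k l = (if i = k \<and> j = l then 1 else 0)" for k l
  define e' :: "'n \<Rightarrow> 'n \<Rightarrow> complex" where "e' k l = (if r = k \<and> s = l then 1 else 0)" for k l
  have N: "N > 0" by (simp add: N_def)
  have cc: "c * c = 1 / (2 * of_nat N)" "d * d = - 1 / of_nat N"
  proof -
    have sq: "complex_of_real (sqrt x) * of_real (sqrt x) = of_real x" if "x \<ge> 0" for x
      using that by (metis of_real_mult real_sqrt_mult_self abs_of_nonneg)
    show "c * c = 1 / (2 * of_nat N)" "d * d = - 1 / of_nat N"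
      by (simp_all add: c_def d_def sq del: real_sqrt_mult)
  qed
  have "(\<Sum>\<xi>\<in>skew_basis. \<xi> $ i $ j * \<xi> $ r $ s) =
     (\<Sum>(k, l)\<in>{(k, l). k < l}. c * (e k l - e l k) * (c * (e' k l - e' l k))
        + \<i> * c * (e k l + e l k) * (\<i> * c * (e' k l + e' l k)))
     + (\<Sum>k\<in>UNIV. d * e k k * (d * e' k k))"
    by (subst sum_skew_basis[OF c_def[unfolded N_def] d_def[unfolded N_def]])
       (simp add: cmat_scale_def matrix_unit_def e_def e'_def)
  also have "\<dots> = (\<Sum>(k, l)\<in>{(k, l). k < l}. - 2 * (c * c) * (e k l * e' l k + e l k * e' k l))
     + (\<Sum>k\<in>UNIV. d * d * (e k k * e' k k))"
    by (simp add: algebra_simps)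
  also have "\<dots> = (- 1 / of_nat N) *
      ((\<Sum>(k, l)\<in>{(k, l). k < l}. e k l * e' l k + e l k * e' k l) + (\<Sum>k\<in>UNIV. e k k * e' k k))"
    unfolding cc distrib_left sum_distrib_left by (simp add: case_prod_unfold add_divide_distrib)
  also have "\<dots> = (- 1 / of_nat N) * (\<Sum>k\<in>UNIV. \<Sum>l\<in>UNIV. e k l * e' l k)"
    by (subst sum_pairs_split) simp
  also have "(\<Sum>k\<in>UNIV. \<Sum>l\<in>UNIV. e k l * e' l k) = (\<Sum>k\<in>UNIV.
      if i = k then (if s = k \<and> r = j then 1 else 0) else 0)"
  proof (rule sum.cong[OF refl])
    fix k
    have "(\<Sum>l\<in>UNIV. e k l * e' l k) = (\<Sum>l\<in>UNIV. if j = l then (if i = k \<and> s = k \<and> r = j then 1 else 0) else 0)"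
      by (rule sum.cong) (auto simp: e_def e'_def)
    then show "(\<Sum>l\<in>UNIV. e k l * e' l k) = (if i = k then (if s = k \<and> r = j then 1 else 0) else 0)"
      by simp
  qed
  finally show ?thesis
    by (auto simp: N_def)
qed

lemma cadjoint_cmat_scale: "cadjoint (cmat_scale c A) = cmat_scale (cnj c) (cadjoint A)"
  by (simp add: cadjoint_def cmat_scale_def vec_eq_iff)

lemma cadjoint_matrix_unit: "cadjoint (matrix_unit k l) = matrix_unit l k"
  by (auto simp: cadjoint_def matrix_unit_def vec_eq_iff)

lemma cmat_scale_uminus: "cmat_scale (- c) A = - cmat_scale c A" "cmat_scale c (- A) = - cmat_scale c A"
  by (simp_all add: cmat_scale_def vec_eq_iff)

lemma skew_basis_skew:
  fixes \<xi> :: "'n::{finite,linorder} cmat"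
  assumes "\<xi> \<in> skew_basis"
  shows "skew \<xi>"
proof -
  have 1: "cadjoint (matrix_unit k l - matrix_unit l k)
      = - (matrix_unit k l - matrix_unit l k :: 'n cmat)" for k l
    by (simp add: cadjoint_simps cadjoint_matrix_unit)
  have 2: "cadjoint (matrix_unit k l + matrix_unit l k)
      = (matrix_unit k l + matrix_unit l k :: 'n cmat)" for k l
    by (simp add: cadjoint_simps cadjoint_matrix_unit add.commute)
  have 3: "skew (cmat_scale c A)" if "cnj c = c" "cadjoint A = - A" for c and A :: "'n cmat"
    using that by (simp add: skew_def cadjoint_cmat_scale cmat_scale_uminus)
  have 4: "skew (cmat_scale c A)" if "cnj c = - c" "cadjoint A = A" for c and A :: "'n cmat"
    using that by (simp add: skew_def cadjoint_cmat_scale cmat_scale_uminus)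
  from assms show ?thesis
    unfolding skew_basis_def
    by (elim UnE CollectE exE conjE)
       (simp_all only: 3[OF _ 1] 4[OF _ 2] 4[OF _ cadjoint_matrix_unit] complex_cnj_divide complex_cnj_i
          complex_cnj_complex_of_real complex_cnj_one minus_divide_left)
qed

lemma skew_basis_nonempty: "skew_basis \<noteq> {}"
  unfolding skew_basis_def by auto

section \<open>Second order expansion of the trace of a power\<close>

text \<open>
  \<open>power_lin A D n\<close> and \<open>power_quad A D E n\<close> are the terms of first and
  second order in the expansion of the \<open>n\<close>-th power of \<open>A + D + E\<close>, where
  \<open>D\<close> counts as first and \<open>E\<close> as second order. The recursions are those of
  the product rule for jets (\<open>jet_mult\<close>).
\<close>

primrec power_lin :: "'n::finite cmat \<Rightarrow> 'n cmat \<Rightarrow> nat \<Rightarrow> 'n cmat" where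
  "power_lin A D 0 = 0"
| "power_lin A D (Suc n) = A ** power_lin A D n + D ** matpow A n"

primrec power_quad :: "'n::finite cmat \<Rightarrow> 'n cmat \<Rightarrow> 'n cmat \<Rightarrow> nat \<Rightarrow> 'n cmat" where
  "power_quad A D E 0 = 0"
| "power_quad A D E (Suc n) = A ** power_quad A D E n + D ** power_lin A D n + E ** matpow A n"

lemma trace_cycle3: "trace (A ** B ** C) = trace (B ** C ** A)" for A B C :: "'n::finite cmat"
  by (metis matrix_mul_assoc trace_mul_sym)

text \<open>
  By cyclicity all positions of \<open>D\<close> contribute equally. The additional factor
  \<open>A\<^sup>p\<close>, here and in \<open>trace_power_quad\<close>, makes the statement
  inductive.
\<close>

lemma trace_power_lin:
  "trace (matpow A p ** power_lin A D n) = of_nat n * trace (D ** matpow A (p + n - 1))"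
proof (induction n arbitrary: p)
  case (Suc n)
  have "trace (matpow A p ** power_lin A D (Suc n))
      = trace (matpow A (Suc p) ** power_lin A D n) + trace (matpow A p ** D ** matpow A n)"
    by (simp add: matmul_simps trace_simps matrix_mul_assoc matpow_commute)
  also have "trace (matpow A p ** D ** matpow A n) = trace (D ** matpow A (n + p))"
    by (subst trace_cycle3) (simp add: matpow_add matrix_mul_assoc)
  finally show ?case
    using Suc[of "Suc p"] by (simp add: algebra_simps)
qed (simp add: matmul_simps trace_simps)

lemma power_lin_sum: "power_lin A D n = (\<Sum>j<n. matpow A j ** D ** matpow A (n - 1 - j))"
proof (induction n)
  case (Suc n)
  have "(\<Sum>j<Suc n. matpow A j ** D ** matpow A (Suc n - 1 - j))
      = D ** matpow A n + (\<Sum>j<n. matpow A (Suc j) ** D ** matpow A (n - Suc j))"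
    by (subst sum.lessThan_Suc_shift) simp
  also have "(\<Sum>j<n. matpow A (Suc j) ** D ** matpow A (n - Suc j)) = A ** power_lin A D n"
    unfolding Suc by (simp add: matmul.sum_right matrix_mul_assoc)
  finally show ?case by simp
qed simp

lemma trace_power_quad:
  "trace (matpow A p ** power_quad A D E n) = of_nat n * trace (E ** matpow A (p + n - 1))
     + (\<Sum>i<n. \<Sum>j<i. trace (D ** matpow A j ** D ** matpow A (p + n - 2 - j)))"
proof (induction n arbitrary: p)
  case (Suc n)
  have "trace (matpow A p ** power_quad A D E (Suc n))
      = trace (matpow A (Suc p) ** power_quad A D E n) + trace (matpow A p ** (D ** power_lin A D n))
        + trace (matpow A p ** E ** matpow A n)"
    by (simp add: matmul_simps trace_simps matrix_mul_assoc matpow_commute)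
  also have "trace (matpow A p ** E ** matpow A n) = trace (E ** matpow A (n + p))"
    by (subst trace_cycle3) (simp add: matpow_add matrix_mul_assoc)
  also have "trace (matpow A p ** (D ** power_lin A D n))
      = (\<Sum>j<n. trace (D ** matpow A j ** D ** matpow A (p + Suc n - 2 - j)))"
  proof -
    have "trace (matpow A p ** (D ** power_lin A D n)) = trace (D ** power_lin A D n ** matpow A p)"
      by (rule trace_mul_sym)
    also have "\<dots> = (\<Sum>j<n. trace (D ** matpow A j ** D ** (matpow A (n - 1 - j) ** matpow A p)))"
      by (simp add: power_lin_sum matmul.sum_right matmul.sum_left trace_sum matrix_mul_assoc)
    also have "\<dots> = (\<Sum>j<n. trace (D ** matpow A j ** D ** matpow A (p + Suc n - 2 - j)))"
      by (rule sum.cong[OF refl]) (simp add: matpow_add[symmetric] add.commute)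
    finally show ?thesis .
  qed
  finally show ?case
    using Suc[of "Suc p"] by (simp add: algebra_simps)
qed (simp add: matmul_simps trace_simps)

text \<open>
  The second order term of \<open>Tr ((R c S c\<^sup>*)\<^sup>n)\<close>, as a combination of
  expressions \<open>Tr (P x Q x)\<close> with the bilinear form \<open>t\<close> in place of
  \<open>Tr (P x Q x)\<close>. Having \<open>t\<close> as a parameter separates the expansion, where
  \<open>t\<close> depends on the increment \<open>x\<close>, from its mean, where \<open>t\<close>
  is a multiple of the product of traces.
\<close>

definition second_order_form ::
    "('n::finite cmat \<Rightarrow> 'n cmat \<Rightarrow> complex) \<Rightarrow> 'n cmat \<Rightarrow> 'n cmat \<Rightarrow> nat \<Rightarrow> complex" where
  "second_order_form t R S n = (let A = R ** S in
     of_nat n * (t (S ** matpow A (n - 1) ** R) (mat 1) / 2 + t (matpow A (n - 1) ** R ** S) (mat 1) / 2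
        - t (matpow A (n - 1) ** R) S)
     + (\<Sum>i<n. \<Sum>j<i. t (S ** matpow A (n - 2 - j) ** R) (S ** matpow A j ** R)
          - t (matpow A (n - 2 - j) ** R) (S ** matpow A j ** R ** S)
          - t (S ** matpow A (n - 2 - j) ** R ** S) (matpow A j ** R)
          + t (matpow A (n - 2 - j) ** R ** S) (matpow A j ** R ** S)))"

lemma trace_power_quad_form:
  fixes R S x :: "'n::finite cmat"
  shows "trace (power_quad (R ** S) (R ** (x ** S - S ** x))
      (R ** ((1/2) *\<^sub>R (x ** x ** S) + (1/2) *\<^sub>R (S ** x ** x) - x ** S ** x)) n)
    = second_order_form (\<lambda>P Q. trace (P ** x ** Q ** x)) R S n"
proof -
  let ?A = "R ** S" and ?D = "R ** (x ** S - S ** x)"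
  let ?E = "R ** ((1/2) *\<^sub>R (x ** x ** S) + (1/2) *\<^sub>R (S ** x ** x) - x ** S ** x)"
  have cyc: "trace (K ** L) = trace (L ** K)" for K L :: "'n cmat"
    by (rule trace_mul_sym)
  have half: "(1/2) *\<^sub>R z = z / 2" for z :: complex
    by (simp add: scaleR_conv_of_real)
  have 1: "trace (?E ** W)
      = trace (S ** W ** R ** x ** mat 1 ** x) / 2 + trace (W ** R ** S ** x ** mat 1 ** x) / 2
        - trace (W ** R ** x ** S ** x)" for W
    using cyc[of "R ** x ** x" "S ** W"] cyc[of "R ** S ** x ** x" W] cyc[of "R ** x ** S ** x" W]
    by (simp add: matmul_simps trace_simps matrix_mul_assoc half)
  have 2: "trace (?D ** Z ** ?D ** W)
      = trace (S ** W ** R ** x ** (S ** Z ** R) ** x) - trace (W ** R ** x ** (S ** Z ** R ** S) ** x)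
        - trace (S ** W ** R ** S ** x ** (Z ** R) ** x)
            + trace (W ** R ** S ** x ** (Z ** R ** S) ** x)" for Z W
    using cyc[of "R ** x ** S ** Z ** R ** x" "S ** W"] cyc[of "R ** x ** S ** Z ** R ** S ** x" W]
      cyc[of "R ** S ** x ** Z ** R ** x" "S ** W"] cyc[of "R ** S ** x ** Z ** R ** S ** x" W]
    by (simp add: matmul_simps trace_simps matrix_mul_assoc)
  show ?thesis
    using trace_power_quad[of ?A 0 ?D ?E n] unfolding second_order_form_def Let_def 1 2
    by (simp add: 1 2)
qed

text \<open>
  The triangle contains \<open>h j\<close> exactly \<open>n - 1 - j\<close> times; averaging with
  the reflected count \<open>j + 1\<close> gives \<open>n/2\<close> for each \<open>j\<close>.
\<close>

lemma sum_triangle_symmetric: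
  fixes h :: "nat \<Rightarrow> 'a::field_char_0"
  assumes "\<And>j. j < n - 1 \<Longrightarrow> h (n - 2 - j) = h j"
  shows "(\<Sum>i<n. \<Sum>j<i. h j) = of_nat n / 2 * (\<Sum>j<n-1. h j)"
proof -
  have tri: "(\<Sum>i<n. \<Sum>j<i. h j) = (\<Sum>j<n-1. of_nat (n - 1 - j) * h j)" for n
  proof (induction n)
    case (Suc n)
    have "(\<Sum>j<n. of_nat (n - j) * h j) = (\<Sum>j<n. of_nat (n - 1 - j) * h j) + (\<Sum>j<n. h j)"
      unfolding sum.distrib[symmetric]
    proof (rule sum.cong[OF refl])
      fix j assume "j \<in> {..<n}"
      then have "n - j = Suc (n - 1 - j)" by auto
      then show "of_nat (n - j) * h j = of_nat (n - 1 - j) * h j + h j"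
        by (simp only: of_nat_Suc distrib_right mult_1_left add.commute)
    qed
    also have "(\<Sum>j<n. of_nat (n - 1 - j) * h j) = (\<Sum>j<n-1. of_nat (n - 1 - j) * h j)"
      by (cases n) auto
    finally show ?case
      using Suc by simp
  qed simp
  have "(\<Sum>j<n-1. of_nat (n - 1 - j) * h j) = (\<Sum>j<n-1. of_nat (n - 1 - (n - 1 - Suc j)) * h (n - 1 - Suc j))"
    by (rule sum.nat_diff_reindex[symmetric])
  also have "\<dots> = (\<Sum>j<n-1. of_nat (Suc j) * h j)"
  proof (rule sum.cong[OF refl])
    fix j assume "j \<in> {..<n-1}"
    then have "n - 1 - (n - 1 - Suc j) = Suc j" "n - 1 - Suc j = n - 2 - j" "j < n - 1" by auto
    then show "of_nat (n - 1 - (n - 1 - Suc j)) * h (n - 1 - Suc j) = of_nat (Suc j) * h j"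
      using assms[of j] by simp
  qed
  finally have "2 * (\<Sum>j<n-1. of_nat (n - 1 - j) * h j)
      = (\<Sum>j<n-1. of_nat (n - 1 - j) * h j) + (\<Sum>j<n-1. of_nat (Suc j) * h j)"
    by simp
  also have "\<dots> = (\<Sum>j<n-1. of_nat n * h j)"
    unfolding sum.distrib[symmetric]
  proof (rule sum.cong[OF refl])
    fix j assume "j \<in> {..<n-1}"
    then have "n = (n - 1 - j) + Suc j" by auto
    then have "(of_nat n :: 'a) = of_nat (n - 1 - j) + of_nat (Suc j)" by (metis of_nat_add)
    then show "of_nat (n - 1 - j) * h j + of_nat (Suc j) * h j = of_nat n * h j"
      by (simp only: distrib_right)
  qed
  finally show ?thesis
    unfolding tri by (simp add: sum_distrib_left[symmetric] mult.commute)
qed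

text \<open>
  Both words are palindromes in the involutions \<open>R\<close> and \<open>S\<close>: conjugation
  strips off the outer letters two at a time until the middle letter remains.
\<close>

lemma trace_alternating:
  assumes R: "R ** R = mat 1" and S: "S ** S = mat 1"
  shows "trace (matpow (R ** S) p ** R) = (if even p then trace R else trace S)"
    and "trace (S ** matpow (R ** S) p) = (if even p then trace S else trace R)"
proof -
  let ?A = "R ** S"
  have conj: "trace (P ** X ** Q) = trace X" if "Q ** P = mat 1" for P Q X :: "'a cmat"
    by (subst trace_cycle3, subst trace_cycle3) (simp add: that)
  have 1: "(S ** R) ** (R ** S) = mat 1" "S ** (R ** R) ** S = mat 1"
    using R S by (metis matrix_mul_assoc matrix_mul_rid)+
  have 2: "(R ** S) ** (S ** R) = mat 1"
    using R S by (metis matrix_mul_assoc matrix_mul_rid)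
  have "trace (matpow ?A p ** R) = (if even p then trace R else trace S) \<and>
        trace (S ** matpow ?A p) = (if even p then trace S else trace R)"
  proof (induction p rule: less_induct)
    case (less p)
    consider "p = 0" | "p = 1" | q where "p = Suc (Suc q)"
      by (metis One_nat_def not0_implies_Suc)
    then show ?case
    proof cases
      case 1
      then show ?thesis by simp
    next
      case 2
      have "trace (R ** S ** R) = trace S" "trace (S ** R ** S) = trace R"
        using R S by (simp_all add: conj)
      then show ?thesis using 2 by (simp add: matrix_mul_assoc)
    next
      case 3
      have p: "matpow ?A p = ?A ** (matpow ?A q ** ?A)"
        by (simp add: 3 matpow_commute)
      have "matpow ?A p ** R = (R ** S) ** (matpow ?A q ** R) ** (S ** R)"
        unfolding p by (simp add: matrix_mul_assoc)
      moreover have "S ** matpow ?A p = (S ** R) ** (S ** matpow ?A q) ** (R ** S)"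
        unfolding p by (simp add: matrix_mul_assoc)
      moreover have "q < p" "even p = even q" using 3 by auto
      ultimately show ?thesis
        using less[of q] by (simp only: conj[OF 1(1)] conj[OF 2]) 
    qed
  qed
  then show "trace (matpow (R ** S) p ** R) = (if even p then trace R else trace S)"
    and "trace (S ** matpow (R ** S) p) = (if even p then trace S else trace R)"
    by auto
qed

text \<open>
  The right-hand side of the moment equation, before taking expectations.
\<close>

definition moment_drift :: "'n::finite cmat \<Rightarrow> complex \<Rightarrow> complex \<Rightarrow> nat \<Rightarrow> complex" where
  "moment_drift A \<alpha> \<beta> n = - of_nat n * ntrace (matpow A n)
     - of_nat n * (\<Sum>p=1..n-1. ntrace (matpow A p) * ntrace (matpow A (n - p)))
     + (if odd n then (of_nat n)\<^sup>2 * \<alpha> * \<beta> else (of_nat n)\<^sup>2 / 2 * (\<alpha>\<^sup>2 + \<beta>\<^sup>2))"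

text \<open>
  Once the quadratic form is contracted, all traces are normalized traces of powers of \<open>A = R
  S\<close> or of alternating words. The summand is symmetric under \<open>j \<mapsto> n - 2 -
  j\<close>, so that the double sum becomes \<open>n/2\<close> times a single one; the alternating
  words in it give the constant term.
\<close>

lemma second_order_form_drift:
  fixes R S :: "'n::finite cmat"
  assumes R: "R ** R = mat 1" and S: "S ** S = mat 1" and n: "n \<ge> 2"
  shows "second_order_form (\<lambda>P Q. - (trace P * trace Q) / of_nat CARD('n)) R S n
    = of_nat CARD('n) * moment_drift (R ** S) (ntrace R) (ntrace S) n"
proof -
  let ?A = "R ** S" and ?N = "of_nat CARD('n) :: complex"
  define a where "a p = ntrace (matpow ?A p)" for p
  define \<alpha> where "\<alpha> = ntrace R"
  define \<beta> where "\<beta> = ntrace S"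
  have N: "?N \<noteq> 0" by simp
  define u where "u p = (if even p then \<alpha> else \<beta>)" for p :: nat
  define v where "v p = (if even p then \<beta> else \<alpha>)" for p :: nat
  have tr: "trace (matpow ?A p) = ?N * a p" "trace R = ?N * \<alpha>" "trace S = ?N * \<beta>" for p
    by (simp_all add: a_def ntrace_def \<alpha>_def \<beta>_def)
  have trR: "trace (matpow ?A p ** R) = ?N * u p" and trS: "trace (S ** matpow ?A p) = ?N * v p" for p
    by (simp_all add: trace_alternating[OF R S] u_def v_def tr)
  have RS: "matpow ?A p ** R ** S = matpow ?A (Suc p)" for p
    by (simp add: matrix_mul_assoc[symmetric] matpow_commute)
  have SR: "trace (S ** matpow ?A p ** R) = ?N * a (Suc p)" for p
    by (subst trace_cycle3) (simp only: RS tr)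
  have SRS: "trace (S ** matpow ?A p ** R ** S) = ?N * v (Suc p)" for p
    using trS[of "Suc p"] RS[of p] by (metis matrix_mul_assoc)
  define h where "h j = 2 * (a (n - 1 - j) * a (Suc j)) - u (n - 2 - j) * v (Suc j) - v (n - 1 - j) * u j" for j
  have sum: "second_order_form (\<lambda>P Q. - (trace P * trace Q) / ?N) R S n
      = ?N * (of_nat n * (u (n - 1) * \<beta> - a n) - (\<Sum>i<n. \<Sum>j<i. h j))"
  proof -
    have "Suc (n - 2 - j) = n - 1 - j" if "j < i" "i < n" for i j
      using that by simp
    then have sumeq: "(\<Sum>i<n. \<Sum>j<i. - (trace (S ** matpow ?A (n - 2 - j) ** R) * trace
        (S ** matpow ?A j ** R)) / ?N
          - - (trace (matpow ?A (n - 2 - j) ** R) * trace (S ** matpow ?A j ** R ** S)) / ?N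
          - - (trace (S ** matpow ?A (n - 2 - j) ** R ** S) * trace (matpow ?A j ** R)) / ?N
          + - (trace (matpow ?A (n - 2 - j) ** R ** S) * trace (matpow ?A j ** R ** S)) / ?N)
        = - ?N * (\<Sum>i<n. \<Sum>j<i. h j)"
      unfolding sum_distrib_left
      by (intro sum.cong refl) (simp add: trR SR SRS RS tr h_def field_simps del: matpow.simps)
    have "Suc (n - 1) = n" using n by simp
    moreover have "trace (mat 1 :: 'n cmat) = ?N" by (simp add: trace_def mat_def)
    ultimately show ?thesis
      unfolding second_order_form_def Let_def sumeq
      by (simp add: trR SR SRS RS tr field_simps del: matpow.simps)
  qed
  have hsym: "h (n - 2 - j) = h j" if "j < n - 1" for j
  proof -
    have "n - 1 - (n - 2 - j) = Suc j" "Suc (n - 2 - j) = n - 1 - j" "n - 2 - (n - 2 - j) = j"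
      using that by auto
    then show ?thesis by (simp add: h_def mult.commute)
  qed
  have sumh: "(\<Sum>j<n-1. h j) = 2 * (\<Sum>p=1..n-1. a p * a (n - p)) - 2 * (\<Sum>j<n-1. u (n - 2 - j) * v (Suc j))"
  proof -
    have "h j = 2 * (a (Suc j) * a (n - Suc j)) - 2 * (u (n - 2 - j) * v (Suc j))" if "j < n - 1" for j
    proof -
      have "v (n - 1 - j) * u j = u (n - 2 - j) * v (Suc j)"
      proof -
        have "n - 1 - j = Suc (n - 2 - j)" using that by simp
        moreover have "v (Suc q) = u q" for q by (simp add: u_def v_def)
        ultimately show ?thesis by simp
      qed
      then show ?thesis by (simp add: h_def mult.commute)
    qed
    then have "(\<Sum>j<n-1. h j) = (\<Sum>j<n-1. 2 * (a (Suc j) * a (n - Suc j)) - 2 * (u (n - 2 - j) * v (Suc j)))"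
      by (intro sum.cong) auto
    also have "\<dots> = 2 * (\<Sum>j<n-1. a (Suc j) * a (n - Suc j)) - 2 * (\<Sum>j<n-1. u (n - 2 - j) * v (Suc j))"
      by (simp add: sum_subtractf sum_distrib_left)
    also have "(\<Sum>j<n-1. a (Suc j) * a (n - Suc j)) = (\<Sum>p=1..n-1. a p * a (n - p))"
      by (rule sum.reindex_bij_witness[of _ "\<lambda>p. p - 1" Suc]) auto
    finally show ?thesis .
  qed
  have bdry: "u (n - 1) * \<beta> + (\<Sum>j<n-1. u (n - 2 - j) * v (Suc j))
      = (if odd n then of_nat n * \<alpha> * \<beta> else of_nat n / 2 * (\<alpha>\<^sup>2 + \<beta>\<^sup>2))"
  proof (cases "odd n")
    case True
    then have "u (n - 2 - j) * v (Suc j) = \<alpha> * \<beta>" if "j < n - 1" for j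
      using that n by (auto simp: u_def v_def)
    then have "(\<Sum>j<n-1. u (n - 2 - j) * v (Suc j)) = (\<Sum>j<n-1. \<alpha> * \<beta>)"
      by (intro sum.cong) auto
    then show ?thesis
      using True n by (simp add: u_def of_nat_diff algebra_simps)
  next
    case False
    have "u (n - 2 - j) * v (Suc j) = (if even j then \<alpha>\<^sup>2 else \<beta>\<^sup>2)" if "j < n - 1" for j
      using that n False by (auto simp: u_def v_def power2_eq_square)
    then have "(\<Sum>j<n-1. u (n - 2 - j) * v (Suc j)) = (\<Sum>j<n-1. if even j then \<alpha>\<^sup>2 else \<beta>\<^sup>2)"
      by (intro sum.cong) auto
    moreover obtain m where m: "n = Suc (Suc (2 * m))"
      using False n by (metis add_2_eq_Suc dvdE even_Suc le_Suc_ex)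
    moreover have "(\<Sum>j<Suc (2 * m). if even j then \<alpha>\<^sup>2 else \<beta>\<^sup>2) = of_nat (Suc m) * \<alpha>\<^sup>2 + of_nat m * \<beta>\<^sup>2" for m
      by (induction m) (simp_all add: algebra_simps)
    ultimately show ?thesis
      by (simp add: u_def power2_eq_square field_simps)
  qed
  have tri: "(\<Sum>i<n. \<Sum>j<i. h j) = of_nat n / 2 * (\<Sum>j<n-1. h j)"
    by (rule sum_triangle_symmetric) (rule hsym)
  have "of_nat n * (u (n - 1) * \<beta> - a n) - (\<Sum>i<n. \<Sum>j<i. h j)
      = - of_nat n * a n - of_nat n * (\<Sum>p=1..n-1. a p * a (n - p))
        + of_nat n * (u (n - 1) * \<beta> + (\<Sum>j<n-1. u (n - 2 - j) * v (Suc j)))"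
    by (simp only: tri sumh) (simp add: field_simps)
  also have "\<dots> = moment_drift ?A \<alpha> \<beta> n"
    unfolding bdry moment_drift_def a_def by (simp add: power2_eq_square algebra_simps)
  finally show ?thesis
    unfolding sum \<alpha>_def \<beta>_def by simp
qed

section \<open>Increments of the matrix Brownian motion\<close>

locale brownian_family = prob_space M for M :: "'a measure" +
  fixes B :: "'n::{finite,linorder} cmat \<Rightarrow> real \<Rightarrow> 'a \<Rightarrow> real"
  assumes iid: "iid_brownian_motions M skew_basis B"
begin

abbreviation F :: "real \<Rightarrow> 'a measure" where
  "F \<equiv> brownian_filtration M skew_basis B"

abbreviation X :: "real \<Rightarrow> 'a \<Rightarrow> 'n cmat" where
  "X \<equiv> skew_brownian_motion B"

lemma B_standard: "\<xi> \<in> skew_basis \<Longrightarrow> std_brownian_motion M (B \<xi>)"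
  using iid by (simp add: iid_brownian_motions_def)

lemma B_measurable: "\<xi> \<in> skew_basis \<Longrightarrow> 0 \<le> t \<Longrightarrow> B \<xi> t \<in> borel_measurable M"
  using B_standard by (simp add: std_brownian_motion_def)

lemma filtration_generators:
  "{B \<xi> u -` A \<inter> space M | \<xi> u A. \<xi> \<in> skew_basis \<and> 0 \<le> u \<and> u \<le> s \<and> A \<in> sets borel} \<union> null_sets M \<subseteq> events"
  by (auto intro: measurable_sets B_measurable)

lemma space_F [simp]: "space (F s) = space M"
  unfolding brownian_filtration_def by (rule space_measure_of_conv)

lemma sets_F: "sets (F s) = sigma_sets (space M)
   ({B \<xi> u -` A \<inter> space M | \<xi> u A. \<xi> \<in> skew_basis \<and> 0 \<le> u \<and> u \<le> s \<and> A \<in> sets borel} \<union> null_sets M)"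
  unfolding brownian_filtration_def
  by (rule sets_measure_of) (use filtration_generators[of s] sets.space_closed in blast)

lemma sets_F_subset: "sets (F s) \<subseteq> events"
  unfolding sets_F by (rule sets.sigma_sets_subset) (rule filtration_generators)

lemma measurable_F_mono: "s \<le> t \<Longrightarrow> f \<in> borel_measurable (F s) \<Longrightarrow> f \<in> borel_measurable (F t)"
proof -
  assume "s \<le> t"
  then have "sets (F s) \<subseteq> sets (F t)"
    unfolding sets_F by (intro sigma_sets_mono') (auto intro: order_trans)
  then show "f \<in> borel_measurable (F s) \<Longrightarrow> f \<in> borel_measurable (F t)"
    by (auto simp: measurable_def)
qed

lemma measurable_F: "f \<in> borel_measurable (F s) \<Longrightarrow> f \<in> borel_measurable M"
  using sets_F_subset[of s] by (auto simp: measurable_def)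

lemma B_measurable_F: "\<xi> \<in> skew_basis \<Longrightarrow> 0 \<le> u \<Longrightarrow> u \<le> s \<Longrightarrow> B \<xi> u \<in> borel_measurable (F s)"
  by (rule measurableI) (auto simp: sets_F intro!: sigma_sets.Basic)

definition incr :: "real \<Rightarrow> real \<Rightarrow> 'n cmat \<Rightarrow> 'a \<Rightarrow> real" where
  "incr s t \<xi> \<omega> = B \<xi> t \<omega> - B \<xi> s \<omega>"

definition incr_events :: "real \<Rightarrow> real \<Rightarrow> 'n cmat \<Rightarrow> 'a set set" where
  "incr_events s t \<xi> = {incr s t \<xi> -` A \<inter> space M | A. A \<in> sets borel}"

definition incr_algebra :: "real \<Rightarrow> real \<Rightarrow> 'a measure" where
  "incr_algebra s t = sigma (space M) (\<Union>\<xi>\<in>skew_basis. incr_events s t \<xi>)"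

text \<open>
  Past and increments of a single driving motion both lie in the algebra of its path, so the
  independence of the family can be applied to their intersections.
\<close>

definition path_algebra :: "'n cmat \<Rightarrow> 'a measure" where
  "path_algebra \<xi> = vimage_algebra (space M) (\<lambda>\<omega>. \<lambda>t\<in>{0..}. B \<xi> t \<omega>) (PiM {0..} (\<lambda>_. borel))"

lemma path_space: "(\<lambda>\<omega>. \<lambda>t\<in>{0..}. B \<xi> t \<omega>) \<in> space M \<rightarrow> space (PiM {0..} (\<lambda>_. borel))"
  by (auto simp: space_PiM)

lemma B_path_measurable: "0 \<le> t \<Longrightarrow> B \<xi> t \<in> borel_measurable (path_algebra \<xi>)"
proof -
  assume t: "0 \<le> t"
  have "(\<lambda>\<omega>. (\<lambda>t\<in>{0..}. B \<xi> t \<omega>) t) \<in> borel_measurable (path_algebra \<xi>)"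
    unfolding path_algebra_def
    by (rule measurable_compose[OF measurable_vimage_algebra1[OF path_space]
        measurable_component_singleton]) (use t in simp)
  then show ?thesis using t by simp
qed

lemma indep_path_algebra: "indep_sets (\<lambda>\<xi>. sets (path_algebra \<xi>)) skew_basis"
  using iid unfolding iid_brownian_motions_def indep_vars_def2 path_algebra_def sets_vimage_algebra2[OF
      path_space]
  by blast

lemma past_in_path: "past_sets M (B \<xi>) s \<subseteq> sets (path_algebra \<xi>)"
proof -
  have "B \<xi> u -` A \<inter> space M \<in> sets (path_algebra \<xi>)" if "0 \<le> u" "A \<in> sets borel" for u A
    using measurable_sets[OF B_path_measurable[OF that(1)] that(2)] by (simp add: path_algebra_def)
  then have "sigma_sets (space (path_algebra \<xi>)) {B \<xi> u -` A \<inter> space M |u A. 0 \<le> u \<and> u \<le> s \<and> A \<in> sets borel}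
      \<subseteq> sets (path_algebra \<xi>)"
    by (intro sets.sigma_sets_subset) auto
  then show ?thesis
    by (simp add: past_sets_def path_algebra_def)
qed

lemma incr_in_path: 
  assumes "0 \<le> s" "0 \<le> t"
  shows "incr_events s t \<xi> \<subseteq> sets (path_algebra \<xi>)"
proof -
  have "incr s t \<xi> \<in> borel_measurable (path_algebra \<xi>)"
    unfolding incr_def using assms by (intro borel_measurable_diff B_path_measurable)
  from measurable_sets[OF this] show ?thesis
    by (auto simp: incr_events_def path_algebra_def)
qed

lemma past_sets_sigma: "sigma_algebra (space M) (past_sets M (B \<xi>) s)"
  unfolding past_sets_def by (rule sigma_algebra_sigma_sets) auto

lemma incr_events_Int: "a \<in> incr_events s t \<xi> \<Longrightarrow> b \<in> incr_events s t \<xi> \<Longrightarrow> a \<inter> b \<in> incr_events s t \<xi>"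
proof -
  assume "a \<in> incr_events s t \<xi>" "b \<in> incr_events s t \<xi>"
  then obtain A A' where "A \<in> sets borel" "A' \<in> sets borel"
      "a = incr s t \<xi> -` A \<inter> space M" "b = incr s t \<xi> -` A' \<inter> space M"
    unfolding incr_events_def by blast
  then have "a \<inter> b = incr s t \<xi> -` (A \<inter> A') \<inter> space M" "A \<inter> A' \<in> sets borel"
    by auto
  then show ?thesis
    unfolding incr_events_def by blast
qed

text \<open>
  Events that are intersections over the family of past events, respectively of increment events,
  form intersection-stable generators, and for them independence follows in two steps: across the
  family by independence of the paths, within each path by independence of increments. The null sets
  that augment the filtration join the first generator; they are independent of everything.
\<close>

lemma indep_F_incr:
  assumes "0 \<le> s" "s < t"
  shows "indep_set (sets (F s)) (sets (incr_algebra s t))"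
proof -
  let ?J = "skew_basis :: 'n cmat set"
  let ?P = "\<lambda>\<xi>. past_sets M (B \<xi>) s"
  have J: "finite ?J" "?J \<noteq> {}"
    by (rule finite_skew_basis) (rule skew_basis_nonempty)
  have path_ev: "sets (path_algebra \<xi>) \<subseteq> events" if "\<xi> \<in> ?J" for \<xi>
    using indep_path_algebra that by (auto simp: indep_sets_def)
  have past_path: "Q \<in> sets (path_algebra \<xi>)" if "Q \<in> ?P \<xi>" for Q \<xi>
    using that past_in_path by blast
  have incr_path: "Q \<in> sets (path_algebra \<xi>)" if "Q \<in> incr_events s t \<xi>" for Q \<xi>
    using that incr_in_path[of s t] assms by (auto simp: less_imp_le)
  have past_Int: "a \<inter> b \<in> ?P \<xi>" if "a \<in> ?P \<xi>" "b \<in> ?P \<xi>" for a b \<xi>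
  proof -
    interpret sigma_algebra "space M" "?P \<xi>"
      by (rule past_sets_sigma)
    show ?thesis using that by (rule Int)
  qed
  have prod_path: "prob (\<Inter>\<xi>\<in>?J. Q \<xi>) = (\<Prod>\<xi>\<in>?J. prob (Q \<xi>))" if "\<forall>\<xi>\<in>?J. Q \<xi> \<in> sets (path_algebra \<xi>)" for Q
    using indep_setsD[OF indep_path_algebra _ J(2,1) that] by simp
  have ind: "prob (a \<inter> b) = prob a * prob b" if "\<xi> \<in> ?J" "a \<in> ?P \<xi>" "b \<in> incr_events s t \<xi>" for \<xi> a b
  proof (rule indep_setD)
    show "indep_set (?P \<xi>) (incr_events s t \<xi>)"
      using B_standard[OF that(1)] assms unfolding std_brownian_motion_def incr_events_def incr_def by blast
  qed (use that in auto)
  \<comment> \<open>The null sets belong to the generator because the filtration is augmented by them.\<close>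
  define G1 where "G1 = {\<Inter>\<xi>\<in>?J. Q \<xi> | Q. \<forall>\<xi>\<in>?J. Q \<xi> \<in> ?P \<xi>} \<union> null_sets M"
  define G2 where "G2 = {\<Inter>\<xi>\<in>?J. Q \<xi> | Q. \<forall>\<xi>\<in>?J. Q \<xi> \<in> incr_events s t \<xi>}"
  have ev: "(\<Inter>\<xi>\<in>?J. Q \<xi>) \<in> events" if "\<forall>\<xi>\<in>?J. Q \<xi> \<in> sets (path_algebra \<xi>)" for Q
    using that path_ev J by (intro sets.finite_INT) blast+
  have G1_ev: "G1 \<subseteq> events" and G2_ev: "G2 \<subseteq> events"
    unfolding G1_def G2_def using ev past_path incr_path by auto
  have "indep_set G1 G2"
  proof (rule indep_setI[OF G1_ev G2_ev])
    fix a b assume a: "a \<in> G1" and b: "b \<in> G2"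
    obtain I where I: "b = (\<Inter>\<xi>\<in>?J. I \<xi>)" "\<forall>\<xi>\<in>?J. I \<xi> \<in> incr_events s t \<xi>"
      using b unfolding G2_def by blast
    consider Q where "a = (\<Inter>\<xi>\<in>?J. Q \<xi>)" "\<forall>\<xi>\<in>?J. Q \<xi> \<in> ?P \<xi>" | "a \<in> null_sets M"
      using a unfolding G1_def by blast
    then show "prob (a \<inter> b) = prob a * prob b"
    proof cases
      case (1 Q)
      have "prob (a \<inter> b) = prob (\<Inter>\<xi>\<in>?J. Q \<xi> \<inter> I \<xi>)"
        unfolding 1 I by (rule arg_cong[where f = prob]) auto
      also have "\<dots> = (\<Prod>\<xi>\<in>?J. prob (Q \<xi> \<inter> I \<xi>))"
        using 1 I past_path incr_path by (intro prod_path) auto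
      also have "\<dots> = (\<Prod>\<xi>\<in>?J. prob (Q \<xi>) * prob (I \<xi>))"
        using 1 I by (intro prod.cong refl ind) auto
      also have "\<dots> = prob a * prob b"
        unfolding prod.distrib 1 I using 1 I past_path incr_path by (simp add: prod_path)
      finally show ?thesis .
    next
      case 2
      then have "a \<inter> b \<in> null_sets M"
        using b G2_ev by (auto intro: null_set_Int2)
      then show ?thesis
        using 2 by (auto simp: null_sets_def measure_def)
    qed
  qed
  moreover have "Int_stable G1"
  proof (rule Int_stableI)
    fix a b assume ab: "a \<in> G1" "b \<in> G1"
    show "a \<inter> b \<in> G1"
    proof (cases "a \<in> null_sets M \<or> b \<in> null_sets M")
      case True
      then have "a \<inter> b \<in> null_sets M"
        using ab G1_ev by (auto intro: null_set_Int1 null_set_Int2)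
      then show ?thesis by (simp add: G1_def)
    next
      case False
      then obtain Q Q' where Q: "a = (\<Inter>\<xi>\<in>?J. Q \<xi>)" "\<forall>\<xi>\<in>?J. Q \<xi> \<in> ?P \<xi>"
          "b = (\<Inter>\<xi>\<in>?J. Q' \<xi>)" "\<forall>\<xi>\<in>?J. Q' \<xi> \<in> ?P \<xi>"
        using ab unfolding G1_def by blast
      then have "a \<inter> b = (\<Inter>\<xi>\<in>?J. Q \<xi> \<inter> Q' \<xi>)" "\<forall>\<xi>\<in>?J. Q \<xi> \<inter> Q' \<xi> \<in> ?P \<xi>"
        using past_Int by auto
      then show ?thesis unfolding G1_def by blast
    qed
  qed
  moreover have "Int_stable G2"
  proof (rule Int_stableI)
    fix a b assume "a \<in> G2" "b \<in> G2"
    then obtain Q Q' where Q: "a = (\<Inter>\<xi>\<in>?J. Q \<xi>)" "\<forall>\<xi>\<in>?J. Q \<xi> \<in> incr_events s t \<xi>"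
        "b = (\<Inter>\<xi>\<in>?J. Q' \<xi>)" "\<forall>\<xi>\<in>?J. Q' \<xi> \<in> incr_events s t \<xi>"
      unfolding G2_def by blast
    then have "a \<inter> b = (\<Inter>\<xi>\<in>?J. Q \<xi> \<inter> Q' \<xi>)" "\<forall>\<xi>\<in>?J. Q \<xi> \<inter> Q' \<xi> \<in> incr_events s t \<xi>"
      using incr_events_Int by auto
    then show "a \<inter> b \<in> G2" unfolding G2_def by blast
  qed
  ultimately have "indep_set (sigma_sets (space M) G1) (sigma_sets (space M) G2)"
    by (rule indep_set_sigma_sets)
  moreover have "sets (F s) \<subseteq> sigma_sets (space M) G1"
  proof -
    have "B \<xi> u -` A \<inter> space M \<in> G1" if "\<xi> \<in> ?J" "0 \<le> u" "u \<le> s" "A \<in> sets borel" for \<xi> u A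
    proof -
      \<comment> \<open>An event of a single motion is an intersection over the family with trivial other factors.\<close>
      define Q where "Q \<eta> = (if \<eta> = \<xi> then B \<xi> u -` A \<inter> space M else space M)" for \<eta>
      have "space M \<in> ?P \<eta>" for \<eta>
        unfolding past_sets_def by (rule sigma_sets_top)
      then have "\<forall>\<eta>\<in>?J. Q \<eta> \<in> ?P \<eta>"
        using that unfolding Q_def past_sets_def by (auto intro!: sigma_sets.Basic)
      moreover have "B \<xi> u -` A \<inter> space M = (\<Inter>\<eta>\<in>?J. Q \<eta>)"
        using that(1) by (auto simp: Q_def split: if_splits)
      ultimately show ?thesis unfolding G1_def by blast
    qed
    then have "{B \<xi> u -` A \<inter> space M | \<xi> u A. \<xi> \<in> ?J \<and> 0 \<le> u \<and> u \<le> s \<and> A \<in> sets borel} \<subseteq> G1"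
      by blast
    moreover have "null_sets M \<subseteq> G1"
      unfolding G1_def by (rule Un_upper2)
    ultimately show ?thesis
      unfolding sets_F by (intro sigma_sets_mono' Un_least)
  qed
  moreover have "sets (incr_algebra s t) \<subseteq> sigma_sets (space M) G2"
  proof -
    have "a \<in> G2" if "\<xi> \<in> ?J" "a \<in> incr_events s t \<xi>" for \<xi> a
    proof -
      define Q where "Q \<eta> = (if \<eta> = \<xi> then a else space M)" for \<eta>
      have "space M \<in> incr_events s t \<eta>" for \<eta>
        unfolding incr_events_def by (auto intro!: exI[of _ UNIV])
      then have "\<forall>\<eta>\<in>?J. Q \<eta> \<in> incr_events s t \<eta>"
        using that unfolding Q_def by auto
      moreover have "a = (\<Inter>\<eta>\<in>?J. Q \<eta>)"
        using that by (auto simp: Q_def incr_events_def split: if_splits)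
      ultimately show ?thesis unfolding G2_def by blast
    qed
    then have "(\<Union>\<xi>\<in>?J. incr_events s t \<xi>) \<subseteq> G2"
      by blast
    moreover have "(\<Union>\<xi>\<in>?J. incr_events s t \<xi>) \<subseteq> Pow (space M)"
      by (auto simp: incr_events_def)
    ultimately show ?thesis
      unfolding incr_algebra_def by (simp add: sets_measure_of sigma_sets_mono')
  qed
  ultimately show ?thesis
    unfolding indep_set_def
    by (elim indep_sets_mono_sets) (simp split: bool.split)
qed

lemma space_incr_algebra [simp]: "space (incr_algebra s t) = space M"
  unfolding incr_algebra_def by (rule space_measure_of_conv)

lemma incr_measurable: "\<xi> \<in> skew_basis \<Longrightarrow> incr s t \<xi> \<in> borel_measurable (incr_algebra s t)"
proof (rule measurableI)
  fix A :: "real set" assume "\<xi> \<in> skew_basis" "A \<in> sets borel"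
  moreover have "(\<Union>\<xi>\<in>skew_basis. incr_events s t \<xi>) \<subseteq> Pow (space M)"
    by (auto simp: incr_events_def)
  ultimately show "incr s t \<xi> -` A \<inter> space (incr_algebra s t) \<in> sets (incr_algebra s t)"
    unfolding space_incr_algebra unfolding incr_algebra_def
    by (subst sets_measure_of) (auto simp: incr_events_def intro!: sigma_sets.Basic)
qed simp

lemma indep_product:
  fixes Z W :: "'a \<Rightarrow> complex"
  assumes st: "0 \<le> s" "s < t" and Z: "Z \<in> borel_measurable (F s)" "integrable M Z"
    and W: "W \<in> borel_measurable (incr_algebra s t)" "integrable M W"
  shows "integrable M (\<lambda>\<omega>. Z \<omega> * W \<omega>)" "(\<integral>\<omega>. Z \<omega> * W \<omega> \<partial>M) = (\<integral>\<omega>. Z \<omega> \<partial>M) * (\<integral>\<omega>. W \<omega> \<partial>M)"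
proof -
  have "{Z -` A \<inter> space M |A. A \<in> sets borel} \<subseteq> sets (F s)"
    using measurable_sets[OF Z(1)] by auto
  from sets.sigma_sets_subset[OF this]
  have 1: "sigma_sets (space M) {Z -` A \<inter> space M |A. A \<in> sets borel} \<subseteq> sets (F s)"
    by simp
  have "{W -` A \<inter> space M |A. A \<in> sets borel} \<subseteq> sets (incr_algebra s t)"
    using measurable_sets[OF W(1)] by auto
  from sets.sigma_sets_subset[OF this]
  have 2: "sigma_sets (space M) {W -` A \<inter> space M |A. A \<in> sets borel} \<subseteq> sets (incr_algebra s t)"
    by simp
  have "indep_set (sigma_sets (space M) {Z -` A \<inter> space M |A. A \<in> sets borel})
      (sigma_sets (space M) {W -` A \<inter> space M |A. A \<in> sets borel})"
    unfolding indep_set_def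
    by (rule indep_sets_mono_sets[OF indep_F_incr[OF st, unfolded indep_set_def]])
       (simp add: 1 2 split: bool.split)
  then have "indep_var borel Z borel W"
    unfolding indep_var_eq using borel_measurable_integrable[OF Z(2)] borel_measurable_integrable[OF W(2)]
    by simp
  then show "integrable M (\<lambda>\<omega>. Z \<omega> * W \<omega>)" "(\<integral>\<omega>. Z \<omega> * W \<omega> \<partial>M) = (\<integral>\<omega>. Z \<omega> \<partial>M) * (\<integral>\<omega>. W \<omega> \<partial>M)"
    using indep_var_integrable[of Z W] indep_var_lebesgue_integral[of Z W] Z(2) W(2) by auto
qed

lemma incr_distributed:
  "\<xi> \<in> skew_basis \<Longrightarrow> 0 \<le> s \<Longrightarrow> s < t \<Longrightarrow> distributed M lborel (incr s t \<xi>) (normal_density 0 (sqrt (t - s)))"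
  using B_standard[of \<xi>] unfolding std_brownian_motion_def incr_def by blast

lemma incr_moment:
  assumes "\<xi> \<in> skew_basis" "0 \<le> s" "s < t"
  shows "integrable M (\<lambda>\<omega>. incr s t \<xi> \<omega> ^ (2 * k))"
    and "(\<integral>\<omega>. incr s t \<xi> \<omega> ^ (2 * k) \<partial>M) = fact (2 * k) / (2 ^ k * fact k) * (t - s) ^ k"
    and "integrable M (incr s t \<xi>)"
    and "(\<integral>\<omega>. incr s t \<xi> \<omega> \<partial>M) = 0"
proof -
  have pos: "0 < sqrt (t - s)" using assms by simp
  note d = incr_distributed[OF assms]
  have nn: "0 \<le> normal_density 0 (sqrt (t - s)) x" for x by simp
  note e = normal_moment_even[OF pos, of 0 k, simplified]
  note o = normal_moment_nz_1[OF pos, of 0]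
  show "integrable M (\<lambda>\<omega>. incr s t \<xi> \<omega> ^ (2 * k))"
    by (subst distributed_integrable[OF d _ nn, symmetric, of "\<lambda>x. x ^ (2 * k)"])
       (use e in \<open>auto simp: has_bochner_integral_iff\<close>)
  have "(\<integral>\<omega>. incr s t \<xi> \<omega> ^ (2 * k) \<partial>M) = fact (2 * k) / ((2 / (t - s)) ^ k * fact k)"
    by (subst distributed_integral[OF d _ nn, symmetric, of "\<lambda>x. x ^ (2 * k)"])
       (use e assms in \<open>auto simp: has_bochner_integral_iff\<close>)
  then show "(\<integral>\<omega>. incr s t \<xi> \<omega> ^ (2 * k) \<partial>M) = fact (2 * k) / (2 ^ k * fact k) * (t - s) ^ k"
    using assms by (simp add: power_divide field_simps)
  show "integrable M (incr s t \<xi>)"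
    by (subst distributed_integrable[OF d _ nn, symmetric, of "\<lambda>x. x"])
       (use o in \<open>auto simp: has_bochner_integral_iff\<close>)
  show "(\<integral>\<omega>. incr s t \<xi> \<omega> \<partial>M) = 0"
    by (subst distributed_integral[OF d _ nn, symmetric, of "\<lambda>x. x"])
       (use o in \<open>auto simp: has_bochner_integral_iff\<close>)
qed

lemma incr_indep_vars:
  assumes "0 \<le> s" "0 \<le> t"
  shows "indep_vars (\<lambda>_. borel) (incr s t) skew_basis"
proof -
  have "indep_vars (\<lambda>_. PiM {0..} (\<lambda>_. borel)) (\<lambda>\<xi> \<omega>. \<lambda>t\<in>{0..}. B \<xi> t \<omega>) skew_basis"
    using iid by (simp add: iid_brownian_motions_def)
  moreover have "(\<lambda>f. f t - f s) \<in> borel_measurable (PiM {0..} (\<lambda>_. borel :: real measure))"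
    using assms by (intro borel_measurable_diff measurable_component_singleton) auto
  ultimately have "indep_vars (\<lambda>_. borel) (\<lambda>\<xi> \<omega>. (\<lambda>t\<in>{0..}. B \<xi> t \<omega>) t - (\<lambda>t\<in>{0..}. B \<xi> t \<omega>) s) skew_basis"
    by (rule indep_vars_compose2[where Y = "\<lambda>_ f. f t - f s"])
  then show ?thesis
    using assms unfolding incr_def by simp
qed

lemma incr_covariance:
  assumes "\<xi> \<in> skew_basis" "\<eta> \<in> skew_basis" "0 \<le> s" "s < t"
  shows "integrable M (\<lambda>\<omega>. incr s t \<xi> \<omega> * incr s t \<eta> \<omega>)"
    and "(\<integral>\<omega>. incr s t \<xi> \<omega> * incr s t \<eta> \<omega> \<partial>M) = (if \<xi> = \<eta> then t - s else 0)"
proof -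
  have *: "integrable M (\<lambda>\<omega>. incr s t \<xi> \<omega> * incr s t \<eta> \<omega>) \<and>
      (\<integral>\<omega>. incr s t \<xi> \<omega> * incr s t \<eta> \<omega> \<partial>M) = (if \<xi> = \<eta> then t - s else 0)"
  proof (cases "\<xi> = \<eta>")
    case True
    then show ?thesis
      using incr_moment(1,2)[of \<xi> s t 1] assms by (simp add: power2_eq_square)
  next
    case False
    have "indep_vars (\<lambda>_. borel) (incr s t) {\<xi>, \<eta>}"
      by (rule indep_vars_subset[OF incr_indep_vars]) (use assms in auto)
    then show ?thesis
      using indep_vars_integrable[of "{\<xi>, \<eta>}" "incr s t"] indep_vars_lebesgue_integral[of "{\<xi>, \<eta>}" "incr s t"]
        incr_moment(3,4)[of _ s t] assms False by auto
  qed
  then show "integrable M (\<lambda>\<omega>. incr s t \<xi> \<omega> * incr s t \<eta> \<omega>)"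
    and "(\<integral>\<omega>. incr s t \<xi> \<omega> * incr s t \<eta> \<omega> \<partial>M) = (if \<xi> = \<eta> then t - s else 0)"
    by auto
qed

definition dX :: "real \<Rightarrow> real \<Rightarrow> 'a \<Rightarrow> 'n cmat" where
  "dX s t \<omega> = X t \<omega> - X s \<omega>"

lemma dX_eq: "dX s t \<omega> = (\<Sum>\<xi>\<in>skew_basis. incr s t \<xi> \<omega> *\<^sub>R \<xi>)"
  by (simp add: dX_def skew_brownian_motion_def incr_def sum_subtractf scaleR_diff_left)

lemma dX_entry: "dX s t \<omega> $ i $ j = (\<Sum>\<xi>\<in>skew_basis. of_real (incr s t \<xi> \<omega>) * \<xi> $ i $ j)"
  unfolding dX_eq by (simp add: scaleR_conv_of_real[symmetric])

lemma dX_skew: "skew (dX s t \<omega>)"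
proof -
  have "cadjoint (dX s t \<omega>) = (\<Sum>\<xi>\<in>skew_basis. incr s t \<xi> \<omega> *\<^sub>R cadjoint \<xi>)"
    by (simp add: dX_eq cadjoint_sum cadjoint_simps)
  also have "\<dots> = (\<Sum>\<xi>\<in>skew_basis. incr s t \<xi> \<omega> *\<^sub>R (- \<xi>))"
  proof (intro sum.cong refl)
    fix \<xi> :: "'n cmat" assume "\<xi> \<in> skew_basis"
    then show "incr s t \<xi> \<omega> *\<^sub>R cadjoint \<xi> = incr s t \<xi> \<omega> *\<^sub>R (- \<xi>)"
      using skew_basis_skew[of \<xi>] by (simp add: skew_def)
  qed
  finally show ?thesis
    by (simp add: skew_def dX_eq sum_negf)
qed

lemma dX_same [simp]: "dX s s \<omega> = 0"
  by (simp add: dX_def)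

lemma X_measurable_F: "0 \<le> u \<Longrightarrow> u \<le> s \<Longrightarrow> X u \<in> borel_measurable (F s)"
  unfolding skew_brownian_motion_def
  by (intro borel_measurable_sum borel_measurable_scaleR B_measurable_F) auto

lemma dX_measurable_F: "0 \<le> s \<Longrightarrow> s \<le> t \<Longrightarrow> t \<le> u \<Longrightarrow> dX s t \<in> borel_measurable (F u)"
  unfolding dX_def by (intro borel_measurable_diff X_measurable_F) auto

lemma dX_measurable: "0 \<le> s \<Longrightarrow> 0 \<le> t \<Longrightarrow> dX s t \<in> borel_measurable M"
  unfolding dX_def using measurable_F[OF X_measurable_F[of s s]] measurable_F[OF X_measurable_F[of t t]] by auto

lemma incr_entry_first:
  fixes Z :: "'a \<Rightarrow> complex"
  assumes st: "0 \<le> s" "s \<le> t" and Z: "Z \<in> borel_measurable (F s)" "integrable M Z"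
  shows "integrable M (\<lambda>\<omega>. Z \<omega> * dX s t \<omega> $ i $ j)"
    and "(\<integral>\<omega>. Z \<omega> * dX s t \<omega> $ i $ j \<partial>M) = 0"
proof -
  have *: "integrable M (\<lambda>\<omega>. Z \<omega> * dX s t \<omega> $ i $ j) \<and> (\<integral>\<omega>. Z \<omega> * dX s t \<omega> $ i $ j \<partial>M) = 0"
  proof (cases "s = t")
    case False
    with st have lt: "s < t" by simp
    have 1: "integrable M (\<lambda>\<omega>. Z \<omega> * of_real (incr s t \<xi> \<omega>))"
        "(\<integral>\<omega>. Z \<omega> * of_real (incr s t \<xi> \<omega>) \<partial>M) = 0" if "\<xi> \<in> skew_basis" for \<xi>
      using indep_product[OF st(1) lt Z, of "\<lambda>\<omega>. of_real (incr s t \<xi> \<omega>)"] incr_measurable[OF that]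
        incr_moment(3,4)[OF that st(1) lt] by auto
    have eq: "Z \<omega> * dX s t \<omega> $ i $ j = (\<Sum>\<xi>\<in>skew_basis. Z \<omega> * of_real (incr s t \<xi> \<omega>) * \<xi> $ i $ j)" for \<omega>
      unfolding dX_entry by (simp add: sum_distrib_left mult.assoc)
    show ?thesis
      unfolding eq using 1 by (subst Bochner_Integration.integral_sum) auto
  qed simp
  then show "integrable M (\<lambda>\<omega>. Z \<omega> * dX s t \<omega> $ i $ j)"
    and "(\<integral>\<omega>. Z \<omega> * dX s t \<omega> $ i $ j \<partial>M) = 0" by auto
qed

text \<open>
  Independence of the past reduces the mean to the covariance of the entries, which is the
  contraction identity scaled by the length of the interval.
\<close>

lemma incr_entry_second:
  fixes Z :: "'a \<Rightarrow> complex"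
  assumes st: "0 \<le> s" "s \<le> t" and Z: "Z \<in> borel_measurable (F s)" "integrable M Z"
  shows "integrable M (\<lambda>\<omega>. Z \<omega> * (dX s t \<omega> $ i $ j * dX s t \<omega> $ k $ l))"
    and "(\<integral>\<omega>. Z \<omega> * (dX s t \<omega> $ i $ j * dX s t \<omega> $ k $ l) \<partial>M)
      = (if i = l \<and> j = k then - of_real (t - s) / of_nat CARD('n) * (\<integral>\<omega>. Z \<omega> \<partial>M) else 0)"
proof -
  have *: "integrable M (\<lambda>\<omega>. Z \<omega> * (dX s t \<omega> $ i $ j * dX s t \<omega> $ k $ l)) \<and>
      (\<integral>\<omega>. Z \<omega> * (dX s t \<omega> $ i $ j * dX s t \<omega> $ k $ l) \<partial>M)
      = (if i = l \<and> j = k then - of_real (t - s) / of_nat CARD('n) * (\<integral>\<omega>. Z \<omega> \<partial>M) else 0)"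
  proof (cases "s = t")
    case False
    with st have lt: "s < t" by simp
    let ?W = "\<lambda>\<xi> \<eta> \<omega>. complex_of_real (incr s t \<xi> \<omega> * incr s t \<eta> \<omega>)"
    have 1: "integrable M (\<lambda>\<omega>. Z \<omega> * ?W \<xi> \<eta> \<omega>)"
        "(\<integral>\<omega>. Z \<omega> * ?W \<xi> \<eta> \<omega> \<partial>M) = (if \<eta> = \<xi> then (\<integral>\<omega>. Z \<omega> \<partial>M) * of_real (t - s) else 0)"
      if "\<xi> \<in> skew_basis" "\<eta> \<in> skew_basis" for \<xi> \<eta>
    proof -
      have "?W \<xi> \<eta> \<in> borel_measurable (incr_algebra s t)"
        using incr_measurable[OF that(1), of s t] incr_measurable[OF that(2), of s t]
        by measurable
      moreover have "integrable M (?W \<xi> \<eta>)" "(\<integral>\<omega>. ?W \<xi> \<eta> \<omega> \<partial>M) = (if \<eta> = \<xi> then of_real (t - s) else 0)"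
        using incr_covariance[OF that st(1) lt] by (auto simp del: of_real_mult)
      ultimately show "integrable M (\<lambda>\<omega>. Z \<omega> * ?W \<xi> \<eta> \<omega>)"
        "(\<integral>\<omega>. Z \<omega> * ?W \<xi> \<eta> \<omega> \<partial>M) = (if \<eta> = \<xi> then (\<integral>\<omega>. Z \<omega> \<partial>M) * of_real (t - s) else 0)"
        using indep_product[OF st(1) lt Z, of "?W \<xi> \<eta>"] by (auto simp del: of_real_mult)
    qed
    have eq: "Z \<omega> * (dX s t \<omega> $ i $ j * dX s t \<omega> $ k $ l)
        = (\<Sum>\<xi>\<in>skew_basis. \<Sum>\<eta>\<in>skew_basis. (Z \<omega> * ?W \<xi> \<eta> \<omega>) * (\<xi> $ i $ j * \<eta> $ k $ l))" for \<omega>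
      unfolding dX_entry unfolding sum_product unfolding sum_distrib_left
      by (intro sum.cong refl) (simp add: mult_ac)
    have hb: "has_bochner_integral M (\<lambda>\<omega>. Z \<omega> * (dX s t \<omega> $ i $ j * dX s t \<omega> $ k $ l))
        (\<Sum>\<xi>\<in>skew_basis. \<Sum>\<eta>\<in>skew_basis. (\<integral>\<omega>. Z \<omega> * ?W \<xi> \<eta> \<omega> \<partial>M) * (\<xi> $ i $ j * \<eta> $ k $ l))"
      unfolding eq using 1(1)
      by (intro has_bochner_integral_sum has_bochner_integral_mult_left has_bochner_integral_integrable) auto
    then have "(\<integral>\<omega>. Z \<omega> * (dX s t \<omega> $ i $ j * dX s t \<omega> $ k $ l) \<partial>M)
        = (\<Sum>\<xi>\<in>skew_basis. \<Sum>\<eta>\<in>skew_basis. (\<integral>\<omega>. Z \<omega> * ?W \<xi> \<eta> \<omega> \<partial>M) * (\<xi> $ i $ j * \<eta> $ k $ l))"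
      by (rule has_bochner_integral_integral_eq)
    also have "\<dots> = (\<Sum>\<xi>\<in>skew_basis. \<Sum>\<eta>\<in>skew_basis.
        if \<eta> = \<xi> then (\<integral>\<omega>. Z \<omega> \<partial>M) * of_real (t - s) * (\<xi> $ i $ j * \<xi> $ k $ l) else 0)"
      by (intro sum.cong refl) (simp add: 1(2) del: of_real_mult)
    also have "\<dots> = (\<integral>\<omega>. Z \<omega> \<partial>M) * of_real (t - s) * (\<Sum>\<xi>\<in>skew_basis. \<xi> $ i $ j * \<xi> $ k $ l)"
      by (simp add: finite_skew_basis sum_distrib_left)
    finally have "(\<integral>\<omega>. Z \<omega> * (dX s t \<omega> $ i $ j * dX s t \<omega> $ k $ l) \<partial>M)
      = (if i = l \<and> j = k then - of_real (t - s) / of_nat CARD('n) * (\<integral>\<omega>. Z \<omega> \<partial>M) else 0)"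
      unfolding skew_basis_contraction by (simp add: mult.commute del: of_real_diff)
    moreover have "integrable M (\<lambda>\<omega>. Z \<omega> * (dX s t \<omega> $ i $ j * dX s t \<omega> $ k $ l))"
      using hb by (rule integrable.intros)
    ultimately show ?thesis by blast
  qed simp
  then show "integrable M (\<lambda>\<omega>. Z \<omega> * (dX s t \<omega> $ i $ j * dX s t \<omega> $ k $ l))"
    and "(\<integral>\<omega>. Z \<omega> * (dX s t \<omega> $ i $ j * dX s t \<omega> $ k $ l) \<partial>M)
      = (if i = l \<and> j = k then - of_real (t - s) / of_nat CARD('n) * (\<integral>\<omega>. Z \<omega> \<partial>M) else 0)"
    by auto
qed

lemma trace_incr_first:
  assumes st: "0 \<le> s" "s \<le> t" and P: "P \<in> borel_measurable (F s)" "integrable M P"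
  shows "has_bochner_integral M (\<lambda>\<omega>. trace (P \<omega> ** dX s t \<omega>)) 0"
proof -
  have "has_bochner_integral M (\<lambda>\<omega>. \<Sum>i\<in>UNIV. \<Sum>j\<in>UNIV. P \<omega> $ i $ j * dX s t \<omega> $ j $ i)
      (\<Sum>i\<in>(UNIV :: 'n set). \<Sum>j\<in>(UNIV :: 'n set). 0)"
  proof (intro has_bochner_integral_sum)
    fix i j :: 'n
    have "integrable M (\<lambda>\<omega>. P \<omega> $ i $ j)"
      using integrable_bounded_linear[OF bounded_linear_compose[OF bounded_linear_vec_nth
          bounded_linear_vec_nth] P(2)] .
    moreover have "(\<lambda>\<omega>. P \<omega> $ i $ j) \<in> borel_measurable (F s)"
      using P(1) by measurable
    ultimately show "has_bochner_integral M (\<lambda>\<omega>. P \<omega> $ i $ j * dX s t \<omega> $ j $ i) 0"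
      using incr_entry_first[OF st] by (simp add: has_bochner_integral_iff)
  qed
  then show ?thesis
    by (simp add: trace_def matrix_matrix_mult_def)
qed

text \<open>
  The mean of \<open>Tr (P x Q x)\<close>. The integrability assumption is on products of entries,
  so that it covers a bounded \<open>Q\<close> together with a \<open>P\<close> that is merely
  integrable.
\<close>

lemma trace_incr_second:
  assumes st: "0 \<le> s" "s \<le> t" and P: "P \<in> borel_measurable (F s)" and Q: "Q \<in> borel_measurable (F s)"
    and PQ: "\<And>i j k l. integrable M (\<lambda>\<omega>. P \<omega> $ i $ j * Q \<omega> $ k $ l)"
  shows "has_bochner_integral M (\<lambda>\<omega>. trace (P \<omega> ** dX s t \<omega> ** Q \<omega> ** dX s t \<omega>))
    (of_real (t - s) * (\<integral>\<omega>. - (trace (P \<omega>) * trace (Q \<omega>)) / of_nat CARD('n) \<partial>M))"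
proof -
  define c :: complex where "c = - of_real (t - s) / of_nat CARD('n)"
  define e where "e i j k l = (if j = i \<and> k = l then c * (\<integral>\<omega>. P \<omega> $ i $ j * Q \<omega> $ k $ l \<partial>M) else 0)" for i j k l
  have e_eq: "e i j k l = (if l = k then
      if j = i then c * (\<integral>\<omega>. P \<omega> $ i $ i * Q \<omega> $ k $ k \<partial>M) else 0 else 0)" for i j k l
    by (auto simp: e_def)
  have expand: "trace (P ** x ** Q ** x) = (\<Sum>i\<in>UNIV. \<Sum>k\<in>UNIV. \<Sum>l\<in>UNIV. \<Sum>j\<in>UNIV.
      P $ i $ j * Q $ k $ l * (x $ j $ k * x $ l $ i))" for P Q x :: "'n cmat"
  proof -
    have "trace (P ** x ** Q ** x) = (\<Sum>i\<in>UNIV. \<Sum>l\<in>UNIV. \<Sum>k\<in>UNIV. \<Sum>j\<in>UNIV.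
        P $ i $ j * Q $ k $ l * (x $ j $ k * x $ l $ i))"
      by (simp add: trace_def matrix_matrix_mult_def sum_distrib_right sum_distrib_left mult_ac)
    then show ?thesis
      by (subst (2) sum.swap)
  qed
  have "has_bochner_integral M (\<lambda>\<omega>. trace (P \<omega> ** dX s t \<omega> ** Q \<omega> ** dX s t \<omega>))
      (\<Sum>i\<in>UNIV. \<Sum>k\<in>UNIV. \<Sum>l\<in>UNIV. \<Sum>j\<in>UNIV. e i j k l)"
    unfolding expand
  proof (intro has_bochner_integral_sum)
    fix i j k l :: 'n
    have "(\<lambda>\<omega>. P \<omega> $ i $ j * Q \<omega> $ k $ l) \<in> borel_measurable (F s)"
      using P Q by measurable
    then show "has_bochner_integral M (\<lambda>\<omega>. P \<omega> $ i $ j * Q \<omega> $ k $ l *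
        (dX s t \<omega> $ j $ k * dX s t \<omega> $ l $ i)) (e i j k l)"
      using incr_entry_second[OF st _ PQ, of i j k l j k l i]
          by (simp add: has_bochner_integral_iff e_def c_def)
  qed
  also have "(\<Sum>i\<in>UNIV. \<Sum>k\<in>UNIV. \<Sum>l\<in>UNIV. \<Sum>j\<in>UNIV. e i j k l)
      = (\<Sum>i\<in>UNIV. \<Sum>k\<in>UNIV. c * (\<integral>\<omega>. P \<omega> $ i $ i * Q \<omega> $ k $ k \<partial>M))"
  proof (intro sum.cong refl)
    fix i k :: 'n
    have "(\<Sum>l\<in>UNIV. \<Sum>j\<in>UNIV. e i j k l)
        = (\<Sum>l\<in>UNIV. if l = k then c * (\<integral>\<omega>. P \<omega> $ i $ i * Q \<omega> $ k $ k \<partial>M) else 0)"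
      unfolding e_eq by (intro sum.cong refl) simp
    then show "(\<Sum>l\<in>UNIV. \<Sum>j\<in>UNIV. e i j k l) = c * (\<integral>\<omega>. P \<omega> $ i $ i * Q \<omega> $ k $ k \<partial>M)"
      by simp
  qed
  also have "\<dots> = c * (\<integral>\<omega>. (\<Sum>i\<in>UNIV. \<Sum>k\<in>UNIV. P \<omega> $ i $ i * Q \<omega> $ k $ k) \<partial>M)"
    by (simp add: PQ sum_distrib_left)
  also have "\<dots> = c * (\<integral>\<omega>. trace (P \<omega>) * trace (Q \<omega>) \<partial>M)"
    by (simp add: trace_def sum_product)
  also have "\<dots> = of_real (t - s) * (\<integral>\<omega>. - (trace (P \<omega>) * trace (Q \<omega>)) / of_nat CARD('n) \<partial>M)"
    by (simp add: c_def del: of_real_diff)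
  finally show ?thesis .
qed

lemma sum_power_le:
  fixes a :: "'b \<Rightarrow> real"
  assumes J: "finite J" "J \<noteq> {}" and a: "\<And>j. j \<in> J \<Longrightarrow> 0 \<le> a j"
  shows "(\<Sum>j\<in>J. a j) ^ m \<le> real (card J) ^ m * (\<Sum>j\<in>J. a j ^ m)"
proof -
  have "Max (a ` J) \<in> a ` J"
    using J by (intro Max_in) auto
  then obtain i where "i \<in> J" "Max (a ` J) = a i"
    by auto
  then have i: "i \<in> J" "\<And>j. j \<in> J \<Longrightarrow> a j \<le> a i"
    using J by (auto simp flip: \<open>Max (a ` J) = a i\<close>)
  have "(\<Sum>j\<in>J. a j) \<le> real (card J) * a i"
    using sum_bounded_above[of J a "a i"] i by simp
  then have "(\<Sum>j\<in>J. a j) ^ m \<le> (real (card J) * a i) ^ m"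
    using a by (intro power_mono sum_nonneg) auto
  also have "\<dots> = real (card J) ^ m * a i ^ m"
    by (rule power_mult_distrib)
  also have "\<dots> \<le> real (card J) ^ m * (\<Sum>j\<in>J. a j ^ m)"
    using i J a by (intro mult_left_mono member_le_sum[of i J "\<lambda>j. a j ^ m"]) auto
  finally show ?thesis .
qed

text \<open>
  Moments scale like powers of the square root of the time step. The constant is left implicit; what
  matters below is that it does not depend on the interval.
\<close>

lemma dX_moment:
  assumes "k > 0"
  shows "\<exists>C\<ge>0. \<forall>s t. 0 \<le> s \<longrightarrow> s \<le> t \<longrightarrow>
    integrable M (\<lambda>\<omega>. norm (dX s t \<omega>) ^ (2 * k)) \<and> (\<integral>\<omega>. norm (dX s t \<omega>) ^ (2 * k) \<partial>M) \<le> C * (t - s) ^ k"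
proof -
  let ?J = "skew_basis :: 'n cmat set"
  define K where "K = real (card ?J) ^ (2 * k)"
  define C where "C = K * (\<Sum>\<xi>\<in>?J. fact (2 * k) / (2 ^ k * fact k) * norm \<xi> ^ (2 * k))"
  have K: "K \<ge> 0" by (simp add: K_def)
  have J: "finite ?J" "?J \<noteq> {}"
    by (rule finite_skew_basis) (rule skew_basis_nonempty)
  have bound: "norm (dX s t \<omega>) ^ (2 * k) \<le> K * (\<Sum>\<xi>\<in>?J. incr s t \<xi> \<omega> ^ (2 * k) * norm \<xi> ^ (2 * k))" for s t \<omega>
  proof -
    have "norm (dX s t \<omega>) \<le> (\<Sum>\<xi>\<in>?J. \<bar>incr s t \<xi> \<omega>\<bar> * norm \<xi>)"
      unfolding dX_eq by (rule order_trans[OF norm_sum]) simp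
    then have "norm (dX s t \<omega>) ^ (2 * k) \<le> (\<Sum>\<xi>\<in>?J. \<bar>incr s t \<xi> \<omega>\<bar> * norm \<xi>) ^ (2 * k)"
      by (intro power_mono) auto
    also have "\<dots> \<le> K * (\<Sum>\<xi>\<in>?J. (\<bar>incr s t \<xi> \<omega>\<bar> * norm \<xi>) ^ (2 * k))"
      unfolding K_def by (rule sum_power_le[OF J]) simp
    also have "(\<Sum>\<xi>\<in>?J. (\<bar>incr s t \<xi> \<omega>\<bar> * norm \<xi>) ^ (2 * k))
        = (\<Sum>\<xi>\<in>?J. incr s t \<xi> \<omega> ^ (2 * k) * norm \<xi> ^ (2 * k))"
      by (simp add: power_mult_distrib power_even_abs)
    finally show ?thesis .
  qed
  have "integrable M (\<lambda>\<omega>. norm (dX s t \<omega>) ^ (2 * k)) \<and> (\<integral>\<omega>. norm (dX s t \<omega>) ^ (2 * k) \<partial>M) \<le> C * (t - s) ^ k"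
    if st: "0 \<le> s" "s \<le> t" for s t
  proof (cases "s = t")
    case True
    then show ?thesis using assms by (simp add: zero_power)
  next
    case False
    with st have lt: "s < t" by simp
    have meas[measurable]: "dX s t \<in> borel_measurable M"
      using st by (intro dX_measurable) auto
    have int: "integrable M (\<lambda>\<omega>. K * (\<Sum>\<xi>\<in>?J. incr s t \<xi> \<omega> ^ (2 * k) * norm \<xi> ^ (2 * k)))"
      using incr_moment(1)[OF _ st(1) lt]
          by (intro integrable_mult_right Bochner_Integration.integrable_sum integrable_mult_left) auto
    have 1: "integrable M (\<lambda>\<omega>. norm (dX s t \<omega>) ^ (2 * k))"
      by (rule Bochner_Integration.integrable_bound[OF int]) (use bound
          in \<open>auto intro!: AE_I2 order_trans[OF bound]\<close>)
    have "(\<integral>\<omega>. norm (dX s t \<omega>) ^ (2 * k) \<partial>M)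
        \<le> (\<integral>\<omega>. K * (\<Sum>\<xi>\<in>?J. incr s t \<xi> \<omega> ^ (2 * k) * norm \<xi> ^ (2 * k)) \<partial>M)"
      by (rule integral_mono[OF 1 int bound])
    also have "\<dots> = K * (\<Sum>\<xi>\<in>?J. fact (2 * k) / (2 ^ k * fact k) * (t - s) ^ k * norm \<xi> ^ (2 * k))"
      using incr_moment(1,2)[OF _ st(1) lt, of _ k] by (simp add: Bochner_Integration.integral_sum)
    also have "\<dots> = C * (t - s) ^ k"
      by (simp add: C_def sum_distrib_left sum_distrib_right mult_ac)
    finally show ?thesis using 1 by simp
  qed
  moreover have "C \<ge> 0"
    unfolding C_def using K by (intro mult_nonneg_nonneg sum_nonneg) auto
  ultimately show ?thesis by blast
qed

text \<open>
  Interpolation between the constant and the sixth moment, which is available from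
  \<open>dX_moment\<close>.
\<close>

lemma dX_third_moment:
  "\<exists>C\<ge>0. \<forall>s t. 0 \<le> s \<longrightarrow> s \<le> t \<longrightarrow>
    integrable M (\<lambda>\<omega>. norm (dX s t \<omega>) ^ 3) \<and> (\<integral>\<omega>. norm (dX s t \<omega>) ^ 3 \<partial>M) \<le> C * sqrt (t - s) ^ 3"
proof -
  obtain C where C: "C \<ge> 0" "\<And>s t. 0 \<le> s \<Longrightarrow> s \<le> t \<Longrightarrow>
    integrable M (\<lambda>\<omega>. norm (dX s t \<omega>) ^ (2 * 3)) \<and> (\<integral>\<omega>. norm (dX s t \<omega>) ^ (2 * 3) \<partial>M) \<le> C * (t - s) ^ 3"
    using dX_moment[of 3] by auto
  have "integrable M (\<lambda>\<omega>. norm (dX s t \<omega>) ^ 3) \<and> (\<integral>\<omega>. norm (dX s t \<omega>) ^ 3 \<partial>M) \<le> (1 + C) * sqrt (t - s) ^ 3"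
    if st: "0 \<le> s" "s \<le> t" for s t
  proof (cases "s = t")
    case False
    with st have lt: "s < t" by simp
    \<comment> \<open>The interpolation is taken at the expected size of the third power.\<close>
    define r where "r = sqrt (t - s) ^ 3"
    have r: "r > 0" "r * r = (t - s) ^ 3"
      using lt by (simp_all add: r_def flip: power_mult_distrib)
    have [measurable]: "dX s t \<in> borel_measurable M"
      using st by (intro dX_measurable) auto
    have bound: "y ^ 3 \<le> r + y ^ (2 * 3) / r" if "y \<ge> 0" for y :: real
    proof -
      have "0 \<le> (y ^ 3 - r)\<^sup>2 + y ^ 3 * r"
        using r that by simp
      then have "y ^ 3 * r \<le> r * r + y ^ (2 * 3)"
        by (simp add: power2_eq_square algebra_simps flip: power_add)
      then show ?thesis using r by (simp add: field_simps)
    qed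
    have int: "integrable M (\<lambda>\<omega>. r + norm (dX s t \<omega>) ^ (2 * 3) / r)"
      using C(2)[OF st] by auto
    have 1: "integrable M (\<lambda>\<omega>. norm (dX s t \<omega>) ^ 3)"
      by (rule Bochner_Integration.integrable_bound[OF int])
          (auto intro!: AE_I2 order_trans[OF bound] simp del: mult_numeral_left_semiring_numeral)
    have "(\<integral>\<omega>. norm (dX s t \<omega>) ^ 3 \<partial>M) \<le> (\<integral>\<omega>. r + norm (dX s t \<omega>) ^ (2 * 3) / r \<partial>M)"
      by (rule integral_mono[OF 1 int bound]) simp
    also have "\<dots> = r + (\<integral>\<omega>. norm (dX s t \<omega>) ^ (2 * 3) \<partial>M) / r"
      using C(2)[OF st] by (simp add: prob_space)
    also have "\<dots> \<le> r + C * (r * r) / r"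
      using C(2)[OF st] r by (intro add_left_mono divide_right_mono) auto
    also have "\<dots> = (1 + C) * r"
      using r by (simp add: field_simps)
    finally show ?thesis using 1 by (simp add: r_def)
  qed simp
  then show ?thesis using C(1) by (intro exI[of _ "1 + C"]) auto
qed

end

context brownian_family
begin

section \<open>The Ito isometry\<close>

text \<open>
  Coefficients of step processes: bounded and known at time \<open>s\<close>.
\<close>

definition bounded_adapted :: "real \<Rightarrow> ('a \<Rightarrow> 'n cmat) \<Rightarrow> bool" where
  "bounded_adapted s Z \<longleftrightarrow> Z \<in> borel_measurable (F s) \<and> (\<exists>C. \<forall>\<omega>\<in>space M. norm (Z \<omega>) \<le> C)"

lemma bounded_adapted_mono: "s \<le> t \<Longrightarrow> bounded_adapted s Z \<Longrightarrow> bounded_adapted t Z"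
  unfolding bounded_adapted_def using measurable_F_mono by blast

lemma bounded_adapted_measurable: "bounded_adapted s Z \<Longrightarrow> Z \<in> borel_measurable M"
  unfolding bounded_adapted_def using measurable_F by blast

lemma bounded_adapted_minus: "bounded_adapted s Z \<Longrightarrow> bounded_adapted s (\<lambda>\<omega>. - Z \<omega>)"
  unfolding bounded_adapted_def by auto

lemma bounded_adapted_one: "bounded_adapted s (\<lambda>_. mat 1)"
  unfolding bounded_adapted_def by auto

lemma bounded_adapted_mult: 
  assumes "bounded_adapted s Z" "bounded_adapted s V"
  shows "bounded_adapted s (\<lambda>\<omega>. Z \<omega> ** V \<omega>)"
proof -
  obtain C D where C: "\<And>\<omega>. \<omega> \<in> space M \<Longrightarrow> norm (Z \<omega>) \<le> C" and D: "\<And>\<omega>. \<omega> \<in> space M \<Longrightarrow> norm (V \<omega>) \<le> D"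
    using assms unfolding bounded_adapted_def by blast
  have "norm (Z \<omega> ** V \<omega>) \<le> C * D" if "\<omega> \<in> space M" for \<omega>
    by (rule matmul_mono[OF C[OF that] D[OF that]])
  then show ?thesis
    using assms unfolding bounded_adapted_def by (auto intro!: exI[of _ "C * D"])
qed

lemma bounded_adapted_cadjoint: "bounded_adapted s Z \<Longrightarrow> bounded_adapted s (\<lambda>\<omega>. cadjoint (Z \<omega>))"
  unfolding bounded_adapted_def by auto

lemma dX_integrable:
  assumes "0 \<le> s" "s \<le> t"
  shows "integrable M (dX s t)"
proof (cases "s = t")
  case True
  then have "dX s t = (\<lambda>_. 0)" by auto
  then show ?thesis by simp
next
  case False
  then have "s < t" using assms by simp
  then have "integrable M (\<lambda>\<omega>. \<Sum>\<xi>\<in>skew_basis. incr s t \<xi> \<omega> *\<^sub>R \<xi>)"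
    using incr_moment(3)[OF _ assms(1)]
        by (intro Bochner_Integration.integrable_sum integrable_scaleR_left) auto
  then show ?thesis
    unfolding dX_eq[abs_def] .
qed

lemma bounded_mult_integrable:
  fixes f :: "'a \<Rightarrow> 'n cmat"
  assumes Z: "bounded_adapted s Z" and f: "integrable M f"
  shows "integrable M (\<lambda>\<omega>. Z \<omega> ** f \<omega>)"
proof -
  obtain C where C: "\<And>\<omega>. \<omega> \<in> space M \<Longrightarrow> norm (Z \<omega>) \<le> C"
    using Z unfolding bounded_adapted_def by blast
  have [measurable]: "Z \<in> borel_measurable M" "f \<in> borel_measurable M"
    using bounded_adapted_measurable[OF Z] f by auto
  have "integrable M (\<lambda>\<omega>. C * norm (f \<omega>))"
    using f by auto
  then show ?thesis
  proof (rule Bochner_Integration.integrable_bound)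
    show "AE \<omega> in M. norm (Z \<omega> ** f \<omega>) \<le> norm (C * norm (f \<omega>))"
    proof (rule AE_I2)
      fix \<omega> assume "\<omega> \<in> space M"
      then have "norm (Z \<omega> ** f \<omega>) \<le> C * norm (f \<omega>)"
        by (rule matmul_mono[OF C order_refl])
      then show "norm (Z \<omega> ** f \<omega>) \<le> norm (C * norm (f \<omega>))" by simp
    qed
  qed measurable
qed

lemma bounded_adapted_integrable:
  assumes "bounded_adapted s Z"
  shows "integrable M Z"
  using bounded_mult_integrable[OF assms, of "\<lambda>_. mat 1"] by simp

lemma has_bochner_integral_Re: "has_bochner_integral M f x \<Longrightarrow> has_bochner_integral M (\<lambda>\<omega>. Re (f \<omega>)) (Re x)"
  by (rule has_bochner_integral_bounded_linear[OF bounded_linear_Re])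

lemma inner_incr_same:
  assumes st: "0 \<le> s" "s \<le> t" and Z: "bounded_adapted s Z" and V: "bounded_adapted s V"
  shows "has_bochner_integral M (\<lambda>\<omega>. inner (Z \<omega> ** dX s t \<omega>) (V \<omega> ** dX s t \<omega>))
    ((t - s) * (\<integral>\<omega>. inner (Z \<omega>) (V \<omega>) \<partial>M))"
proof -
  let ?P = "\<lambda>\<omega>. cadjoint (V \<omega>) ** Z \<omega>"
  have P: "bounded_adapted s ?P"
    by (intro bounded_adapted_mult bounded_adapted_cadjoint Z V)
  have int: "integrable M (\<lambda>\<omega>. ?P \<omega> $ i $ j * (mat 1 :: 'n cmat) $ k $ l)" for i j k l
    using integrable_bounded_linear[OF bounded_linear_compose[OF bounded_linear_vec_nth bounded_linear_vec_nth]
        bounded_adapted_integrable[OF P]]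
    by (intro integrable_mult_left) simp
  have "has_bochner_integral M (\<lambda>\<omega>. trace (?P \<omega> ** dX s t \<omega> ** mat 1 ** dX s t \<omega>))
      (of_real (t - s) * (\<integral>\<omega>. - (trace (?P \<omega>) * trace (mat 1 :: 'n cmat)) / of_nat CARD('n) \<partial>M))"
    by (rule trace_incr_second[OF st]) (use P int in \<open>auto simp: bounded_adapted_def\<close>)
  then have hb: "has_bochner_integral M (\<lambda>\<omega>. - Re (trace (?P \<omega> ** dX s t \<omega> ** mat 1 ** dX s t \<omega>)))
      (- Re (of_real (t - s) * (\<integral>\<omega>. - (trace (?P \<omega>) * trace (mat 1 :: 'n cmat)) / of_nat CARD('n) \<partial>M)))"
    by (intro has_bochner_integral_minus has_bochner_integral_Re)
  have 1: "trace (mat 1 :: 'n cmat) = of_nat CARD('n)"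
    by (simp add: trace_def mat_def)
  have inner: "inner (Z \<omega>) (V \<omega>) = Re (trace (?P \<omega>))" for \<omega>
    unfolding inner_cmat by (subst trace_mul_sym) simp
  have tr_int: "integrable M (\<lambda>\<omega>. trace (?P \<omega>))"
    by (rule integrable_bounded_linear[OF bounded_linear_trace bounded_adapted_integrable[OF P]])
  have "- Re (trace (?P \<omega> ** dX s t \<omega> ** mat 1 ** dX s t \<omega>)) = inner (Z \<omega> ** dX s t \<omega>) (V \<omega> ** dX s t \<omega>)" for \<omega>
  proof -
    let ?x = "dX s t \<omega>"
    have "inner (Z \<omega> ** ?x) (V \<omega> ** ?x) = - Re (trace (Z \<omega> ** ?x ** ?x ** cadjoint (V \<omega>)))"
      using dX_skew[of s t \<omega>]
      by (simp add: inner_cmat cadjoint_mult skew_def matmul_simps trace_simps matrix_mul_assoc)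
    also have "trace (Z \<omega> ** ?x ** ?x ** cadjoint (V \<omega>)) = trace (cadjoint (V \<omega>) ** (Z \<omega> ** ?x ** ?x))"
      by (rule trace_mul_sym)
    finally show ?thesis by (simp add: matrix_mul_assoc)
  qed
  moreover have "- Re (of_real (t - s) * (\<integral>\<omega>. - (trace (?P \<omega>) * trace (mat 1 :: 'n cmat)) / of_nat CARD('n) \<partial>M))
      = (t - s) * (\<integral>\<omega>. inner (Z \<omega>) (V \<omega>) \<partial>M)"
    unfolding inner 1 using integral_Re[OF tr_int] by simp
  ultimately show ?thesis
    using hb by simp
qed

lemma inner_incr_disjoint:
  assumes "0 \<le> a" "a \<le> b" "b \<le> c" "c \<le> d" and Z: "bounded_adapted a Z" and V: "bounded_adapted c V"
  shows "has_bochner_integral M (\<lambda>\<omega>. inner (Z \<omega> ** dX a b \<omega>) (V \<omega> ** dX c d \<omega>)) 0"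
proof -
  let ?P = "\<lambda>\<omega>. (cadjoint (V \<omega>) ** Z \<omega>) ** dX a b \<omega>"
  have VZ: "bounded_adapted c (\<lambda>\<omega>. cadjoint (V \<omega>) ** Z \<omega>)"
    by (intro bounded_adapted_mult bounded_adapted_cadjoint V bounded_adapted_mono[OF _ Z]) (use assms in simp)
  have "has_bochner_integral M (\<lambda>\<omega>. trace (?P \<omega> ** dX c d \<omega>)) 0"
  proof (rule trace_incr_first)
    show "?P \<in> borel_measurable (F c)"
      by (rule borel_measurable_matmul[OF VZ[unfolded bounded_adapted_def, THEN conjunct1] dX_measurable_F])
         (use assms in auto)
    show "integrable M ?P"
      by (rule bounded_mult_integrable[OF VZ dX_integrable]) (use assms in auto)
  qed (use assms in auto)
  then have hb: "has_bochner_integral M (\<lambda>\<omega>. - Re (trace (?P \<omega> ** dX c d \<omega>))) (- Re 0)"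
    by (intro has_bochner_integral_minus has_bochner_integral_Re)
  have "- Re (trace (?P \<omega> ** dX c d \<omega>)) = inner (Z \<omega> ** dX a b \<omega>) (V \<omega> ** dX c d \<omega>)" for \<omega>
  proof -
    let ?x = "dX a b \<omega>" and ?y = "dX c d \<omega>"
    have "inner (Z \<omega> ** ?x) (V \<omega> ** ?y) = - Re (trace (Z \<omega> ** ?x ** ?y ** cadjoint (V \<omega>)))"
      using dX_skew[of c d \<omega>]
      by (simp add: inner_cmat cadjoint_mult skew_def matmul_simps trace_simps matrix_mul_assoc)
    also have "trace (Z \<omega> ** ?x ** ?y ** cadjoint (V \<omega>)) = trace (cadjoint (V \<omega>) ** (Z \<omega> ** ?x ** ?y))"
      by (rule trace_mul_sym)
    finally show ?thesis by (simp add: matrix_mul_assoc)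
  qed
  then show ?thesis
    using hb by simp
qed

text \<open>
  The isometry for two single increments. Overlapping intervals are cut at their end points; of the
  products of the pieces only that of the common piece with itself has a nonzero mean.
\<close>

lemma inner_incr:
  assumes ab: "0 \<le> a" "a \<le> b" and cd: "0 \<le> c" "c \<le> d" and Z: "bounded_adapted a Z" and V: "bounded_adapted c V"
  shows "has_bochner_integral M (\<lambda>\<omega>. inner (Z \<omega> ** dX a b \<omega>) (V \<omega> ** dX c d \<omega>))
    (max 0 (min b d - max a c) * (\<integral>\<omega>. inner (Z \<omega>) (V \<omega>) \<partial>M))"
proof -
  have ordered: "has_bochner_integral M (\<lambda>\<omega>. inner (Z \<omega> ** dX a b \<omega>) (V \<omega> ** dX c d \<omega>))
      (max 0 (min b d - max a c) * (\<integral>\<omega>. inner (Z \<omega>) (V \<omega>) \<partial>M))"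
    if ab: "0 \<le> a" "a \<le> b" and cd: "c \<le> d" and Z: "bounded_adapted a Z" and V: "bounded_adapted c V"
        and ac: "a \<le> c"
    for a b c d Z V
  proof (cases "b \<le> c")
    case True
    then have "max 0 (min b d - max a c) = 0" using ac by simp
    then show ?thesis
      using inner_incr_disjoint[OF ab True cd Z V] by simp
  next
    case False
    \<comment> \<open>The intervals overlap in \<open>(c, m]\<close>.\<close>
    define m where "m = min b d"
    have m: "c \<le> m" "m \<le> b" "m \<le> d" "m = b \<or> m = d" "max 0 (min b d - max a c) = m - c"
      using False cd ac by (auto simp: m_def)
    have c0: "0 \<le> c" "0 \<le> m" using ab ac m by auto
    have Zc: "bounded_adapted c Z" and Zm: "bounded_adapted m Z" and Vm: "bounded_adapted m V"
      using Z V ac m by (auto intro: bounded_adapted_mono)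
    note h1 = inner_incr_disjoint[OF ab(1) ac order_refl m(1) Z V]
    note h2 = inner_incr_disjoint[OF ab(1) ac m(1) m(3) Z Vm]
    note h3 = inner_incr_same[OF c0(1) m(1) Zc V]
    note h4 = inner_incr_disjoint[OF c0(1) m(1) order_refl m(3) Zc Vm]
    note h5 = inner_incr_disjoint[OF c0(1) m(1) order_refl m(2) V Zm]
    have zero: "inner (Z \<omega> ** dX m b \<omega>) (V \<omega> ** dX m d \<omega>) = 0" for \<omega>
      using m(4) by (auto simp: matmul_simps)
    have "inner (Z \<omega> ** dX a b \<omega>) (V \<omega> ** dX c d \<omega>) =
        inner (Z \<omega> ** dX a c \<omega>) (V \<omega> ** dX c m \<omega>) + inner (Z \<omega> ** dX a c \<omega>) (V \<omega> ** dX m d \<omega>)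
        + inner (Z \<omega> ** dX c m \<omega>) (V \<omega> ** dX c m \<omega>) + inner (Z \<omega> ** dX c m \<omega>) (V \<omega> ** dX m d \<omega>)
        + inner (V \<omega> ** dX c m \<omega>) (Z \<omega> ** dX m b \<omega>)" for \<omega>
    proof -
      have "dX a b \<omega> = dX a c \<omega> + dX c m \<omega> + dX m b \<omega>" "dX c d \<omega> = dX c m \<omega> + dX m d \<omega>"
        by (simp_all add: dX_def)
      then show ?thesis
        using zero[of \<omega>]
        by (simp add: matmul_simps inner_add_left inner_add_right inner_commute[of "V \<omega> ** dX c m \<omega>"
            "Z \<omega> ** dX m b \<omega>"])
    qed
    moreover have "has_bochner_integral M (\<lambda>\<omega>. inner (Z \<omega> ** dX a c \<omega>) (V \<omega> ** dX c m \<omega>)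
        + inner (Z \<omega> ** dX a c \<omega>) (V \<omega> ** dX m d \<omega>)
        + inner (Z \<omega> ** dX c m \<omega>) (V \<omega> ** dX c m \<omega>) + inner (Z \<omega> ** dX c m \<omega>) (V \<omega> ** dX m d \<omega>)
        + inner (V \<omega> ** dX c m \<omega>) (Z \<omega> ** dX m b \<omega>)) (0 + 0 + (m - c) * (\<integral>\<omega>. inner (Z \<omega>) (V \<omega>) \<partial>M) + 0 + 0)"
      by (intro has_bochner_integral_add h1 h2 h3 h4 h5)
    ultimately show ?thesis
      unfolding m(5) by simp
  qed
  show ?thesis
  proof (cases "a \<le> c")
    case True
    then show ?thesis using ordered ab cd Z V by blast
  next
    case False
    then show ?thesis
      using ordered[OF cd ab(2) V Z] by (simp add: inner_commute max.commute min.commute)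
  qed
qed

definition msq :: "('a \<Rightarrow> 'n cmat) \<Rightarrow> ennreal" where
  "msq f = (\<integral>\<^sup>+\<omega>. ennreal ((norm (f \<omega>))\<^sup>2) \<partial>M)"

text \<open>
  Step processes indexed by an arbitrary finite family of intervals, which may overlap. The
  difference of two simple processes on different partitions is again of this form, which replaces a
  common refinement.
\<close>

definition step_process :: "'i set \<Rightarrow> ('i \<Rightarrow> real) \<Rightarrow> ('i \<Rightarrow> real) \<Rightarrow> ('i \<Rightarrow> 'a \<Rightarrow> 'n cmat) \<Rightarrow> real \<Rightarrow> 'a \<Rightarrow> 'n
    cmat" where
  "step_process I a b Z r \<omega> = (\<Sum>i\<in>I. indicator {a i<..b i} r *\<^sub>R Z i \<omega>)"

definition step_integral :: "'i set \<Rightarrow> ('i \<Rightarrow> real) \<Rightarrow> ('i \<Rightarrow> real) \<Rightarrow> ('i \<Rightarrow> 'a \<Rightarrow> 'n cmat) \<Rightarrow> 'a \<Rightarrow> 'n cmat" where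
  "step_integral I a b Z \<omega> = (\<Sum>i\<in>I. Z i \<omega> ** dX (a i) (b i) \<omega>)"

text \<open>
  Both sides expand into the same double sum over pairs of intervals, with the lengths of the
  intersections as coefficients.
\<close>

lemma ito_isometry:
  assumes I: "finite I" and ab: "\<And>i. i \<in> I \<Longrightarrow> 0 \<le> a i \<and> a i \<le> b i"
    and Z: "\<And>i. i \<in> I \<Longrightarrow> bounded_adapted (a i) (Z i)"
  shows "msq (step_integral I a b Z)
    = (\<integral>\<^sup>+\<omega>. (\<integral>\<^sup>+r. ennreal ((norm (step_process I a b Z r \<omega>))\<^sup>2) \<partial>lborel) \<partial>M)"
proof -
  define l where "l i j = max 0 (min (b i) (b j) - max (a i) (a j))" for i j
  define c where "c = (\<Sum>i\<in>I. \<Sum>j\<in>I. l i j * (\<integral>\<omega>. inner (Z i \<omega>) (Z j \<omega>) \<partial>M))"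
  have "has_bochner_integral M (\<lambda>\<omega>. \<Sum>i\<in>I. \<Sum>j\<in>I. inner (Z i \<omega> ** dX (a i) (b i) \<omega>) (Z j \<omega> ** dX (a j)
      (b j) \<omega>)) c"
    unfolding c_def l_def using ab Z by (intro has_bochner_integral_sum inner_incr) auto
  then have hb: "has_bochner_integral M (\<lambda>\<omega>. (norm (step_integral I a b Z \<omega>))\<^sup>2) c"
    unfolding power2_norm_eq_inner step_integral_def inner_sum_left inner_sum_right by (subst sum.swap)
  have 1: "msq (step_integral I a b Z) = ennreal c"
    unfolding msq_def using hb by (subst nn_integral_eq_integral) (auto simp: has_bochner_integral_iff)
  have inter: "{a i<..b i} \<inter> {a j<..b j} = {max (a i) (a j)<..min (b i) (b j)}" for i j
    by auto
  have ind: "has_bochner_integral lborel (\<lambda>r. indicator {a i<..b i} r * indicator {a j<..b j} r)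
      (l i j)" for i j
  proof -
    have fin: "emeasure lborel {x<..y} < \<infinity>" for x y :: real
      by (cases "x \<le> y") auto
    have "has_bochner_integral lborel (indicator {max (a i) (a j)<..min (b i) (b j)} :: real \<Rightarrow> real)
        (measure lborel {max (a i) (a j)<..min (b i) (b j)})"
      by (rule has_bochner_integral_real_indicator[OF _ fin]) simp
    moreover have "measure lborel {x<..y} = max 0 (y - x)" for x y :: real
      by (cases "x \<le> y") auto
    moreover have "(\<lambda>r. indicator {a i<..b i} r * indicator {a j<..b j} r)
        = (indicator {max (a i) (a j)<..min (b i) (b j)} :: real \<Rightarrow> real)"
      by (auto simp: fun_eq_iff split: split_indicator)
    ultimately show ?thesis
      unfolding l_def by simp
  qed
  have "(\<integral>\<^sup>+r. ennreal ((norm (step_process I a b Z r \<omega>))\<^sup>2) \<partial>lborel)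
      = ennreal (\<Sum>i\<in>I. \<Sum>j\<in>I. l i j * inner (Z i \<omega>) (Z j \<omega>))" for \<omega>
  proof -
    have "has_bochner_integral lborel (\<lambda>r. \<Sum>i\<in>I. \<Sum>j\<in>I. (indicator {a i<..b i} r * indicator {a j<..b j}
        r) * inner (Z i \<omega>) (Z j \<omega>))
        (\<Sum>i\<in>I. \<Sum>j\<in>I. l i j * inner (Z i \<omega>) (Z j \<omega>))"
      by (intro has_bochner_integral_sum has_bochner_integral_mult_left ind)
    also have "(\<lambda>r. \<Sum>i\<in>I. \<Sum>j\<in>I. (indicator {a i<..b i} r * indicator {a j<..b j} r) * inner (Z i \<omega>) (Z j \<omega>))
        = (\<lambda>r. (norm (step_process I a b Z r \<omega>))\<^sup>2)"
      unfolding power2_norm_eq_inner step_process_def inner_sum_left inner_sum_right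
      by (rule ext, subst sum.swap) (simp add: mult_ac)
    finally show ?thesis
      by (subst nn_integral_eq_integral) (auto simp: has_bochner_integral_iff)
  qed
  moreover have "(\<integral>\<^sup>+\<omega>. ennreal (\<Sum>i\<in>I. \<Sum>j\<in>I. l i j * inner (Z i \<omega>) (Z j \<omega>)) \<partial>M) = ennreal c"
  proof -
    have int: "integrable M (\<lambda>\<omega>. inner (Z i \<omega>) (Z j \<omega>))" if "i \<in> I" "j \<in> I" for i j
    proof -
      have "bounded_adapted (max (a i) (a j)) (Z i)" "bounded_adapted (max (a i) (a j)) (Z j)"
        using bounded_adapted_mono[OF _ Z[OF that(1)]] bounded_adapted_mono[OF _ Z[OF that(2)]] by simp_all
      then have "integrable M (\<lambda>\<omega>. Z i \<omega> ** cadjoint (Z j \<omega>))"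
        by (intro bounded_adapted_integrable bounded_adapted_mult bounded_adapted_cadjoint)
      then show ?thesis
        unfolding inner_cmat by (intro integrable_Re integrable_bounded_linear[OF bounded_linear_trace])
    qed
    have hb: "has_bochner_integral M (\<lambda>\<omega>. \<Sum>i\<in>I. \<Sum>j\<in>I. l i j * inner (Z i \<omega>) (Z j \<omega>)) c"
      unfolding c_def using int
          by (intro has_bochner_integral_sum has_bochner_integral_mult_right has_bochner_integral_integrable)
    have "0 \<le> (\<Sum>i\<in>I. \<Sum>j\<in>I. l i j * inner (Z i \<omega>) (Z j \<omega>))" for \<omega>
    proof -
      have "(\<integral>r. (\<Sum>i\<in>I. \<Sum>j\<in>I. (indicator {a i<..b i} r * indicator {a j<..b j} r) * inner (Z i \<omega>)
          (Z j \<omega>)) \<partial>lborel)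
        = (\<Sum>i\<in>I. \<Sum>j\<in>I. l i j * inner (Z i \<omega>) (Z j \<omega>))"
        by (rule has_bochner_integral_integral_eq)
            (intro has_bochner_integral_sum has_bochner_integral_mult_left ind)
      also have "(\<lambda>r. \<Sum>i\<in>I. \<Sum>j\<in>I. (indicator {a i<..b i} r * indicator {a j<..b j} r) * inner (Z i \<omega>) (Z j \<omega>))
        = (\<lambda>r. (norm (step_process I a b Z r \<omega>))\<^sup>2)"
        unfolding power2_norm_eq_inner step_process_def inner_sum_left inner_sum_right
        by (rule ext, subst sum.swap) (simp add: mult_ac)
      finally show ?thesis
        by (metis (no_types, lifting) Bochner_Integration.integral_nonneg zero_le_power2)
    qed
    then show ?thesis
      using hb by (subst nn_integral_eq_integral) (auto simp: has_bochner_integral_iff)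
  qed
  ultimately show ?thesis
    using 1 by simp
qed

lemma ennreal_norm_add_square:
  fixes x y :: "'b::real_normed_vector"
  shows "ennreal ((norm (x + y))\<^sup>2) \<le> 2 * ennreal ((norm x)\<^sup>2) + 2 * ennreal ((norm y)\<^sup>2)"
proof -
  have "(norm (x + y))\<^sup>2 \<le> (norm x + norm y)\<^sup>2"
    by (intro power_mono norm_triangle_ineq) simp
  also have "\<dots> \<le> 2 * (norm x)\<^sup>2 + 2 * (norm y)\<^sup>2"
    using zero_le_power2[of "norm x - norm y"] by (simp add: power2_eq_square algebra_simps)
  finally have "ennreal ((norm (x + y))\<^sup>2) \<le> ennreal (2 * (norm x)\<^sup>2 + 2 * (norm y)\<^sup>2)"
    by (rule ennreal_leI)
  then show ?thesis
    by (simp add: ennreal_mult)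
qed

lemma nn_integral_add_square:
  fixes f g :: "'b \<Rightarrow> 'c::{real_normed_vector, second_countable_topology}"
  assumes [measurable]: "f \<in> borel_measurable N" "g \<in> borel_measurable N"
  shows "(\<integral>\<^sup>+x. ennreal ((norm (f x + g x))\<^sup>2) \<partial>N)
    \<le> 2 * (\<integral>\<^sup>+x. ennreal ((norm (f x))\<^sup>2) \<partial>N) + 2 * (\<integral>\<^sup>+x. ennreal ((norm (g x))\<^sup>2) \<partial>N)"
proof -
  have "(\<integral>\<^sup>+x. ennreal ((norm (f x + g x))\<^sup>2) \<partial>N)
      \<le> (\<integral>\<^sup>+x. 2 * ennreal ((norm (f x))\<^sup>2) + 2 * ennreal ((norm (g x))\<^sup>2) \<partial>N)"
    by (intro nn_integral_mono ennreal_norm_add_square)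
  also have "\<dots> = 2 * (\<integral>\<^sup>+x. ennreal ((norm (f x))\<^sup>2) \<partial>N) + 2 * (\<integral>\<^sup>+x. ennreal ((norm (g x))\<^sup>2) \<partial>N)"
    by (simp add: nn_integral_add nn_integral_cmult)
  finally show ?thesis .
qed

lemma msq_add:
  "f \<in> borel_measurable M \<Longrightarrow> g \<in> borel_measurable M \<Longrightarrow> msq (\<lambda>\<omega>. f \<omega> + g \<omega>) \<le> 2 * msq f + 2 * msq g"
  unfolding msq_def by (rule nn_integral_add_square)

text \<open>
  The distance, squared, in which the simple processes converge to the integrand of an Ito integral.
\<close>

definition dmsq :: "real \<Rightarrow> (real \<Rightarrow> 'a \<Rightarrow> 'n cmat) \<Rightarrow> ennreal" where
  "dmsq t G = (\<integral>\<^sup>+\<omega>. (\<integral>\<^sup>+r\<in>{0..t}. ennreal ((norm (G r \<omega>))\<^sup>2) \<partial>lborel) \<partial>M)"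

definition jointly_measurable :: "real \<Rightarrow> (real \<Rightarrow> 'a \<Rightarrow> 'n cmat) \<Rightarrow> bool" where
  "jointly_measurable t G \<longleftrightarrow> (\<lambda>(s, \<omega>). G s \<omega>) \<in> borel_measurable (restrict_space borel {0..t} \<Otimes>\<^sub>M M)"

text \<open>
  Joint measurability is given on \<open>[0, t]\<close> only. Clamping the time to this interval
  produces a process that is measurable on the whole product space and to which Tonelli's theorem
  applies.
\<close>

lemma jointly_measurable_extend:
  assumes G: "jointly_measurable t G" and t: "0 \<le> t"
  shows "(\<lambda>(\<omega>, s). G (max 0 (min t s)) \<omega>) \<in> borel_measurable (M \<Otimes>\<^sub>M lborel)"
proof -
  have "(\<lambda>s. max 0 (min t s)) \<in> measurable lborel (restrict_space borel {0..t})"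
    using t by (intro measurable_restrict_space2) auto
  then have "(\<lambda>(\<omega>, s). (max 0 (min t s), \<omega>)) \<in> measurable (M \<Otimes>\<^sub>M lborel) (restrict_space borel {0..t} \<Otimes>\<^sub>M M)"
    unfolding case_prod_unfold by (intro measurable_Pair measurable_compose[OF measurable_snd] measurable_fst)
  from measurable_compose[OF this G[unfolded jointly_measurable_def]] show ?thesis
    by (simp add: case_prod_unfold)
qed

lemma dmsq_extend:
  "dmsq t G = (\<integral>\<^sup>+\<omega>. (\<integral>\<^sup>+r\<in>{0..t}. ennreal ((norm (G (max 0 (min t r)) \<omega>))\<^sup>2) \<partial>lborel) \<partial>M)"
  unfolding dmsq_def by (intro nn_integral_cong) (auto split: split_indicator)

lemma dmsq_pair:
  assumes G: "jointly_measurable t G" and t: "0 \<le> t"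
  shows "dmsq t G
      = (\<integral>\<^sup>+p. ennreal ((norm (indicator {0..t} (snd p) *\<^sub>R G (max 0 (min t (snd p))) (fst p)))\<^sup>2)
          \<partial>(M \<Otimes>\<^sub>M lborel))"
proof -
  note [measurable] = jointly_measurable_extend[OF G t, unfolded case_prod_unfold]
  have "(\<integral>\<^sup>+p. ennreal ((norm (indicator {0..t} (snd p) *\<^sub>R G (max 0 (min t (snd p))) (fst p)))\<^sup>2)
      \<partial>(M \<Otimes>\<^sub>M lborel))
      = (\<integral>\<^sup>+\<omega>. \<integral>\<^sup>+r. ennreal ((norm (indicator {0..t} r *\<^sub>R G (max 0 (min t r)) \<omega>))\<^sup>2) \<partial>lborel \<partial>M)"
    by (subst lborel.nn_integral_fst[symmetric]) simp_all
  also have "\<dots> = dmsq t G"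
    unfolding dmsq_extend by (intro nn_integral_cong) (auto split: split_indicator)
  finally show ?thesis ..
qed

lemma dmsq_add:
  assumes G: "jointly_measurable t G" and H: "jointly_measurable t H" and t: "0 \<le> t"
  shows "dmsq t (\<lambda>r \<omega>. G r \<omega> + H r \<omega>) \<le> 2 * dmsq t G + 2 * dmsq t H"
proof -
  note [measurable] = jointly_measurable_extend[OF G t, unfolded case_prod_unfold]
    jointly_measurable_extend[OF H t, unfolded case_prod_unfold]
  have GH: "jointly_measurable t (\<lambda>r \<omega>. G r \<omega> + H r \<omega>)"
    using G H unfolding jointly_measurable_def case_prod_unfold by simp
  show ?thesis
    unfolding dmsq_pair[OF GH t] dmsq_pair[OF G t] dmsq_pair[OF H t] scaleR_right_distrib
    by (rule nn_integral_add_square) measurable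
qed

lemma jointly_measurable_minus: "jointly_measurable t G \<Longrightarrow> jointly_measurable t (\<lambda>r \<omega>. - G r \<omega>)"
  unfolding jointly_measurable_def case_prod_unfold by simp

lemma dmsq_minus: "dmsq t (\<lambda>r \<omega>. G r \<omega> - H r \<omega>) = dmsq t (\<lambda>r \<omega>. H r \<omega> - G r \<omega>)"
  unfolding dmsq_def by (simp add: norm_minus_commute)

lemma msq_minus: "msq (\<lambda>\<omega>. f \<omega> - g \<omega>) = msq (\<lambda>\<omega>. g \<omega> - f \<omega>)"
  unfolding msq_def by (simp add: norm_minus_commute)

lemma step_process_jointly_measurable:
  assumes "\<And>i. i \<in> I \<Longrightarrow> Z i \<in> borel_measurable M"
  shows "jointly_measurable t (step_process I a b Z)"
proof -
  have ind: "(indicator {a i<..b i} :: real \<Rightarrow> real) \<in> borel_measurable (restrict_space borel {0..t})" for i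
    by (intro measurable_restrict_space1) simp
  have "(\<lambda>p. indicator {a i<..b i} (fst p) *\<^sub>R Z i (snd p)) \<in> borel_measurable
      (restrict_space borel {0..t} \<Otimes>\<^sub>M M)"
    if "i \<in> I" for i
    by (intro borel_measurable_scaleR measurable_compose[OF measurable_fst ind] measurable_compose[OF
        measurable_snd assms] that)
  then show ?thesis
    unfolding jointly_measurable_def case_prod_unfold step_process_def by (intro borel_measurable_sum) auto
qed

lemma dmsq_step_process:
  assumes "\<And>i. i \<in> I \<Longrightarrow> 0 \<le> a i \<and> b i \<le> t"
  shows "(\<integral>\<^sup>+\<omega>. (\<integral>\<^sup>+r. ennreal ((norm (step_process I a b Z r \<omega>))\<^sup>2) \<partial>lborel) \<partial>M)
      = dmsq t (step_process I a b Z)"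
proof -
  have "step_process I a b Z r \<omega> = 0" if "r \<notin> {0..t}" for r \<omega>
    unfolding step_process_def using assms that by (intro sum.neutral) (force split: split_indicator)
  then show ?thesis
    unfolding dmsq_def by (intro nn_integral_cong) (auto split: split_indicator)
qed

lemma step_integral_measurable:
  assumes "\<And>i. i \<in> I \<Longrightarrow> 0 \<le> a i \<and> a i \<le> b i" "\<And>i. i \<in> I \<Longrightarrow> bounded_adapted (a i) (Z i)"
  shows "step_integral I a b Z \<in> borel_measurable M"
  unfolding step_integral_def
  using assms by (intro borel_measurable_sum borel_measurable_matmul bounded_adapted_measurable dX_measurable)
    (auto intro: order_trans)

text \<open>
  The isometry extended to a difference of an Ito integral and a step integral, with a constant in
  place of equality: the integral is a limit of simple integrals, for which the isometry applies to
  the difference from the given step process.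
\<close>

lemma ito_comparison:
  assumes ito: "has_ito_integral M F X H t J" and t: "0 \<le> t"
    and I: "finite (I :: nat set)" and ab: "\<And>i. i \<in> I \<Longrightarrow> 0 \<le> a i \<and> a i \<le> b i \<and> b i \<le> t"
    and Z: "\<And>i. i \<in> I \<Longrightarrow> bounded_adapted (a i) (Z i)"
  shows "msq (\<lambda>\<omega>. J \<omega> - step_integral I a b Z \<omega>) \<le> 4 * dmsq t (\<lambda>r \<omega>. H r \<omega> - step_process I a b Z r \<omega>)"
proof -
  have H: "jointly_measurable t H" and [measurable]: "J \<in> borel_measurable M"
    using ito by (auto simp: has_ito_integral_def jointly_measurable_def)
  obtain m \<tau> Y where simple: "\<And>k. is_simple_process F t (m k) (\<tau> k) (Y k)"
    and lim1: "(\<lambda>k. dmsq t (\<lambda>s \<omega>. simple_process (m k) (\<tau> k) (Y k) s \<omega> - H s \<omega>)) \<longlonglongrightarrow> 0"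
    and lim2: "(\<lambda>k. msq (\<lambda>\<omega>. simple_integral X (m k) (\<tau> k) (Y k) \<omega> - J \<omega>)) \<longlonglongrightarrow> 0"
    using ito unfolding has_ito_integral_def dmsq_def msq_def by blast
  let ?S = "step_integral I a b Z" and ?V = "step_process I a b Z"
  have Vm: "jointly_measurable t ?V"
    by (rule step_process_jointly_measurable) (use Z bounded_adapted_measurable in blast)
  have S[measurable]: "?S \<in> borel_measurable M"
    by (rule step_integral_measurable) (use ab Z in auto)
  have bound: "msq (\<lambda>\<omega>. J \<omega> - ?S \<omega>)
      \<le> 2 * msq (\<lambda>\<omega>. simple_integral X (m k) (\<tau> k) (Y k) \<omega> - J \<omega>)
        + 2 * (2 * dmsq t (\<lambda>s \<omega>. simple_process (m k) (\<tau> k) (Y k) s \<omega> - H s \<omega>) + 2 * dmsq t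
            (\<lambda>r \<omega>. H r \<omega> - ?V r \<omega>))" for k
  proof -
    let ?K = "{..<m k}" and ?b = "\<lambda>i. \<tau> k (Suc i)"
    have mono: "strict_mono_on {..m k} (\<tau> k)" and ends: "\<tau> k 0 = 0" "\<tau> k (m k) = t"
      using simple[of k] by (auto simp: is_simple_process_def)
    have \<tau>: "0 \<le> \<tau> k i \<and> \<tau> k i \<le> ?b i \<and> ?b i \<le> t" if "i \<in> ?K" for i
      using that strict_mono_onD[OF mono, of 0 i] strict_mono_onD[OF mono, of i
          "Suc i"] strict_mono_onD[OF mono, of "Suc i" "m k"] ends
      by (cases "i = 0"; cases "Suc i = m k") auto
    have Y: "bounded_adapted (\<tau> k i) (Y k i)" if "i \<in> ?K" for i
      using simple[of k] that by (auto simp: is_simple_process_def bounded_adapted_def)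
    have sp: "simple_process (m k) (\<tau> k) (Y k) = step_process ?K (\<tau> k) ?b (Y k)"
      unfolding simple_process_def[abs_def] step_process_def[abs_def] ..
    have si: "simple_integral X (m k) (\<tau> k) (Y k) = step_integral ?K (\<tau> k) ?b (Y k)"
      unfolding simple_integral_def[abs_def] step_integral_def[abs_def] dX_def ..
    let ?SK = "step_integral ?K (\<tau> k) ?b (Y k)" and ?VK = "step_process ?K (\<tau> k) ?b (Y k)"
    have VKm: "jointly_measurable t ?VK"
      by (rule step_process_jointly_measurable) (use Y bounded_adapted_measurable in blast)
    have SK[measurable]: "?SK \<in> borel_measurable M"
      by (rule step_integral_measurable) (use \<tau> Y in auto)
    \<comment> \<open>The difference of the two step processes as a single one, indexed by the disjoint union.\<close>
    let ?I = "?K <+> I" and ?A = "case_sum (\<tau> k) a" and ?B = "case_sum ?b b"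
      and ?Z = "case_sum (Y k) (\<lambda>i \<omega>. - Z i \<omega>)"
    have "step_integral ?I ?A ?B ?Z \<omega> = ?SK \<omega> - ?S \<omega>" for \<omega>
      unfolding step_integral_def using I by (subst sum.Plus) (simp_all add: matmul.minus_left sum_negf)
    then have comb1: "step_integral ?I ?A ?B ?Z = (\<lambda>\<omega>. ?SK \<omega> - ?S \<omega>)" by auto
    have "step_process ?I ?A ?B ?Z r \<omega> = ?VK r \<omega> - ?V r \<omega>" for r \<omega>
      unfolding step_process_def using I by (subst sum.Plus) (simp_all add: sum_negf)
    then have comb2: "step_process ?I ?A ?B ?Z = (\<lambda>r \<omega>. ?VK r \<omega> - ?V r \<omega>)" by auto
    have "msq (\<lambda>\<omega>. ?SK \<omega> - ?S \<omega>) = dmsq t (\<lambda>r \<omega>. ?VK r \<omega> - ?V r \<omega>)"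
    proof -
      have "msq (step_integral ?I ?A ?B ?Z)
          = (\<integral>\<^sup>+\<omega>. (\<integral>\<^sup>+r. ennreal ((norm (step_process ?I ?A ?B ?Z r \<omega>))\<^sup>2) \<partial>lborel) \<partial>M)"
        by (rule ito_isometry) (use I \<tau> ab Y Z in \<open>auto intro!: bounded_adapted_minus\<close>)
      also have "\<dots> = dmsq t (step_process ?I ?A ?B ?Z)"
        by (rule dmsq_step_process) (use \<tau> ab in auto)
      finally show ?thesis unfolding comb1 comb2 .
    qed
    also have "\<dots> = dmsq t (\<lambda>r \<omega>. (?VK r \<omega> - H r \<omega>) + (H r \<omega> - ?V r \<omega>))"
      by simp
    also have "\<dots> \<le> 2 * dmsq t (\<lambda>r \<omega>. ?VK r \<omega> - H r \<omega>) + 2 * dmsq t (\<lambda>r \<omega>. H r \<omega> - ?V r \<omega>)"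
      by (rule dmsq_add) (use VKm H Vm t in \<open>auto simp: jointly_measurable_def case_prod_unfold\<close>)
    finally have 1: "msq (\<lambda>\<omega>. ?SK \<omega> - ?S \<omega>)
      \<le> 2 * dmsq t (\<lambda>r \<omega>. ?VK r \<omega> - H r \<omega>) + 2 * dmsq t (\<lambda>r \<omega>. H r \<omega> - ?V r \<omega>)" .
    have "msq (\<lambda>\<omega>. J \<omega> - ?S \<omega>) = msq (\<lambda>\<omega>. (J \<omega> - ?SK \<omega>) + (?SK \<omega> - ?S \<omega>))"
      by simp
    also have "\<dots> \<le> 2 * msq (\<lambda>\<omega>. J \<omega> - ?SK \<omega>) + 2 * msq (\<lambda>\<omega>. ?SK \<omega> - ?S \<omega>)"
      by (rule msq_add) measurable
    also have "\<dots> \<le> 2 * msq (\<lambda>\<omega>. J \<omega> - ?SK \<omega>) + 2 * (2 * dmsq t (\<lambda>r \<omega>. ?VK r \<omega> - H r \<omega>) + 2 * dmsq t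
        (\<lambda>r \<omega>. H r \<omega> - ?V r \<omega>))"
      by (intro add_left_mono mult_left_mono 1) simp
    finally show ?thesis
      unfolding sp si msq_minus[of J] .
  qed
  have "(\<lambda>k. 2 * msq (\<lambda>\<omega>. simple_integral X (m k) (\<tau> k) (Y k) \<omega> - J \<omega>)
        + 2 * (2 * dmsq t (\<lambda>s \<omega>. simple_process (m k) (\<tau> k) (Y k) s \<omega> - H s \<omega>) + 2 * dmsq t
            (\<lambda>r \<omega>. H r \<omega> - ?V r \<omega>)))
     \<longlonglongrightarrow> 2 * 0 + 2 * (2 * 0 + 2 * dmsq t (\<lambda>r \<omega>. H r \<omega> - ?V r \<omega>))"
    by (intro tendsto_add ennreal_tendsto_cmult lim1 lim2 tendsto_const) auto
  then have "msq (\<lambda>\<omega>. J \<omega> - ?S \<omega>) \<le> 2 * 0 + 2 * (2 * 0 + 2 * dmsq t (\<lambda>r \<omega>. H r \<omega> - ?V r \<omega>))"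
    by (rule LIMSEQ_le_const) (use bound in blast)
  then show ?thesis
    by (simp add: mult.assoc[symmetric])
qed

end

section \<open>Two integral inequalities\<close>

text \<open>
  Gronwall's inequality without iteration: for the weight \<open>w s = exp (- 2 K s)\<close> the
  supremum of \<open>w \<phi>\<close> is finite and at most half of itself plus
  \<open>\<epsilon>\<close>.
\<close>

lemma integral_gronwall:
  fixes \<phi> :: "real \<Rightarrow> ennreal"
  assumes le: "\<And>s. s \<in> {0..T} \<Longrightarrow> \<phi> s \<le> ennreal K * (\<integral>\<^sup>+r\<in>{0..s}. \<phi> r \<partial>lborel) + ennreal \<epsilon>"
    and fin: "(\<integral>\<^sup>+r\<in>{0..T}. \<phi> r \<partial>lborel) < \<infinity>" and K: "K > 0" and \<epsilon>: "\<epsilon> \<ge> 0" and s: "s \<in> {0..T}"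
  shows "\<phi> s \<le> ennreal (2 * \<epsilon> * exp (2 * K * T))"
proof -
  define w where "w s = exp (- (2 * K * s))" for s
  define \<Phi> where "\<Phi> = (SUP s\<in>{0..T}. \<phi> s * ennreal (w s))"
  have w: "0 < w s" "0 \<le> s \<Longrightarrow> w s \<le> 1" for s
    using K by (auto simp: w_def)
  have "\<Phi> \<le> ennreal K * (\<integral>\<^sup>+r\<in>{0..T}. \<phi> r \<partial>lborel) + ennreal \<epsilon>"
    unfolding \<Phi>_def
  proof (rule SUP_least)
    fix s assume s: "s \<in> {0..T}"
    have "\<phi> s * ennreal (w s) \<le> \<phi> s * 1"
      using w(2)[of s] s by (intro mult_left_mono) auto
    also have "\<dots> \<le> ennreal K * (\<integral>\<^sup>+r\<in>{0..s}. \<phi> r \<partial>lborel) + ennreal \<epsilon>"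
      using le[OF s] by simp
    also have "\<dots> \<le> ennreal K * (\<integral>\<^sup>+r\<in>{0..T}. \<phi> r \<partial>lborel) + ennreal \<epsilon>"
      using s by (intro add_right_mono mult_left_mono nn_integral_mono) (auto split: split_indicator)
    finally show "\<phi> s * ennreal (w s) \<le> \<dots>" .
  qed
  also have "\<dots> < \<infinity>"
    using fin by (simp add: ennreal_mult_less_top)
  finally obtain p where p: "\<Phi> = ennreal p" "p \<ge> 0"
    by (cases \<Phi>) auto
  have \<phi>p: "\<phi> r \<le> ennreal (p * exp (2 * K * r))" if "r \<in> {0..T}" for r
  proof -
    have "\<phi> r = \<phi> r * ennreal (w r) * ennreal (exp (2 * K * r))"
      by (simp add: w_def mult.assoc ennreal_mult[symmetric] exp_minus)
    also have "\<dots> \<le> \<Phi> * ennreal (exp (2 * K * r))"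
      unfolding \<Phi>_def using that by (intro mult_right_mono SUP_upper) auto
    finally show ?thesis
      using p by (simp add: ennreal_mult)
  qed
  have "\<phi> s * ennreal (w s) \<le> ennreal (p / 2 + \<epsilon>)" if s: "s \<in> {0..T}" for s
  proof -
    have "(\<integral>\<^sup>+r\<in>{0..s}. \<phi> r \<partial>lborel) \<le> (\<integral>\<^sup>+r\<in>{0..s}. ennreal (p * exp (2 * K * r)) \<partial>lborel)"
      using s by (intro nn_integral_mono) (auto split: split_indicator intro: \<phi>p)
    also have "\<dots> = ennreal (p * exp (2 * K * s) / (2 * K) - p * exp (2 * K * 0) / (2 * K))"
      using s K p by (intro nn_integral_FTC_Icc) (auto intro!: derivative_eq_intros)
    also have "\<dots> \<le> ennreal (p * exp (2 * K * s) / (2 * K))"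
      using p K by (intro ennreal_leI) simp
    finally have "\<phi> s \<le> ennreal K * ennreal (p * exp (2 * K * s) / (2 * K)) + ennreal \<epsilon>"
      using le[OF s] by (meson add_right_mono mult_left_mono order_trans zero_le)
    also have "\<dots> = ennreal (p * exp (2 * K * s) / 2 + \<epsilon>)"
      using p K \<epsilon> by (simp add: ennreal_mult[symmetric] ennreal_plus[symmetric] del: ennreal_plus)
    finally have "\<phi> s * ennreal (w s) \<le> ennreal (p * exp (2 * K * s) / 2 + \<epsilon>) * ennreal (w s)"
      by (rule mult_right_mono) simp
    also have "\<dots> = ennreal ((p * exp (2 * K * s) / 2 + \<epsilon>) * w s)"
      using p \<epsilon> w by (simp add: ennreal_mult less_imp_le)
    also have "(p * exp (2 * K * s) / 2 + \<epsilon>) * w s = p / 2 + \<epsilon> * w s"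
      by (simp add: w_def exp_minus field_simps)
    also have "ennreal \<dots> \<le> ennreal (p / 2 + \<epsilon>)"
      using w[of s] s \<epsilon> by (intro ennreal_leI add_left_mono mult_left_le) auto
    finally show ?thesis .
  qed
  then have "\<Phi> \<le> ennreal (p / 2 + \<epsilon>)"
    unfolding \<Phi>_def by (rule SUP_least)
  then have "p \<le> p / 2 + \<epsilon>"
    using p \<epsilon> by (simp add: ennreal_le_iff del: ennreal_plus)
  then have "p * exp (2 * K * s) \<le> 2 * \<epsilon> * exp (2 * K * T)"
    using s K p \<epsilon> by (intro mult_mono) auto
  then show ?thesis
    using \<phi>p[OF s] by (meson ennreal_leI order_trans)
qed

text \<open>
  Cauchy-Schwarz for a vector-valued integral over \<open>[0, s]\<close>. The right-hand side is an
  integral with values in \<open>[0, \<infinity>]\<close>, as in the mean squares that it will be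
  compared with.
\<close>

lemma norm_integral_square_le:
  fixes f :: "real \<Rightarrow> 'b::{banach, second_countable_topology}"
  assumes f: "set_integrable lborel {0..s} f" and s: "0 \<le> s"
  shows "ennreal ((norm (LINT r:{0..s}|lborel. f r))\<^sup>2)
      \<le> ennreal s * (\<integral>\<^sup>+r\<in>{0..s}. ennreal ((norm (f r))\<^sup>2) \<partial>lborel)"
proof -
  let ?D = "\<integral>\<^sup>+r\<in>{0..s}. ennreal ((norm (f r))\<^sup>2) \<partial>lborel"
  define c where "c = norm (LINT r:{0..s}|lborel. f r)"
  define g where "g r = indicator {0..s} r *\<^sub>R f r" for r
  have [measurable]: "g \<in> borel_measurable lborel"
    using f unfolding set_integrable_def g_def[abs_def] by (rule borel_measurable_integrable)
  show ?thesis
  proof (cases "c = 0 \<or> s = 0")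
    case True
    moreover have "c = 0" if "s = 0"
    proof -
      have "AE r in lborel. g r = 0"
        using AE_lborel_singleton[of 0]
        by (rule AE_mp) (use that in \<open>auto simp: g_def split: split_indicator\<close>)
      then show ?thesis
        unfolding c_def set_lebesgue_integral_def g_def[symmetric] by (subst integral_eq_zero_AE) auto
    qed
    ultimately have "c = 0" by auto
    then show ?thesis unfolding c_def[symmetric] by simp
  next
    case False
    then have c: "c > 0" "s > 0" using s by (auto simp: c_def)
    have D: "?D = (\<integral>\<^sup>+r. ennreal ((norm (g r))\<^sup>2) \<partial>lborel)"
      by (intro nn_integral_cong) (auto simp: g_def split: split_indicator)
    \<comment> \<open>Weighted so that the constant term integrates to half of the left-hand side.\<close>
    have amgm: "x \<le> c / (2 * s) + s / (2 * c) * x\<^sup>2" for x :: real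
    proof -
      have "0 \<le> (s * x - c)\<^sup>2" by simp
      then have "2 * (s * x) * c \<le> c * c + s * s * (x * x)"
        by (simp add: power2_eq_square algebra_simps)
      then show ?thesis
        using c by (simp add: field_simps power2_eq_square)
    qed
    have "ennreal c \<le> (\<integral>\<^sup>+r. ennreal (norm (g r)) \<partial>lborel)"
      unfolding c_def set_lebesgue_integral_def g_def
      using f unfolding set_integrable_def by (rule integral_norm_bound_ennreal)
    also have "\<dots> \<le> (\<integral>\<^sup>+r. ennreal (c / (2 * s)) * indicator {0..s} r
        + ennreal (s / (2 * c)) * ennreal ((norm (g r))\<^sup>2) \<partial>lborel)"
    proof (rule nn_integral_mono)
      fix r
      have "ennreal (norm (f r)) \<le> ennreal (c / (2 * s) + s / (2 * c) * (norm (f r))\<^sup>2)"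
        by (intro ennreal_leI amgm)
      then show "ennreal (norm (g r)) \<le> ennreal (c / (2 * s)) * indicator {0..s} r
        + ennreal (s / (2 * c)) * ennreal ((norm (g r))\<^sup>2)"
        using c by (auto split: split_indicator simp: g_def ennreal_mult[symmetric]
            ennreal_plus[symmetric] simp del: ennreal_plus)
    qed
    also have "\<dots> = ennreal (c / (2 * s)) * ennreal s + ennreal (s / (2 * c)) * ?D"
      unfolding D using s by (subst nn_integral_add) (auto simp: nn_integral_cmult)
    also have "ennreal (c / (2 * s)) * ennreal s = ennreal (c / 2)"
      using c by (simp add: ennreal_mult[symmetric])
    finally have "ennreal (c / 2) + ennreal (c / 2) \<le> ennreal (c / 2) + ennreal (s / (2 * c)) * ?D"
      using c by (simp add: ennreal_plus[symmetric] del: ennreal_plus)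
    then have "ennreal (c / 2) \<le> ennreal (s / (2 * c)) * ?D"
      by (simp add: ennreal_add_left_cancel_le)
    then have "ennreal (2 * c) * ennreal (c / 2) \<le> ennreal (2 * c) * (ennreal (s / (2 * c)) * ?D)"
      by (rule mult_left_mono) simp
    also have "\<dots> = ennreal s * ?D"
      using c by (simp add: mult.assoc[symmetric] ennreal_mult[symmetric])
    also have "ennreal (2 * c) * ennreal (c / 2) = ennreal (c\<^sup>2)"
      using c by (simp add: ennreal_mult[symmetric] power2_eq_square)
    finally show ?thesis
      unfolding c_def .
  qed
qed

section \<open>The Cayley random walk\<close>

context brownian_family
begin

lemma msq_le:
  assumes "\<And>\<omega>. \<omega> \<in> space M \<Longrightarrow> (norm (f \<omega>))\<^sup>2 \<le> g \<omega>" "integrable M g" "(\<integral>\<omega>. g \<omega> \<partial>M) \<le> c"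
  shows "msq f \<le> ennreal c"
proof -
  have "0 \<le> g \<omega>" if "\<omega> \<in> space M" for \<omega>
    using assms(1)[OF that] zero_le_power2[of "norm (f \<omega>)"] by linarith
  then have "(\<integral>\<^sup>+\<omega>. ennreal (g \<omega>) \<partial>M) = ennreal (\<integral>\<omega>. g \<omega> \<partial>M)"
    using assms(2) by (intro nn_integral_eq_integral) auto
  moreover have "msq f \<le> (\<integral>\<^sup>+\<omega>. ennreal (g \<omega>) \<partial>M)"
    unfolding msq_def using assms(1) by (intro nn_integral_mono ennreal_leI)
  ultimately show ?thesis
    using assms(3) by (metis ennreal_leI order_trans)
qed

lemma dmsq_bounded:
  assumes "\<And>r \<omega>. r \<in> {0..t} \<Longrightarrow> \<omega> \<in> space M \<Longrightarrow> norm (G r \<omega>) \<le> c" "0 \<le> t"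
  shows "dmsq t G \<le> ennreal (c\<^sup>2 * t)"
proof -
  have "dmsq t G \<le> (\<integral>\<^sup>+\<omega>. (\<integral>\<^sup>+r\<in>{0..t}. ennreal (c\<^sup>2) \<partial>lborel) \<partial>M)"
    unfolding dmsq_def
    using assms by (intro nn_integral_mono) (auto split: split_indicator intro!: ennreal_leI power_mono)
  also have "\<dots> = ennreal (c\<^sup>2 * t)"
    using assms(2) by (simp add: nn_integral_cmult_indicator emeasure_space_1 ennreal_mult)
  finally show ?thesis .
qed

lemma dmsq_tonelli:
  assumes G: "jointly_measurable t G" and t: "0 \<le> t"
  shows "dmsq t G = (\<integral>\<^sup>+r\<in>{0..t}. msq (G r) \<partial>lborel)"
proof -
  interpret pair_sigma_finite M lborel ..
  note [measurable] = jointly_measurable_extend[OF G t, unfolded case_prod_unfold]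
  have "dmsq t G = (\<integral>\<^sup>+r. \<integral>\<^sup>+\<omega>. ennreal ((norm (indicator {0..t} r *\<^sub>R G (max 0 (min t r)) \<omega>))\<^sup>2) \<partial>M \<partial>lborel)"
    unfolding dmsq_pair[OF G t] by (subst nn_integral_snd[symmetric]) simp_all
  also have "\<dots> = (\<integral>\<^sup>+r\<in>{0..t}. msq (G r) \<partial>lborel)"
    unfolding msq_def by (intro nn_integral_cong) (auto split: split_indicator)
  finally show ?thesis .
qed

text \<open>
  The random walk that approximates the unitary Brownian motion at the times \<open>k
  \<delta>\<close>.
\<close>

primrec scheme :: "real \<Rightarrow> nat \<Rightarrow> 'a \<Rightarrow> 'n cmat" where
  "scheme \<delta> 0 \<omega> = mat 1"
| "scheme \<delta> (Suc k) \<omega> = scheme \<delta> k \<omega> ** cayley (dX (real k * \<delta>) (real (Suc k) * \<delta>) \<omega>)"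

lemma scheme_unitary: "unitary (scheme \<delta> k \<omega>)"
  by (induction k) (simp_all add: unitary_one unitary_mult cayley_unitary dX_skew)

lemma scheme_measurable:
  assumes "0 \<le> \<delta>"
  shows "scheme \<delta> k \<in> borel_measurable (F (real k * \<delta>))"
proof (induction k)
  case (Suc k)
  have "(\<lambda>\<omega>. cayley (dX (real k * \<delta>) (real (Suc k) * \<delta>) \<omega>)) \<in> borel_measurable (F (real (Suc k) * \<delta>))"
    using assms by (intro borel_measurable_cayley dX_measurable_F dX_skew mult_right_mono) auto
  moreover have "scheme \<delta> k \<in> borel_measurable (F (real (Suc k) * \<delta>))"
    by (rule measurable_F_mono[OF _ Suc]) (use assms in \<open>auto intro: mult_right_mono\<close>)
  ultimately show ?case by simp
qed simp

lemma scheme_bounded_adapted: "0 \<le> \<delta> \<Longrightarrow> bounded_adapted (real k * \<delta>) (scheme \<delta> k)"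
  unfolding bounded_adapted_def using scheme_measurable norm_unitary_le[OF scheme_unitary] by blast

definition increment :: "real \<Rightarrow> nat \<Rightarrow> 'a \<Rightarrow> 'n cmat" where
  "increment \<delta> k = dX (real k * \<delta>) (real (Suc k) * \<delta>)"

definition remainder :: "real \<Rightarrow> nat \<Rightarrow> 'a \<Rightarrow> 'n cmat" where
  "remainder \<delta> k \<omega> = cayley (increment \<delta> k \<omega>) - mat 1 - increment \<delta> k \<omega>
     - (1/2) *\<^sub>R (increment \<delta> k \<omega> ** increment \<delta> k \<omega>)"

text \<open>
  The walk written like the integrated equation of \<open>U\<close>: a stochastic sum, a drift and
  two error terms. The drift is obtained by adding \<open>\<delta>\<close> to
  \<open>x\<^sup>2\<close>, which centers it.
\<close>

lemma scheme_expand: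
  "scheme \<delta> m \<omega> = mat 1 + (\<Sum>k<m. scheme \<delta> k \<omega> ** increment \<delta> k \<omega>)
     + (1/2) *\<^sub>R (\<Sum>k<m. scheme \<delta> k \<omega> ** (increment \<delta> k \<omega> ** increment \<delta> k \<omega> + \<delta> *\<^sub>R mat 1))
     - (\<delta> / 2) *\<^sub>R (\<Sum>k<m. scheme \<delta> k \<omega>) + (\<Sum>k<m. scheme \<delta> k \<omega> ** remainder \<delta> k \<omega>)"
proof (induction m)
  case (Suc m)
  let ?V = "scheme \<delta> m \<omega>" and ?x = "increment \<delta> m \<omega>"
  have "cayley ?x = mat 1 + ?x + (1/2) *\<^sub>R (?x ** ?x) + remainder \<delta> m \<omega>"
    by (simp add: remainder_def)
  then have step: "scheme \<delta> (Suc m) \<omega> = ?V + (?V ** ?x + (1/2) *\<^sub>R (?V ** (?x ** ?x)) + ?V ** remainder \<delta> m \<omega>)"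
    by (simp add: increment_def matmul_simps)
  have collect: "v + (a + (1/2) *\<^sub>R q + r) = mat 1 + (A + a) + (1/2) *\<^sub>R (Q + (q + \<delta> *\<^sub>R v'))
      - (\<delta>/2) *\<^sub>R (S + v') + (R + r)"
    if "v = mat 1 + A + (1/2) *\<^sub>R Q - (\<delta>/2) *\<^sub>R S + R" for v v' a q r A Q R S :: "'n cmat"
    unfolding that by (simp add: scaleR_right_distrib)
  have "?V ** (?x ** ?x + \<delta> *\<^sub>R mat 1) = ?V ** (?x ** ?x) + \<delta> *\<^sub>R ?V"
    by (simp add: matmul_simps)
  then show ?case
    unfolding step sum.lessThan_Suc by (simp only: collect[OF Suc])
qed simp

lemma increment_measurable: "0 \<le> \<delta> \<Longrightarrow> increment \<delta> k \<in> borel_measurable M"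
  unfolding increment_def by (intro dX_measurable) auto

lemma increment_measurable_F: "0 \<le> \<delta> \<Longrightarrow> k < m \<Longrightarrow> increment \<delta> k \<in> borel_measurable (F (real m * \<delta>))"
  unfolding increment_def by (intro dX_measurable_F mult_right_mono) auto

definition quadratic_sum :: "real \<Rightarrow> nat \<Rightarrow> 'a \<Rightarrow> 'n cmat" where
  "quadratic_sum \<delta> m \<omega> = (\<Sum>k<m. scheme \<delta> k \<omega> ** (increment \<delta> k \<omega> ** increment \<delta> k \<omega> + \<delta> *\<^sub>R mat 1))"

text \<open>
  \<open>x\<^sup>2 + \<delta>\<close> is centered and independent of the past, hence orthogonal to
  all earlier summands.
\<close>

lemma quadratic_sum_orthogonal:
  assumes \<delta>: "0 \<le> \<delta>" and int: "integrable M (quadratic_sum \<delta> m)"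
  shows "has_bochner_integral M (\<lambda>\<omega>. inner (quadratic_sum \<delta> m \<omega>)
    (scheme \<delta> m \<omega> ** (increment \<delta> m \<omega> ** increment \<delta> m \<omega> + \<delta> *\<^sub>R mat 1))) 0"
proof -
  let ?t = "real m * \<delta>"
  let ?P = "\<lambda>\<omega>. cadjoint (scheme \<delta> m \<omega>) ** quadratic_sum \<delta> m \<omega>"
  have meas: "quadratic_sum \<delta> m \<in> borel_measurable (F ?t)"
    unfolding quadratic_sum_def
  proof (intro borel_measurable_sum borel_measurable_matmul borel_measurable_add)
    fix k assume k: "k \<in> {..<m}"
    then have "real k * \<delta> \<le> ?t"
      using \<delta> by (intro mult_right_mono) auto
    from measurable_F_mono[OF this scheme_measurable[OF \<delta>]]
    show "scheme \<delta> k \<in> borel_measurable (F ?t)" .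
    show "increment \<delta> k \<in> borel_measurable (F ?t)"
      using k by (intro increment_measurable_F \<delta>) simp
    then show "increment \<delta> k \<in> borel_measurable (F ?t)" by simp
  qed simp
  have intP: "integrable M ?P"
    by (rule bounded_mult_integrable[OF bounded_adapted_cadjoint[OF scheme_bounded_adapted[OF \<delta>]] int])
  have intPQ: "integrable M (\<lambda>\<omega>. ?P \<omega> $ i $ j * (mat 1 :: 'n cmat) $ k $ l)" for i j k l
    using integrable_bounded_linear[OF bounded_linear_compose[OF bounded_linear_vec_nth
        bounded_linear_vec_nth] intP]
    by (intro integrable_mult_left) simp
  have measP: "?P \<in> borel_measurable (F ?t)"
    using meas scheme_measurable[OF \<delta>, of m] by measurable
  have 1: "trace (mat 1 :: 'n cmat) = of_nat CARD('n)"
    by (simp add: trace_def mat_def)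
  have hb1: "has_bochner_integral M (\<lambda>\<omega>. trace (?P \<omega> ** increment \<delta> m \<omega> ** mat 1 ** increment \<delta> m \<omega>))
    (of_real (real (Suc m) * \<delta> - ?t) * (\<integral>\<omega>. - (trace (?P \<omega>) * trace (mat 1 :: 'n cmat)) / of_nat CARD('n) \<partial>M))"
    unfolding increment_def
    by (rule trace_incr_second) (use \<delta> measP intPQ in \<open>auto intro: mult_right_mono\<close>)
  have hb2: "has_bochner_integral M (\<lambda>\<omega>. of_real \<delta> * trace (?P \<omega>)) (of_real \<delta> * (\<integral>\<omega>. trace (?P \<omega>) \<partial>M))"
    using integrable_bounded_linear[OF bounded_linear_trace intP]
    by (intro has_bochner_integral_mult_right has_bochner_integral_integrable)
  have "real (Suc m) * \<delta> - ?t = \<delta>"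
    by (simp add: algebra_simps)
  then have "of_real (real (Suc m) * \<delta> - ?t) * (\<integral>\<omega>. - (trace (?P \<omega>) * trace (mat 1 :: 'n cmat)) /
      of_nat CARD('n) \<partial>M)
      = - (of_real \<delta> * (\<integral>\<omega>. trace (?P \<omega>) \<partial>M))"
    unfolding 1 by (simp only:) simp
  with has_bochner_integral_add[OF hb1 hb2]
  have "has_bochner_integral M (\<lambda>\<omega>. trace (?P \<omega> ** increment \<delta> m \<omega> ** mat 1 ** increment \<delta> m \<omega>)
      + of_real \<delta> * trace (?P \<omega>)) 0"
    by (simp only: add.left_inverse)
  then have hb: "has_bochner_integral M (\<lambda>\<omega>. Re (trace (?P \<omega> ** increment \<delta> m \<omega> ** mat 1 ** increment \<delta> m \<omega>)
      + of_real \<delta> * trace (?P \<omega>))) (Re 0)"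
    by (rule has_bochner_integral_Re)
  have "Re (trace (?P \<omega> ** increment \<delta> m \<omega> ** mat 1 ** increment \<delta> m \<omega>) + of_real \<delta> * trace (?P \<omega>))
    = inner (quadratic_sum \<delta> m \<omega>) (scheme \<delta> m \<omega> ** (increment \<delta> m \<omega> ** increment \<delta> m \<omega> + \<delta> *\<^sub>R mat 1))" for \<omega>
  proof -
    let ?x = "increment \<delta> m \<omega>" and ?Q = "quadratic_sum \<delta> m \<omega>" and ?V = "scheme \<delta> m \<omega>"
    have "cadjoint (?x ** ?x + \<delta> *\<^sub>R mat 1) = ?x ** ?x + \<delta> *\<^sub>R mat 1"
      using dX_skew[of ?t "real (Suc m) * \<delta>" \<omega>]
      by (simp add: cadjoint_simps cadjoint_mult skew_def increment_def matmul_simps)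
    then have "inner ?Q (?V ** (?x ** ?x + \<delta> *\<^sub>R mat 1))
        = Re (trace (?Q ** (?x ** ?x + \<delta> *\<^sub>R mat 1) ** cadjoint ?V))"
      by (simp add: inner_cmat cadjoint_mult matrix_mul_assoc)
    also have "trace (?Q ** (?x ** ?x + \<delta> *\<^sub>R mat 1) ** cadjoint ?V)
        = trace (cadjoint ?V ** (?Q ** (?x ** ?x + \<delta> *\<^sub>R mat 1)))"
      by (rule trace_mul_sym)
    also have "\<dots> = trace (?P \<omega> ** ?x ** mat 1 ** ?x) + of_real \<delta> * trace (?P \<omega>)"
      by (simp add: matmul_simps trace_simps matrix_mul_assoc scaleR_conv_of_real[symmetric])
    finally show ?thesis by simp
  qed
  then show ?thesis
    using hb by simp
qed

text \<open>
  By orthogonality the mean square of the sum is the sum of \<open>m\<close> terms of order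
  \<open>\<delta>\<^sup>2\<close>.
\<close>

lemma quadratic_sum_bound:
  "\<exists>C\<ge>0. \<forall>\<delta> m. 0 \<le> \<delta> \<longrightarrow> msq (quadratic_sum \<delta> m) \<le> ennreal (C * real m * \<delta>\<^sup>2)"
proof -
  obtain C2 where C2: "C2 \<ge> 0" "\<And>s t. 0 \<le> s \<Longrightarrow> s \<le> t \<Longrightarrow>
    integrable M (\<lambda>\<omega>. norm (dX s t \<omega>) ^ (2 * 2)) \<and> (\<integral>\<omega>. norm (dX s t \<omega>) ^ (2 * 2) \<partial>M) \<le> C2 * (t - s) ^ 2"
    using dX_moment[of 2] by auto
  define N where "N = real CARD('n)"
  define C where "C = 2 * C2 + 2 * N"
  have "integrable M (\<lambda>\<omega>. (norm (quadratic_sum \<delta> m \<omega>))\<^sup>2) \<and> integrable M (quadratic_sum \<delta> m)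
      \<and> (\<integral>\<omega>. (norm (quadratic_sum \<delta> m \<omega>))\<^sup>2 \<partial>M) \<le> C * real m * \<delta>\<^sup>2" if \<delta>: "0 \<le> \<delta>" for \<delta> m
  proof (induction m)
    case 0
    show ?case by (simp add: quadratic_sum_def)
  next
    case (Suc m)
    let ?Q = "quadratic_sum \<delta> m"
    let ?y = "\<lambda>\<omega>. increment \<delta> m \<omega> ** increment \<delta> m \<omega> + \<delta> *\<^sub>R mat 1"
    let ?w = "\<lambda>\<omega>. scheme \<delta> m \<omega> ** ?y \<omega>"
    have step: "quadratic_sum \<delta> (Suc m) \<omega> = ?Q \<omega> + ?w \<omega>" for \<omega>
      by (simp add: quadratic_sum_def)
    have [measurable]: "increment \<delta> m \<in> borel_measurable M" "scheme \<delta> m \<in> borel_measurable M"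
      using increment_measurable[OF \<delta>] measurable_F[OF scheme_measurable[OF \<delta>]] by auto
    have wb: "(norm (?w \<omega>))\<^sup>2 \<le> 2 * norm (increment \<delta> m \<omega>) ^ 4 + 2 * N * \<delta>\<^sup>2" for \<omega>
    proof -
      have "norm (?w \<omega>) = norm (?y \<omega>)"
        by (rule norm_unitary_mult[OF scheme_unitary])
      also have "\<dots> \<le> norm (increment \<delta> m \<omega>) ^ 2 + \<delta> * sqrt N"
        using norm_triangle_ineq[of "increment \<delta> m \<omega> ** increment \<delta> m \<omega>" "\<delta> *\<^sub>R mat 1"]
          norm_matrix_mult_le[of "increment \<delta> m \<omega>" "increment \<delta> m \<omega>"] \<delta> norm_unitary[OF unitary_one,
              where 'n = 'n]
        by (simp add: power2_eq_square N_def)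
      finally have "(norm (?w \<omega>))\<^sup>2 \<le> (norm (increment \<delta> m \<omega>) ^ 2 + \<delta> * sqrt N)\<^sup>2"
        by (intro power_mono) auto
      also have "\<dots> \<le> 2 * (norm (increment \<delta> m \<omega>) ^ 2)\<^sup>2 + 2 * (\<delta> * sqrt N)\<^sup>2"
        using zero_le_power2[of "norm (increment \<delta> m \<omega>) ^ 2 - \<delta> * sqrt N"]
        by (simp add: power2_sum power2_diff)
      finally show ?thesis
        by (simp add: power_mult_distrib N_def mult.commute mult.left_commute flip: power_mult)
    qed
    have mom: "integrable M (\<lambda>\<omega>. norm (increment \<delta> m \<omega>) ^ 4)" "(\<integral>\<omega>. norm (increment \<delta> m \<omega>) ^ 4 \<partial>M) \<le> C2 * \<delta>\<^sup>2"
      using C2(2)[of "real m * \<delta>" "real (Suc m) * \<delta>"] \<delta>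
      by (auto simp: increment_def mult_right_mono algebra_simps)
    have ib: "integrable M (\<lambda>\<omega>. 2 * norm (increment \<delta> m \<omega>) ^ 4 + 2 * N * \<delta>\<^sup>2)"
      using mom by auto
    have iw2: "integrable M (\<lambda>\<omega>. (norm (?w \<omega>))\<^sup>2)"
      by (rule Bochner_Integration.integrable_bound[OF ib]) (auto intro!: AE_I2 order_trans[OF wb])
    have iw: "integrable M ?w"
    proof (rule Bochner_Integration.integrable_bound)
      show "integrable M (\<lambda>\<omega>. 1 + (norm (?w \<omega>))\<^sup>2)"
        using iw2 by simp
      show "AE \<omega> in M. norm (?w \<omega>) \<le> norm (1 + (norm (?w \<omega>))\<^sup>2)"
      proof (rule AE_I2)
        fix \<omega>
        have "0 \<le> (norm (?w \<omega>) - 1)\<^sup>2 + norm (?w \<omega>)" by simp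
        then show "norm (?w \<omega>) \<le> norm (1 + (norm (?w \<omega>))\<^sup>2)"
          by (simp add: power2_diff)
      qed
    qed measurable
    have ew2: "(\<integral>\<omega>. (norm (?w \<omega>))\<^sup>2 \<partial>M) \<le> C * \<delta>\<^sup>2"
    proof -
      have "(\<integral>\<omega>. (norm (?w \<omega>))\<^sup>2 \<partial>M) \<le> (\<integral>\<omega>. 2 * norm (increment \<delta> m \<omega>) ^ 4 + 2 * N * \<delta>\<^sup>2 \<partial>M)"
        by (rule integral_mono[OF iw2 ib wb])
      also have "\<dots> \<le> C * \<delta>\<^sup>2"
        using mom by (simp add: C_def prob_space algebra_simps)
      finally show ?thesis .
    qed
    note IH = Suc
    have cross: "has_bochner_integral M (\<lambda>\<omega>. inner (?Q \<omega>) (?w \<omega>)) 0"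
      by (rule quadratic_sum_orthogonal[OF \<delta>]) (use IH in auto)
    have "has_bochner_integral M (\<lambda>\<omega>. (norm (?Q \<omega>))\<^sup>2 + (norm (?w \<omega>))\<^sup>2 + 2 * inner (?Q \<omega>) (?w \<omega>))
        ((\<integral>\<omega>. (norm (?Q \<omega>))\<^sup>2 \<partial>M) + (\<integral>\<omega>. (norm (?w \<omega>))\<^sup>2 \<partial>M) + 2 * 0)"
      using IH iw2 cross
      by (intro has_bochner_integral_add has_bochner_integral_integrable has_bochner_integral_mult_right) auto
    moreover have "(norm (quadratic_sum \<delta> (Suc m) \<omega>))\<^sup>2 = (norm (?Q \<omega>))\<^sup>2 + (norm (?w \<omega>))\<^sup>2
        + 2 * inner (?Q \<omega>) (?w \<omega>)" for \<omega>
      unfolding step by (simp add: power2_norm_eq_inner inner_add_left inner_add_right inner_commute)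
    ultimately have hb: "has_bochner_integral M (\<lambda>\<omega>. (norm (quadratic_sum \<delta> (Suc m) \<omega>))\<^sup>2)
        ((\<integral>\<omega>. (norm (?Q \<omega>))\<^sup>2 \<partial>M) + (\<integral>\<omega>. (norm (?w \<omega>))\<^sup>2 \<partial>M))"
      by simp
    have "integrable M (quadratic_sum \<delta> (Suc m))"
      unfolding step[abs_def] using IH iw by auto
    moreover have "(\<integral>\<omega>. (norm (?Q \<omega>))\<^sup>2 \<partial>M) + (\<integral>\<omega>. (norm (?w \<omega>))\<^sup>2 \<partial>M) \<le> C * real (Suc m) * \<delta>\<^sup>2"
      using IH ew2 by (simp add: algebra_simps)
    ultimately show ?case
      using hb by (simp add: has_bochner_integral_iff)
  qed
  note main = this
  have "msq (quadratic_sum \<delta> m) \<le> ennreal (C * real m * \<delta>\<^sup>2)" if "0 \<le> \<delta>" for \<delta> m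
    by (rule msq_le[of _ "\<lambda>\<omega>. (norm (quadratic_sum \<delta> m \<omega>))\<^sup>2"]) (use main[OF that] in auto)
  moreover have "C \<ge> 0" using C2(1) by (simp add: C_def N_def)
  ultimately show ?thesis by blast
qed

text \<open>
  Here no cancellation is used: \<open>m\<close> terms of order
  \<open>\<delta>\<^sup>3\<^sup>/\<^sup>2\<close> have a square of order \<open>m\<^sup>2
  \<delta>\<^sup>3\<close>.
\<close>

lemma remainder_sum_bound:
  "\<exists>C\<ge>0. \<forall>\<delta> m. 0 \<le> \<delta> \<longrightarrow> msq (\<lambda>\<omega>. \<Sum>k<m. scheme \<delta> k \<omega> ** remainder \<delta> k \<omega>) \<le> ennreal (C * (real m)\<^sup>2 * \<delta> ^ 3)"
proof -
  obtain C3 where C3: "C3 \<ge> 0" "\<And>s t. 0 \<le> s \<Longrightarrow> s \<le> t \<Longrightarrow>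
    integrable M (\<lambda>\<omega>. norm (dX s t \<omega>) ^ (2 * 3)) \<and> (\<integral>\<omega>. norm (dX s t \<omega>) ^ (2 * 3) \<partial>M) \<le> C3 * (t - s) ^ 3"
    using dX_moment[of 3] by auto
  define N where "N = real CARD('n)"
  have "msq (\<lambda>\<omega>. \<Sum>k<m. scheme \<delta> k \<omega> ** remainder \<delta> k \<omega>) \<le> ennreal (N\<^sup>2 * C3 * (real m)\<^sup>2 * \<delta> ^ 3)"
      if \<delta>: "0 \<le> \<delta>" for \<delta> m
  proof (rule msq_le)
    have mom: "integrable M (\<lambda>\<omega>. norm (increment \<delta> k \<omega>) ^ 6)" "(\<integral>\<omega>. norm (increment \<delta> k \<omega>) ^ 6 \<partial>M)
        \<le> C3 * \<delta> ^ 3" for k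
      using C3(2)[of "real k * \<delta>" "real (Suc k) * \<delta>"] \<delta>
      by (auto simp: increment_def mult_right_mono algebra_simps)
    show "(norm (\<Sum>k<m. scheme \<delta> k \<omega> ** remainder \<delta> k \<omega>))\<^sup>2
        \<le> real m * N\<^sup>2 * (\<Sum>k<m. norm (increment \<delta> k \<omega>) ^ 6)" for \<omega>
    proof -
      have "norm (\<Sum>k<m. scheme \<delta> k \<omega> ** remainder \<delta> k \<omega>) \<le> (\<Sum>k<m. N * norm (increment \<delta> k \<omega>) ^ 3)"
      proof (rule sum_norm_le)
        fix k
        have "norm (scheme \<delta> k \<omega> ** remainder \<delta> k \<omega>) = norm (remainder \<delta> k \<omega>)"
          by (rule norm_unitary_mult[OF scheme_unitary])
        also have "\<dots> \<le> N * norm (increment \<delta> k \<omega>) ^ 3"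
          unfolding remainder_def N_def by (rule norm_cayley_expand3) (simp add: increment_def dX_skew)
        finally show "norm (scheme \<delta> k \<omega> ** remainder \<delta> k \<omega>) \<le> N * norm (increment \<delta> k \<omega>) ^ 3" .
      qed
      then have "(norm (\<Sum>k<m. scheme \<delta> k \<omega> ** remainder \<delta> k \<omega>))\<^sup>2 \<le> (\<Sum>k<m. N * norm (increment \<delta> k \<omega>) ^ 3)\<^sup>2"
        by (intro power_mono) auto
      also have "\<dots> \<le> (\<Sum>k<m. (N * norm (increment \<delta> k \<omega>) ^ 3)\<^sup>2) * card {..<m}"
        by (rule sum_squared_le_sum_of_squares)
      also have "\<dots> = real m * N\<^sup>2 * (\<Sum>k<m. norm (increment \<delta> k \<omega>) ^ 6)"
        by (simp add: power_mult_distrib sum_distrib_left sum_distrib_right mult_ac flip: power_mult)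
      finally show ?thesis .
    qed
    show "integrable M (\<lambda>\<omega>. real m * N\<^sup>2 * (\<Sum>k<m. norm (increment \<delta> k \<omega>) ^ 6))"
      using mom by auto
    have "(\<integral>\<omega>. real m * N\<^sup>2 * (\<Sum>k<m. norm (increment \<delta> k \<omega>) ^ 6) \<partial>M)
        = real m * N\<^sup>2 * (\<Sum>k<m. \<integral>\<omega>. norm (increment \<delta> k \<omega>) ^ 6 \<partial>M)"
      using mom by simp
    also have "\<dots> \<le> real m * N\<^sup>2 * (\<Sum>k<m. C3 * \<delta> ^ 3)"
      using mom by (intro mult_left_mono sum_mono) auto
    also have "\<dots> = N\<^sup>2 * C3 * (real m)\<^sup>2 * \<delta> ^ 3"
      by (simp add: power2_eq_square)
    finally show "(\<integral>\<omega>. real m * N\<^sup>2 * (\<Sum>k<m. norm (increment \<delta> k \<omega>) ^ 6) \<partial>M) \<le> N\<^sup>2 * C3 * (real m)\<^sup>2 * \<delta> ^ 3" .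
  qed
  moreover have "N\<^sup>2 * C3 \<ge> 0" using C3(1) by simp
  ultimately show ?thesis by blast
qed

end

section \<open>Mean square convergence of the walk to the unitary Brownian motion\<close>

lemma nat_floor_cell:
  fixes x :: real
  assumes "0 \<le> x"
  shows "real (nat \<lfloor>x\<rfloor>) \<le> x" "x < real (Suc (nat \<lfloor>x\<rfloor>))"
proof -
  have "real (nat \<lfloor>x\<rfloor>) = of_int \<lfloor>x\<rfloor>"
    using assms by simp
  then show "real (nat \<lfloor>x\<rfloor>) \<le> x" "x < real (Suc (nat \<lfloor>x\<rfloor>))"
    unfolding of_nat_Suc by linarith+
qed

lemma six_squares: "(a + b + c + d + e + f)\<^sup>2 \<le> 6 * (a\<^sup>2 + b\<^sup>2 + c\<^sup>2 + d\<^sup>2 + e\<^sup>2 + f\<^sup>2)" for a b c d e f :: real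
proof -
  define h where "h i = [a, b, c, d, e, f] ! i" for i
  have "(\<Sum>i<6. h i)\<^sup>2 \<le> (\<Sum>i<6. (h i)\<^sup>2) * card {..<6::nat}"
    by (rule sum_squared_le_sum_of_squares)
  then show ?thesis
    by (simp add: h_def eval_nat_numeral add.assoc)
qed

text \<open>
  The drift error: the time integral of a continuous path against that of a step function.
\<close>

lemma step_integral_square_le:
  fixes u :: "real \<Rightarrow> 'b::euclidean_space"
  assumes u: "continuous_on {0..s} u" and s: "0 \<le> s" and I: "finite I"
    and ab: "\<And>i. i \<in> I \<Longrightarrow> 0 \<le> a i \<and> a i \<le> b i \<and> b i \<le> s"
  shows "ennreal ((norm (integral {0..s} u - (\<Sum>i\<in>I. (b i - a i) *\<^sub>R z i)))\<^sup>2)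
    \<le> ennreal s * (\<integral>\<^sup>+r\<in>{0..s}. ennreal ((norm (u r - (\<Sum>i\<in>I. indicator {a i<..b i} r *\<^sub>R z i)))\<^sup>2) \<partial>lborel)"
proof -
  let ?st = "\<lambda>r. \<Sum>i\<in>I. indicator {a i<..b i} r *\<^sub>R z i"
  have hb: "has_bochner_integral lborel ?st (\<Sum>i\<in>I. (b i - a i) *\<^sub>R z i)"
  proof (intro has_bochner_integral_sum has_bochner_integral_scaleR_left)
    fix i assume "i \<in> I"
    then have "has_bochner_integral lborel (indicator {a i<..b i} :: real \<Rightarrow> real) (measure lborel {a i<..b i})"
      using ab by (intro has_bochner_integral_real_indicator) auto
    then show "has_bochner_integral lborel (indicator {a i<..b i} :: real \<Rightarrow> real) (b i - a i)"
      using ab[OF \<open>i \<in> I\<close>] by simp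
  qed
  have st_out: "indicator {0..s} r *\<^sub>R ?st r = ?st r" for r
  proof (cases "r \<in> {0..s}")
    case False
    then have "?st r = 0"
      using ab by (intro sum.neutral) (force split: split_indicator)
    then show ?thesis by simp
  qed simp
  have u_int: "set_integrable lborel {0..s} u"
    by (rule borel_integrable_atLeastAtMost'[OF u])
  have st_int: "set_integrable lborel {0..s} ?st"
    unfolding set_integrable_def st_out using hb by (rule integrable.intros)
  have "(LINT r:{0..s}|lborel. u r - ?st r) = (LINT r:{0..s}|lborel. u r) - (LINT r:{0..s}|lborel. ?st r)"
    by (rule set_integral_diff(2)[OF u_int st_int])
  also have "(LINT r:{0..s}|lborel. u r) = integral {0..s} u"
    by (rule set_borel_integral_eq_integral(2)[OF u_int])
  also have "(LINT r:{0..s}|lborel. ?st r) = (\<Sum>i\<in>I. (b i - a i) *\<^sub>R z i)"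
    unfolding set_lebesgue_integral_def st_out using hb by (rule has_bochner_integral_integral_eq)
  finally have "integral {0..s} u - (\<Sum>i\<in>I. (b i - a i) *\<^sub>R z i) = (LINT r:{0..s}|lborel. u r - ?st r)" ..
  then show ?thesis
    using norm_integral_square_le[OF set_integral_diff(1)[OF u_int st_int] s] by simp
qed

locale unitary_bm = brownian_family M B for M :: "'a measure"
    and B :: "'n::{finite,linorder} cmat \<Rightarrow> real \<Rightarrow> 'a \<Rightarrow> real" +
  fixes U :: "real \<Rightarrow> 'a \<Rightarrow> 'n cmat"
  assumes ubm: "unitary_brownian_motion M B U"
begin

lemma U_start: "AE \<omega> in M. U 0 \<omega> = mat 1"
  and U_continuous: "AE \<omega> in M. continuous_on {0..} (\<lambda>t. U t \<omega>)"
  and U_measurable_F: "0 \<le> t \<Longrightarrow> U t \<in> borel_measurable (F t)"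
  and U_equation: "0 \<le> t \<Longrightarrow> \<exists>J. has_ito_integral M F X U t J \<and>
        (AE \<omega> in M. U t \<omega> = U 0 \<omega> + J \<omega> - (1/2) *\<^sub>R integral {0..t} (\<lambda>s. U s \<omega>))"
  using ubm unfolding unitary_brownian_motion_def by auto

lemma U_measurable: "0 \<le> t \<Longrightarrow> U t \<in> borel_measurable M"
  using measurable_F[OF U_measurable_F] .

lemma U_jointly_measurable: "0 \<le> t \<Longrightarrow> jointly_measurable t U"
  using U_equation[of t] by (auto simp: has_ito_integral_def jointly_measurable_def)

lemma dmsq_U_finite:
  assumes t: "0 \<le> t"
  shows "dmsq t U < \<infinity>"
proof -
  obtain J where "has_ito_integral M F X U t J"
    using U_equation[OF t] by blast
  then obtain m \<tau> Y where simple: "\<And>k. is_simple_process F t (m k) (\<tau> k) (Y k)"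
    and lim: "(\<lambda>k. dmsq t (\<lambda>s \<omega>. simple_process (m k) (\<tau> k) (Y k) s \<omega> - U s \<omega>)) \<longlonglongrightarrow> 0"
    unfolding has_ito_integral_def dmsq_def by blast
  have "eventually (\<lambda>k. dmsq t (\<lambda>s \<omega>. simple_process (m k) (\<tau> k) (Y k) s \<omega> - U s \<omega>) < 1) sequentially"
    by (rule order_tendstoD(2)[OF lim]) simp
  then obtain k where k: "dmsq t (\<lambda>s \<omega>. simple_process (m k) (\<tau> k) (Y k) s \<omega> - U s \<omega>) < 1"
    by (auto simp: eventually_sequentially)
  let ?V = "simple_process (m k) (\<tau> k) (Y k)"
  have Y: "bounded_adapted (\<tau> k i) (Y k i)" if "i < m k" for i
    using simple[of k] that by (auto simp: is_simple_process_def bounded_adapted_def)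
  have V: "?V = step_process {..<m k} (\<tau> k) (\<lambda>i. \<tau> k (Suc i)) (Y k)"
    unfolding simple_process_def[abs_def] step_process_def[abs_def] ..
  have Vm: "jointly_measurable t ?V"
    unfolding V by (rule step_process_jointly_measurable) (use Y bounded_adapted_measurable in auto)
  have "\<forall>i\<in>{..<m k}. \<exists>C. \<forall>\<omega>\<in>space M. norm (Y k i \<omega>) \<le> C"
    using Y unfolding bounded_adapted_def by auto
  then obtain C where C: "\<And>i \<omega>. i < m k \<Longrightarrow> \<omega> \<in> space M \<Longrightarrow> norm (Y k i \<omega>) \<le> C i"
    unfolding bchoice_iff by (metis lessThan_iff)
  have "dmsq t ?V \<le> ennreal ((\<Sum>i<m k. \<bar>C i\<bar>)\<^sup>2 * t)"
  proof (rule dmsq_bounded[OF _ t])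
    fix r \<omega> assume "\<omega> \<in> space M"
    then show "norm (?V r \<omega>) \<le> (\<Sum>i<m k. \<bar>C i\<bar>)"
      unfolding V step_process_def using C
      by (intro sum_norm_le) (force split: split_indicator intro: order_trans[OF _ abs_ge_self])
  qed
  moreover have "dmsq t U \<le> 2 * dmsq t ?V + 2 * dmsq t (\<lambda>s \<omega>. U s \<omega> - ?V s \<omega>)"
    using dmsq_add[OF Vm, of "\<lambda>s \<omega>. U s \<omega> - ?V s \<omega>"] t Vm U_jointly_measurable[OF t]
    by (simp add: jointly_measurable_def case_prod_unfold)
  moreover have "2 * dmsq t ?V < \<infinity>"
    using calculation(1) by (auto simp: ennreal_mult_less_top intro: le_less_trans)
  moreover have "2 * dmsq t (\<lambda>s \<omega>. U s \<omega> - ?V s \<omega>) < \<infinity>"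
    using k unfolding dmsq_minus[of t U] by (auto simp: ennreal_mult_less_top intro: less_trans)
  ultimately show ?thesis
    by (elim le_less_trans) (simp add: less_top)
qed

text \<open>
  The partition of \<open>[0, s]\<close> by the grid points up to \<open>m \<delta>\<close>, with a
  last interval that ends at \<open>s\<close>.
\<close>

definition cell_end :: "real \<Rightarrow> nat \<Rightarrow> real \<Rightarrow> nat \<Rightarrow> real" where
  "cell_end \<delta> m s k = (if k < m then real (Suc k) * \<delta> else s)"

definition scheme_step :: "real \<Rightarrow> nat \<Rightarrow> real \<Rightarrow> real \<Rightarrow> 'a \<Rightarrow> 'n cmat" where
  "scheme_step \<delta> m s = step_process {..m} (\<lambda>k. real k * \<delta>) (cell_end \<delta> m s) (scheme \<delta>)"

lemma scheme_step_joint: "0 \<le> \<delta> \<Longrightarrow> jointly_measurable t (scheme_step \<delta> m s)"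
  unfolding scheme_step_def
  by (rule step_process_jointly_measurable) (rule measurable_F[OF scheme_measurable])

text \<open>
  The equation of \<open>U\<close> minus the expanded walk, for \<open>s\<close> between the grid
  points \<open>m \<delta>\<close> and \<open>(m + 1) \<delta>\<close>. The two terms with \<open>s
  - m \<delta>\<close> correct for the incomplete last interval.
\<close>

lemma scheme_defect:
  assumes "U s \<omega> = mat 1 + J - (1/2) *\<^sub>R D"
  shows "U s \<omega> - scheme \<delta> m \<omega> =
    (J - step_integral {..m} (\<lambda>k. real k * \<delta>) (cell_end \<delta> m s) (scheme \<delta>) \<omega>)
    + scheme \<delta> m \<omega> ** dX (real m * \<delta>) s \<omega>
    + (- (1/2)) *\<^sub>R (D - (\<Sum>k\<in>{..m}. (cell_end \<delta> m s k - real k * \<delta>) *\<^sub>R scheme \<delta> k \<omega>))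
    + (- (1/2)) *\<^sub>R ((s - real m * \<delta>) *\<^sub>R scheme \<delta> m \<omega>)
    + (- (1/2)) *\<^sub>R quadratic_sum \<delta> m \<omega>
    + (- 1) *\<^sub>R (\<Sum>k<m. scheme \<delta> k \<omega> ** remainder \<delta> k \<omega>)"
proof -
  have 1: "step_integral {..m} (\<lambda>k. real k * \<delta>) (cell_end \<delta> m s) (scheme \<delta>) \<omega>
      = (\<Sum>k<m. scheme \<delta> k \<omega> ** increment \<delta> k \<omega>) + scheme \<delta> m \<omega> ** dX (real m * \<delta>) s \<omega>"
    unfolding step_integral_def lessThan_Suc_atMost[symmetric] sum.lessThan_Suc
    by (simp add: cell_end_def increment_def)
  have 2: "(\<Sum>k\<in>{..m}. (cell_end \<delta> m s k - real k * \<delta>) *\<^sub>R scheme \<delta> k \<omega>)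
      = \<delta> *\<^sub>R (\<Sum>k<m. scheme \<delta> k \<omega>) + (s - real m * \<delta>) *\<^sub>R scheme \<delta> m \<omega>"
    unfolding lessThan_Suc_atMost[symmetric] sum.lessThan_Suc
    by (simp add: cell_end_def scaleR_sum_right algebra_simps)
  have 3: "u - v = (J - (A + x)) + x + (- (1/2)) *\<^sub>R (D - (\<delta> *\<^sub>R S + y)) + (- (1/2)) *\<^sub>R y
      + (- (1/2)) *\<^sub>R Q + (- 1) *\<^sub>R R"
    if "u = mat 1 + J - (1/2) *\<^sub>R D" "v = mat 1 + A + (1/2) *\<^sub>R Q - (\<delta>/2) *\<^sub>R S + R"
    for u v A x S y Q R :: "'n cmat"
    unfolding that by (simp add: scaleR_right_distrib scaleR_right_diff_distrib)
  show ?thesis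
    unfolding 1 2 by (rule 3[OF assms scheme_expand[folded quadratic_sum_def]])
qed

text \<open>
  The inequality that feeds the Gronwall argument: up to an error of order \<open>\<delta>\<close>,
  the mean square error at time \<open>s\<close> is bounded by its integral over \<open>[0,
  s]\<close>.
\<close>

lemma scheme_error_step:
  assumes T: "0 \<le> T"
  shows "\<exists>K1 K2. 0 < K1 \<and> 0 \<le> K2 \<and> (\<forall>\<delta> m s. 0 < \<delta> \<longrightarrow> \<delta> \<le> 1 \<longrightarrow> real m * \<delta> \<le> s \<longrightarrow> s \<le> real (Suc m) * \<delta> \<longrightarrow> s \<le> T \<longrightarrow>
    msq (\<lambda>\<omega>. U s \<omega> - scheme \<delta> m \<omega>)
      \<le> ennreal K1 * dmsq s (\<lambda>r \<omega>. U r \<omega> - scheme_step \<delta> m s r \<omega>) + ennreal (K2 * \<delta>))"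
proof -
  obtain C1 where C1: "C1 \<ge> 0" "\<And>s t. 0 \<le> s \<Longrightarrow> s \<le> t \<Longrightarrow>
    integrable M (\<lambda>\<omega>. norm (dX s t \<omega>) ^ (2 * 1)) \<and> (\<integral>\<omega>. norm (dX s t \<omega>) ^ (2 * 1) \<partial>M) \<le> C1 * (t - s) ^ 1"
    using dX_moment[of 1] by auto
  obtain C5 where C5: "C5 \<ge> 0" "\<And>\<delta> m. 0 \<le> \<delta> \<Longrightarrow> msq (quadratic_sum \<delta> m) \<le> ennreal (C5 * real m * \<delta>\<^sup>2)"
    using quadratic_sum_bound by auto
  obtain C6 where C6: "C6 \<ge> 0" "\<And>\<delta> m. 0 \<le> \<delta> \<Longrightarrow>
      msq (\<lambda>\<omega>. \<Sum>k<m. scheme \<delta> k \<omega> ** remainder \<delta> k \<omega>) \<le> ennreal (C6 * (real m)\<^sup>2 * \<delta> ^ 3)"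
    using remainder_sum_bound by auto
  define N where "N = real CARD('n)"
  define K1 where "K1 = 6 * (4 + T)"
  define K2 where "K2 = 6 * (C1 + N\<^sup>2 + C5 * T + C6 * T\<^sup>2)"
  have "msq (\<lambda>\<omega>. U s \<omega> - scheme \<delta> m \<omega>)
      \<le> ennreal K1 * dmsq s (\<lambda>r \<omega>. U r \<omega> - scheme_step \<delta> m s r \<omega>) + ennreal (K2 * \<delta>)"
    if \<delta>: "0 < \<delta>" "\<delta> \<le> 1" and s: "real m * \<delta> \<le> s" "s \<le> real (Suc m) * \<delta>" "s \<le> T" for \<delta> m s
  proof -
    have \<delta>0: "0 \<le> \<delta>"
      using \<delta> by simp
    then have "0 \<le> real m * \<delta>"
      by simp
    then have s0: "0 \<le> s"
      using s(1) by linarith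
    have len: "0 \<le> s - real m * \<delta>" "s - real m * \<delta> \<le> \<delta>"
      using s by (auto simp: algebra_simps)
    have ends: "0 \<le> real k * \<delta> \<and> real k * \<delta> \<le> cell_end \<delta> m s k \<and> cell_end \<delta> m s k \<le> s" if "k \<in> {..m}" for k
    proof (cases "k < m")
      case True
      then have "real (Suc k) * \<delta> \<le> real m * \<delta>"
        using \<delta>0 by (intro mult_right_mono) auto
      then have "real (Suc k) * \<delta> \<le> s"
        using s(1) by linarith
      moreover have "real k * \<delta> \<le> real (Suc k) * \<delta>"
        using \<delta>0 by (intro mult_right_mono) auto
      ultimately show ?thesis
        using True \<delta>0 by (simp add: cell_end_def del: of_nat_Suc)
    next
      case False
      then show ?thesis using that s \<delta>0 by (simp add: cell_end_def)
    qed
    obtain J where J: "has_ito_integral M F X U s J"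
      and eq: "AE \<omega> in M. U s \<omega> = U 0 \<omega> + J \<omega> - (1/2) *\<^sub>R integral {0..s} (\<lambda>s. U s \<omega>)"
      using U_equation[OF s0] by blast
    have [measurable]: "J \<in> borel_measurable M"
      using J by (simp add: has_ito_integral_def)
    have [measurable]: "scheme \<delta> k \<in> borel_measurable M" "increment \<delta> k \<in> borel_measurable M" for k
      using measurable_F[OF scheme_measurable[OF \<delta>0]] increment_measurable[OF \<delta>0] by auto
    have [measurable]: "remainder \<delta> k \<in> borel_measurable M" for k
    proof -
      have "(\<lambda>\<omega>. cayley (increment \<delta> k \<omega>)) \<in> borel_measurable M"
        by (rule borel_measurable_cayley)
            (simp_all add: increment_def[symmetric] dX_skew[folded increment_def] , simp add:
                increment_def dX_skew)
      then show ?thesis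
        unfolding remainder_def by measurable
    qed
    let ?a = "\<lambda>k. real k * \<delta>" and ?b = "cell_end \<delta> m s"
    let ?S = "step_integral {..m} ?a ?b (scheme \<delta>)"
    let ?E1 = "\<lambda>\<omega>. J \<omega> - ?S \<omega>"
    let ?E2 = "\<lambda>\<omega>. scheme \<delta> m \<omega> ** dX (?a m) s \<omega>"
    let ?E3 = "\<lambda>\<omega>. integral {0..s} (\<lambda>s. U s \<omega>) - (\<Sum>k\<in>{..m}. (?b k - ?a k) *\<^sub>R scheme \<delta> k \<omega>)"
    let ?G3 = "\<lambda>\<omega>. \<integral>\<^sup>+r\<in>{0..s}. ennreal ((norm (U r \<omega> - scheme_step \<delta> m s r \<omega>))\<^sup>2) \<partial>lborel"
    let ?E4 = "\<lambda>\<omega>. (s - ?a m) *\<^sub>R scheme \<delta> m \<omega>"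
    let ?E5 = "quadratic_sum \<delta> m"
    let ?E6 = "\<lambda>\<omega>. \<Sum>k<m. scheme \<delta> k \<omega> ** remainder \<delta> k \<omega>"
    have ba: "bounded_adapted (?a k) (scheme \<delta> k)" for k
      by (rule scheme_bounded_adapted[OF \<delta>0])
    have [measurable]: "?S \<in> borel_measurable M"
      by (rule step_integral_measurable) (use ends ba in auto)
    have [measurable]: "dX (?a m) s \<in> borel_measurable M"
      using \<delta>0 s0 by (intro dX_measurable) auto
    have [measurable]: "?E5 \<in> borel_measurable M"
      unfolding quadratic_sum_def by measurable
    have jm: "jointly_measurable s (\<lambda>r \<omega>. U r \<omega> - scheme_step \<delta> m s r \<omega>)"
      using U_jointly_measurable[OF s0] scheme_step_joint[OF \<delta>0]
      unfolding jointly_measurable_def case_prod_unfold by simp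
    have G3_meas[measurable]: "?G3 \<in> borel_measurable M"
    proof -
      note [measurable] = jointly_measurable_extend[OF jm s0, unfolded case_prod_unfold]
      have "(\<lambda>\<omega>. \<integral>\<^sup>+r. ennreal
          ((norm (indicator {0..s} r *\<^sub>R (U (max 0 (min s r)) \<omega> - scheme_step \<delta> m s
              (max 0 (min s r)) \<omega>)))\<^sup>2) \<partial>lborel)
          \<in> borel_measurable M"
        by measurable
      also have
          "(\<lambda>\<omega>. \<integral>\<^sup>+r. ennreal ((norm (indicator {0..s} r *\<^sub>R (U (max 0 (min s r)) \<omega> - scheme_step \<delta> m s
              (max 0 (min s r)) \<omega>)))\<^sup>2) \<partial>lborel) = ?G3"
        by (intro ext nn_integral_cong) (auto split: split_indicator)
      finally show ?thesis .
    qed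
    have E3: "ennreal ((norm (?E3 \<omega>))\<^sup>2) \<le> ennreal s * ?G3 \<omega>" if "continuous_on {0..} (\<lambda>t. U t \<omega>)" for \<omega>
      using step_integral_square_le[OF continuous_on_subset[OF that] s0 finite_atMost[of m] ends,
          where z = "\<lambda>k. scheme \<delta> k \<omega>"]
      by (simp add: scheme_step_def step_process_def)
    have "AE \<omega> in M. ennreal ((norm (U s \<omega> - scheme \<delta> m \<omega>))\<^sup>2) \<le>
        6 * (ennreal ((norm (?E1 \<omega>))\<^sup>2) + ennreal ((norm (?E2 \<omega>))\<^sup>2) + ennreal s * ?G3 \<omega>
          + ennreal ((norm (?E4 \<omega>))\<^sup>2) + ennreal ((norm (?E5 \<omega>))\<^sup>2) + ennreal ((norm (?E6 \<omega>))\<^sup>2))"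
      using eq U_start U_continuous
    proof eventually_elim
      case (elim \<omega>)
      have "U s \<omega> = mat 1 + J \<omega> - (1/2) *\<^sub>R integral {0..s} (\<lambda>s. U s \<omega>)"
        using elim(1,2) by simp
      note decomp = scheme_defect[OF this, of \<delta> m]
      \<comment> \<open>The six terms of the decomposition, the factors \<open>1/2\<close> being dropped.\<close>
      have tri: "norm (x1 + x2 + (- (1/2)) *\<^sub>R x3 + (- (1/2)) *\<^sub>R x4 + (- (1/2)) *\<^sub>R x5 + (- 1) *\<^sub>R x6)
          \<le> norm x1 + norm x2 + norm x3 + norm x4 + norm x5 + norm x6" for x1 x2 x3 x4 x5 x6 :: "'n cmat"
      proof -
        have "norm (x1 + x2 + (- (1/2)) *\<^sub>R x3 + (- (1/2)) *\<^sub>R x4 + (- (1/2)) *\<^sub>R x5 + (- 1) *\<^sub>R x6)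
            \<le> norm x1 + norm x2 + norm ((- (1/2)) *\<^sub>R x3) + norm ((- (1/2)) *\<^sub>R x4)
                + norm ((- (1/2)) *\<^sub>R x5) + norm ((- 1) *\<^sub>R x6)"
          by (intro norm_add_rule_thm order_refl)
        also have "\<dots> \<le> norm x1 + norm x2 + norm x3 + norm x4 + norm x5 + norm x6"
          by (intro add_mono) auto
        finally show ?thesis .
      qed
      have "(norm (U s \<omega> - scheme \<delta> m \<omega>))\<^sup>2 \<le> (norm (?E1 \<omega>) + norm (?E2 \<omega>) + norm (?E3 \<omega>)
          + norm (?E4 \<omega>) + norm (?E5 \<omega>) + norm (?E6 \<omega>))\<^sup>2"
        unfolding decomp by (intro power_mono tri norm_ge_zero)
      also have "\<dots> \<le> 6 * ((norm (?E1 \<omega>))\<^sup>2 + (norm (?E2 \<omega>))\<^sup>2 + (norm (?E3 \<omega>))\<^sup>2 + (norm (?E4 \<omega>))\<^sup>2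
          + (norm (?E5 \<omega>))\<^sup>2 + (norm (?E6 \<omega>))\<^sup>2)"
        by (rule six_squares)
      finally have "ennreal ((norm (U s \<omega> - scheme \<delta> m \<omega>))\<^sup>2) \<le>
        6 * (ennreal ((norm (?E1 \<omega>))\<^sup>2) + ennreal ((norm (?E2 \<omega>))\<^sup>2) + ennreal ((norm (?E3 \<omega>))\<^sup>2)
          + ennreal ((norm (?E4 \<omega>))\<^sup>2) + ennreal ((norm (?E5 \<omega>))\<^sup>2) + ennreal ((norm (?E6 \<omega>))\<^sup>2))"
        by (subst (asm) ennreal_le_iff[symmetric]) (simp_all add: ennreal_mult)
      also have "\<dots> \<le> 6 * (ennreal ((norm (?E1 \<omega>))\<^sup>2) + ennreal ((norm (?E2 \<omega>))\<^sup>2) + ennreal s * ?G3 \<omega>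
          + ennreal ((norm (?E4 \<omega>))\<^sup>2) + ennreal ((norm (?E5 \<omega>))\<^sup>2) + ennreal ((norm (?E6 \<omega>))\<^sup>2))"
        by (intro mult_left_mono add_mono order_refl E3 elim(3)) simp
      finally show ?case .
    qed
    then have "msq (\<lambda>\<omega>. U s \<omega> - scheme \<delta> m \<omega>) \<le> (\<integral>\<^sup>+\<omega>. 
        6 * (ennreal ((norm (?E1 \<omega>))\<^sup>2) + ennreal ((norm (?E2 \<omega>))\<^sup>2) + ennreal s * ?G3 \<omega>
          + ennreal ((norm (?E4 \<omega>))\<^sup>2) + ennreal ((norm (?E5 \<omega>))\<^sup>2) + ennreal ((norm (?E6 \<omega>))\<^sup>2)) \<partial>M)"
      unfolding msq_def by (rule nn_integral_mono_AE)
    also have "\<dots> = 6 * (msq ?E1 + msq ?E2 + ennreal s * (\<integral>\<^sup>+\<omega>. ?G3 \<omega> \<partial>M) + msq ?E4 + msq ?E5 + msq ?E6)"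
      unfolding msq_def by (simp add: nn_integral_cmult nn_integral_add)
    also have "\<dots> = 6 * (msq ?E1 + msq ?E2 + ennreal s * dmsq s (\<lambda>r \<omega>. U r \<omega> - scheme_step \<delta> m s r \<omega>)
        + msq ?E4 + msq ?E5 + msq ?E6)"
      unfolding dmsq_def ..
    also have "\<dots> \<le> 6 * (4 * dmsq s (\<lambda>r \<omega>. U r \<omega> - scheme_step \<delta> m s r \<omega>) + ennreal (C1 * \<delta>)
       + ennreal T * dmsq s (\<lambda>r \<omega>. U r \<omega> - scheme_step \<delta> m s r \<omega>) + ennreal (N\<^sup>2 * \<delta>)
           + ennreal (C5 * T * \<delta>) + ennreal (C6 * T\<^sup>2 * \<delta>))"
    proof (intro mult_left_mono add_mono)
      show "msq ?E1 \<le> 4 * dmsq s (\<lambda>r \<omega>. U r \<omega> - scheme_step \<delta> m s r \<omega>)"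
        unfolding scheme_step_def by (rule ito_comparison[OF J s0]) (use ends ba in auto)
      show "msq ?E2 \<le> ennreal (C1 * \<delta>)"
      proof (rule msq_le)
        show "(norm (?E2 \<omega>))\<^sup>2 \<le> norm (dX (?a m) s \<omega>) ^ (2 * 1)" for \<omega>
          using norm_unitary_mult[OF scheme_unitary] by simp
        show "integrable M (\<lambda>\<omega>. norm (dX (?a m) s \<omega>) ^ (2 * 1))"
          using C1(2)[of "?a m" s] \<delta>0 s by auto
        have "(\<integral>\<omega>. norm (dX (?a m) s \<omega>) ^ (2 * 1) \<partial>M) \<le> C1 * (s - ?a m) ^ 1"
          using C1(2)[of "?a m" s] \<delta>0 s by auto
        also have "\<dots> \<le> C1 * \<delta>"
          using C1(1) len by (simp add: mult_left_mono)
        finally show "(\<integral>\<omega>. norm (dX (?a m) s \<omega>) ^ (2 * 1) \<partial>M) \<le> C1 * \<delta>" .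
      qed
      show "ennreal s * dmsq s (\<lambda>r \<omega>. U r \<omega> - scheme_step \<delta> m s r \<omega>)
          \<le> ennreal T * dmsq s (\<lambda>r \<omega>. U r \<omega> - scheme_step \<delta> m s r \<omega>)"
        using s by (intro mult_right_mono ennreal_leI) auto
      show "msq ?E4 \<le> ennreal (N\<^sup>2 * \<delta>)"
      proof (rule msq_le)
        show "(norm (?E4 \<omega>))\<^sup>2 \<le> N\<^sup>2 * \<delta>" for \<omega>
        proof -
          have "norm (?E4 \<omega>) \<le> \<delta> * N"
            using len norm_unitary_le[OF scheme_unitary, of \<delta> m \<omega>] by (simp add: N_def mult_mono)
          then have "(norm (?E4 \<omega>))\<^sup>2 \<le> (\<delta> * N)\<^sup>2"
            by (intro power_mono) auto
          also have "(\<delta> * N)\<^sup>2 = N\<^sup>2 * (\<delta> * \<delta>)"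
            by (simp add: power2_eq_square)
          also have "\<dots> \<le> N\<^sup>2 * (1 * \<delta>)"
            using \<delta> by (intro mult_left_mono mult_right_mono) auto
          also have "\<dots> = N\<^sup>2 * \<delta>"
            by simp
          finally show ?thesis .
        qed
      qed (simp_all add: prob_space)
      show "msq ?E5 \<le> ennreal (C5 * T * \<delta>)"
      proof -
        have "C5 * real m * \<delta>\<^sup>2 = C5 * (real m * \<delta>) * \<delta>" by (simp add: power2_eq_square)
        also have "\<dots> \<le> C5 * T * \<delta>"
          using s C5(1) \<delta>0 by (intro mult_right_mono mult_left_mono) auto
        finally show ?thesis
          using C5(2)[OF \<delta>0, of m] by (meson ennreal_leI order_trans)
      qed
      show "msq ?E6 \<le> ennreal (C6 * T\<^sup>2 * \<delta>)"
      proof -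
        have "C6 * (real m)\<^sup>2 * \<delta> ^ 3 = C6 * (real m * \<delta>)\<^sup>2 * \<delta>" by (simp add: power2_eq_square power3_eq_cube)
        also have "\<dots> \<le> C6 * T\<^sup>2 * \<delta>"
          using s C6(1) \<delta>0 by (intro mult_right_mono mult_left_mono power_mono) auto
        finally show ?thesis
          using C6(2)[OF \<delta>0, of m] by (meson ennreal_leI order_trans)
      qed
    qed auto
    also have "\<dots> = ennreal K1 * dmsq s (\<lambda>r \<omega>. U r \<omega> - scheme_step \<delta> m s r \<omega>) + ennreal (K2 * \<delta>)"
    proof -
      have e1: "ennreal K1 = 6 * (4 + ennreal T)"
        unfolding K1_def using T by (simp add: ennreal_mult)
      have "K2 * \<delta> = 6 * (C1 * \<delta> + N\<^sup>2 * \<delta> + C5 * T * \<delta> + C6 * T\<^sup>2 * \<delta>)"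
        by (simp add: K2_def algebra_simps)
      then have e2: "ennreal (K2 * \<delta>) = 6 * (ennreal (C1 * \<delta>) + ennreal (N\<^sup>2 * \<delta>)
          + ennreal (C5 * T * \<delta>) + ennreal (C6 * T\<^sup>2 * \<delta>))"
        using C1(1) C5(1) C6(1) \<delta>0 T by (simp add: ennreal_mult)
      show ?thesis
        unfolding e1 e2 by (simp add: distrib_left distrib_right add_ac mult_ac)
    qed
    finally show ?thesis .
  qed
  moreover have "0 < K1" "0 \<le> K2"
    using T C1(1) C5(1) C6(1) by (auto simp: K1_def K2_def)
  ultimately show ?thesis by blast
qed

definition grid_error :: "real \<Rightarrow> real \<Rightarrow> ennreal" where
  "grid_error \<delta> r = msq (\<lambda>\<omega>. U r \<omega> - scheme \<delta> (nat \<lfloor>r / \<delta>\<rfloor>) \<omega>)"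

text \<open>
  Away from the grid the step process with the last interval cut at \<open>s\<close> is the walk
  read at the preceding grid point. The latter description does not mention \<open>s\<close>, as the
  Gronwall argument requires.
\<close>

lemma scheme_step_eq:
  assumes \<delta>: "0 < \<delta>" and s: "real m * \<delta> \<le> s" "s \<le> real (Suc m) * \<delta>"
    and r: "r \<in> {0..s}" "\<And>k. r \<noteq> real k * \<delta>"
  shows "scheme_step \<delta> m s r \<omega> = scheme \<delta> (nat \<lfloor>r / \<delta>\<rfloor>) \<omega>"
proof -
  define k where "k = nat \<lfloor>r / \<delta>\<rfloor>"
  have r0: "0 < r"
    using r(1) r(2)[of 0] by auto
  then have "real k \<le> r / \<delta>" "r / \<delta> < real (Suc k)"
    using \<delta> nat_floor_cell[of "r / \<delta>"] by (simp_all add: k_def)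
  then have kr: "real k * \<delta> \<le> r" "r < real (Suc k) * \<delta>"
    using \<delta> by (simp_all add: pos_le_divide_eq pos_divide_less_eq del: of_nat_Suc)
  then have kr': "real k * \<delta> < r"
    using r(2)[of k] by simp
  have "real k * \<delta> < real (Suc m) * \<delta>"
    using kr' r(1) s by auto
  then have km: "k \<le> m"
    using \<delta> by (simp add: mult_less_cancel_right)
  have ind: "(indicator {real j * \<delta><..cell_end \<delta> m s j} r :: real) = (if j = k then 1 else 0)" if "j \<le> m" for j
  proof -
    have "r \<in> {real j * \<delta><..cell_end \<delta> m s j} \<longleftrightarrow> j = k"
    proof
      assume rj: "r \<in> {real j * \<delta><..cell_end \<delta> m s j}"
      then have "real j * \<delta> < real (Suc k) * \<delta>"
        using kr by auto
      then have "j \<le> k"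
        using \<delta> by (simp add: mult_less_cancel_right)
      moreover have "k \<le> j"
      proof (cases "j < m")
        case True
        then have "real k * \<delta> < real (Suc j) * \<delta>"
          using rj kr' by (auto simp: cell_end_def simp del: of_nat_Suc)
        then show ?thesis
          using \<delta> by (simp add: mult_less_cancel_right)
      qed (use that km in simp)
      ultimately show "j = k" by simp
    next
      assume "j = k"
      then show "r \<in> {real j * \<delta><..cell_end \<delta> m s j}"
        using kr kr' r(1) by (simp add: cell_end_def del: of_nat_Suc)
    qed
    then show ?thesis by (cases "j = k") (simp_all add: indicator_def del: greaterThanAtMost_iff)
  qed
  have "scheme_step \<delta> m s r \<omega> = (\<Sum>j\<in>{..m}. (if j = k then 1 else 0) *\<^sub>R scheme \<delta> j \<omega>)"
    unfolding scheme_step_def step_process_def by (intro sum.cong refl) (simp add: ind)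
  also have "\<dots> = (\<Sum>j\<in>{..m}. if j = k then scheme \<delta> k \<omega> else 0)"
    by (intro sum.cong refl) simp
  also have "\<dots> = scheme \<delta> k \<omega>"
    using km by simp
  finally show ?thesis
    by (simp add: k_def)
qed

lemma dmsq_grid_error:
  assumes \<delta>: "0 < \<delta>" and s: "0 \<le> s" "real m * \<delta> \<le> s" "s \<le> real (Suc m) * \<delta>"
  shows "dmsq s (\<lambda>r \<omega>. U r \<omega> - scheme_step \<delta> m s r \<omega>) = (\<integral>\<^sup>+r\<in>{0..s}. grid_error \<delta> r \<partial>lborel)"
proof -
  have jm: "jointly_measurable s (\<lambda>r \<omega>. U r \<omega> - scheme_step \<delta> m s r \<omega>)"
    using U_jointly_measurable[OF s(1)] scheme_step_joint[of \<delta>] \<delta>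
    unfolding jointly_measurable_def case_prod_unfold by simp
  have "dmsq s (\<lambda>r \<omega>. U r \<omega> - scheme_step \<delta> m s r \<omega>)
      = (\<integral>\<^sup>+r\<in>{0..s}. msq (\<lambda>\<omega>. U r \<omega> - scheme_step \<delta> m s r \<omega>) \<partial>lborel)"
    by (rule dmsq_tonelli[OF jm s(1)])
  also have "\<dots> = (\<integral>\<^sup>+r\<in>{0..s}. grid_error \<delta> r \<partial>lborel)"
  proof (rule nn_integral_cong_AE)
    have "countable (range (\<lambda>k::nat. real k * \<delta>))"
      by simp
    then have "AE r in lborel. r \<notin> range (\<lambda>k::nat. real k * \<delta>)"
      by (intro AE_not_in countable_imp_null_set_lborel)
    then show "AE r in lborel. msq (\<lambda>\<omega>. U r \<omega> - scheme_step \<delta> m s r \<omega>) * indicator {0..s} r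
        = grid_error \<delta> r * indicator {0..s} r"
    proof eventually_elim
      case (elim r)
      then have "r \<noteq> real k * \<delta>" for k by auto
      then have "scheme_step \<delta> m s r \<omega> = scheme \<delta> (nat \<lfloor>r / \<delta>\<rfloor>) \<omega>" if "r \<in> {0..s}" for \<omega>
        by (rule scheme_step_eq[OF \<delta> s(2,3) that])
      then show ?case
        unfolding grid_error_def by (simp split: split_indicator)
    qed
  qed
  finally show ?thesis .
qed

lemma scheme_error:
  assumes T: "0 \<le> T"
  shows "\<exists>C>0. \<forall>\<delta> m s. 0 < \<delta> \<longrightarrow> \<delta> \<le> 1 \<longrightarrow> real m * \<delta> \<le> s \<longrightarrow> s \<le> real (Suc m) * \<delta> \<longrightarrow> s \<le> T \<longrightarrow>
    msq (\<lambda>\<omega>. U s \<omega> - scheme \<delta> m \<omega>) \<le> ennreal (C * \<delta>)"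
proof -
  obtain K1 K2 where K: "0 < K1" "0 \<le> K2" and step: "\<And>\<delta> m s. 0 < \<delta> \<Longrightarrow> \<delta> \<le> 1 \<Longrightarrow> real m * \<delta> \<le> s \<Longrightarrow> s
      \<le> real (Suc m) * \<delta> \<Longrightarrow> s \<le> T \<Longrightarrow>
    msq (\<lambda>\<omega>. U s \<omega> - scheme \<delta> m \<omega>)
      \<le> ennreal K1 * dmsq s (\<lambda>r \<omega>. U r \<omega> - scheme_step \<delta> m s r \<omega>) + ennreal (K2 * \<delta>)"
    using scheme_error_step[OF T] by blast
  define L where "L = 2 * K2 * exp (2 * K1 * T)"
  define C where "C = K1 * (L * T) + K2 + 1"
  have L: "0 \<le> L" using K by (simp add: L_def)
  have "msq (\<lambda>\<omega>. U s \<omega> - scheme \<delta> m \<omega>) \<le> ennreal (C * \<delta>)"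
    if \<delta>: "0 < \<delta>" "\<delta> \<le> 1" and s: "real m * \<delta> \<le> s" "s \<le> real (Suc m) * \<delta>" "s \<le> T" for \<delta> m s
  proof -
    have cell: "real (nat \<lfloor>r / \<delta>\<rfloor>) * \<delta> \<le> r \<and> r \<le> real (Suc (nat \<lfloor>r / \<delta>\<rfloor>)) * \<delta>" if "0 \<le> r" for r
    proof -
      have "real (nat \<lfloor>r / \<delta>\<rfloor>) \<le> r / \<delta>" "r / \<delta> < real (Suc (nat \<lfloor>r / \<delta>\<rfloor>))"
        using \<delta> that by (intro nat_floor_cell; simp)+
      then show ?thesis
        using \<delta> by (simp add: pos_le_divide_eq pos_divide_less_eq less_imp_le del: of_nat_Suc)
    qed
    \<comment> \<open>For each time \<open>r\<close> the estimate is applied with the grid point preceding \<open>r\<close>.\<close>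
    have rec: "grid_error \<delta> r \<le> ennreal K1 * (\<integral>\<^sup>+r\<in>{0..r}. grid_error \<delta> r \<partial>lborel) + ennreal (K2 * \<delta>)"
        if "r \<in> {0..T}" for r
      using step[OF \<delta>, of "nat \<lfloor>r / \<delta>\<rfloor>" r] dmsq_grid_error[OF \<delta>(1), of r "nat \<lfloor>r / \<delta>\<rfloor>"] cell[of r] that
      by (simp add: grid_error_def[symmetric] del: of_nat_Suc)
    have fin: "(\<integral>\<^sup>+r\<in>{0..T}. grid_error \<delta> r \<partial>lborel) < \<infinity>"
    proof -
      let ?S = "scheme_step \<delta> (nat \<lfloor>T / \<delta>\<rfloor>) T"
      have Sj: "jointly_measurable T ?S"
        using \<delta> by (intro scheme_step_joint) simp
      have "norm (?S r \<omega>) \<le> (\<Sum>k\<in>{..nat \<lfloor>T / \<delta>\<rfloor>}. real CARD('n))" for r \<omega>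
        unfolding scheme_step_def step_process_def using norm_unitary_le[OF scheme_unitary, of \<delta> _ \<omega>]
        by (intro sum_norm_le) (auto split: split_indicator)
      then have "dmsq T ?S \<le> ennreal ((\<Sum>k\<in>{..nat \<lfloor>T / \<delta>\<rfloor>}. real CARD('n))\<^sup>2 * T)"
        by (intro dmsq_bounded T)
      then have "dmsq T ?S < \<infinity>"
        by (rule le_less_trans) simp
      moreover have "dmsq T (\<lambda>r \<omega>. - ?S r \<omega>) = dmsq T ?S"
        unfolding dmsq_def by simp
      moreover have "dmsq T (\<lambda>r \<omega>. U r \<omega> - ?S r \<omega>) \<le> 2 * dmsq T U + 2 * dmsq T (\<lambda>r \<omega>. - ?S r \<omega>)"
        using dmsq_add[OF U_jointly_measurable[OF T] jointly_measurable_minus[OF Sj] T] by simp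
      ultimately have "dmsq T (\<lambda>r \<omega>. U r \<omega> - ?S r \<omega>) < \<infinity>"
        using dmsq_U_finite[OF T] by (elim le_less_trans) (simp add: ennreal_mult_less_top less_top)
      then show ?thesis
        using dmsq_grid_error[OF \<delta>(1) T] cell[OF T] by simp
    qed
    have s0: "0 \<le> s"
      using s(1) \<delta> mult_nonneg_nonneg[of "real m" \<delta>] by linarith
    have "grid_error \<delta> r \<le> ennreal (2 * (K2 * \<delta>) * exp (2 * K1 * T))" if "r \<in> {0..T}" for r
      by (rule integral_gronwall[OF rec fin K(1) _ that]) (use K \<delta> in auto)
    then have grid: "grid_error \<delta> r \<le> ennreal (L * \<delta>)" if "r \<in> {0..T}" for r
      using that by (simp add: L_def mult_ac)
    have "(\<integral>\<^sup>+r\<in>{0..s}. grid_error \<delta> r \<partial>lborel) \<le> (\<integral>\<^sup>+r\<in>{0..s}. ennreal (L * \<delta>) \<partial>lborel)"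
      using s by (intro nn_integral_mono) (auto split: split_indicator intro: grid)
    also have "\<dots> = ennreal (L * \<delta> * s)"
      using s0 L \<delta> by (simp add: nn_integral_cmult_indicator ennreal_mult)
    also have "\<dots> \<le> ennreal (L * \<delta> * T)"
      using s L \<delta> by (intro ennreal_leI mult_left_mono) auto
    finally have "msq (\<lambda>\<omega>. U s \<omega> - scheme \<delta> m \<omega>) \<le> ennreal K1 * ennreal (L * \<delta> * T) + ennreal (K2 * \<delta>)"
      using step[OF \<delta> s] unfolding dmsq_grid_error[OF \<delta>(1) s0 s(1,2)]
      by (meson add_right_mono mult_left_mono order_trans zero_le)
    also have "\<dots> = ennreal (K1 * (L * \<delta> * T) + K2 * \<delta>)"
      using K L \<delta> T by (simp add: ennreal_mult)
    also have "\<dots> \<le> ennreal (C * \<delta>)"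
      using \<delta> by (intro ennreal_leI) (simp add: C_def algebra_simps)
    finally show ?thesis .
  qed
  moreover have "C > 0"
    using K L T by (simp add: C_def add_nonneg_pos)
  ultimately show ?thesis by blast
qed

text \<open>
  The distance of \<open>U s\<close> to the closed set of unitary matrices is at most its distance
  to the walk.
\<close>

lemma U_unitary:
  assumes s: "0 \<le> s"
  shows "AE \<omega> in M. unitary (U s \<omega>)"
proof -
  obtain C where C: "C > 0" "\<And>\<delta> m. 0 < \<delta> \<Longrightarrow> \<delta> \<le> 1 \<Longrightarrow> real m * \<delta> \<le> s \<Longrightarrow> s \<le> real (Suc m) * \<delta> \<Longrightarrow>
    msq (\<lambda>\<omega>. U s \<omega> - scheme \<delta> m \<omega>) \<le> ennreal (C * \<delta>)"
    using scheme_error[OF s] by blast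
  let ?d = "\<lambda>\<omega>. infdist (U s \<omega>) {A. unitary A}"
  have ne: "{A :: 'n cmat. unitary A} \<noteq> {}"
    using unitary_one by auto
  have [measurable]: "?d \<in> borel_measurable M"
    by (rule borel_measurable_continuous_on[OF _ U_measurable[OF s]]) (intro continuous_intros)
  have bound: "(\<integral>\<^sup>+\<omega>. ennreal ((?d \<omega>)\<^sup>2) \<partial>M) \<le> ennreal (C * (1 / real (Suc k)))" for k
  proof -
    let ?\<delta> = "1 / real (Suc k)"
    define m where "m = nat \<lfloor>s / ?\<delta>\<rfloor>"
    have "real m \<le> s / ?\<delta>" "s / ?\<delta> < real (Suc m)"
      unfolding m_def using s by (intro nat_floor_cell; simp)+
    then have m: "real m * ?\<delta> \<le> s" "s \<le> real (Suc m) * ?\<delta>"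
      by (simp_all add: field_simps)
    have "(\<integral>\<^sup>+\<omega>. ennreal ((?d \<omega>)\<^sup>2) \<partial>M) \<le> msq (\<lambda>\<omega>. U s \<omega> - scheme ?\<delta> m \<omega>)"
      unfolding msq_def
    proof (intro nn_integral_mono ennreal_leI power_mono)
      fix \<omega>
      show "?d \<omega> \<le> norm (U s \<omega> - scheme ?\<delta> m \<omega>)"
        unfolding dist_norm[symmetric] using scheme_unitary by (intro infdist_le) simp
    qed (simp add: infdist_nonneg)
    also have "\<dots> \<le> ennreal (C * ?\<delta>)"
      by (rule C(2)[OF _ _ m]) auto
    finally show ?thesis .
  qed
  have "(\<lambda>k. ennreal (C * (1 / real (Suc k)))) \<longlonglongrightarrow> ennreal (C * 0)"
    by (intro tendsto_ennrealI tendsto_mult tendsto_const) (use LIMSEQ_inverse_real_of_nat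
        in \<open>simp add: inverse_eq_divide\<close>)
  then have "(\<integral>\<^sup>+\<omega>. ennreal ((?d \<omega>)\<^sup>2) \<partial>M) \<le> ennreal (C * 0)"
    by (rule LIMSEQ_le_const) (use bound in blast)
  then have "(\<integral>\<^sup>+\<omega>. ennreal ((?d \<omega>)\<^sup>2) \<partial>M) = 0"
    by simp
  then have "AE \<omega> in M. ennreal ((?d \<omega>)\<^sup>2) = 0"
    by (subst (asm) nn_integral_0_iff_AE) auto
  then show ?thesis
  proof eventually_elim
    case (elim \<omega>)
    then have "?d \<omega> = 0"
      by (simp add: ennreal_eq_0_iff)
    then have "U s \<omega> \<in> {A. unitary A}"
      by (simp only: in_closed_iff_infdist_zero[OF closed_unitary ne])
    then show ?case
      by (rule CollectD)
  qed
qed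

lemma scheme_error_L1:
  assumes T: "0 \<le> T"
  shows "\<exists>C>0. \<forall>\<delta> m s. 0 < \<delta> \<longrightarrow> \<delta> \<le> 1 \<longrightarrow> real m * \<delta> \<le> s \<longrightarrow> s \<le> real (Suc m) * \<delta> \<longrightarrow> s \<le> T \<longrightarrow>
    integrable M (\<lambda>\<omega>. U s \<omega> - scheme \<delta> m \<omega>) \<and> (\<integral>\<omega>. norm (U s \<omega> - scheme \<delta> m \<omega>) \<partial>M) \<le> C * sqrt \<delta>"
proof -
  obtain C where C: "C > 0" "\<And>\<delta> m s. 0 < \<delta> \<Longrightarrow> \<delta> \<le> 1 \<Longrightarrow> real m * \<delta> \<le> s \<Longrightarrow> s \<le> real (Suc m) * \<delta> \<Longrightarrow> s \<le> T \<Longrightarrow>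
    msq (\<lambda>\<omega>. U s \<omega> - scheme \<delta> m \<omega>) \<le> ennreal (C * \<delta>)"
    using scheme_error[OF T] by blast
  have "integrable M (\<lambda>\<omega>. U s \<omega> - scheme \<delta> m \<omega>) \<and> (\<integral>\<omega>. norm (U s \<omega> - scheme \<delta> m \<omega>) \<partial>M) \<le> (1 + C) * sqrt \<delta>"
    if \<delta>: "0 < \<delta>" "\<delta> \<le> 1" and s: "real m * \<delta> \<le> s" "s \<le> real (Suc m) * \<delta>" "s \<le> T" for \<delta> m s
  proof -
    have s0: "0 \<le> s"
      using s(1) \<delta> mult_nonneg_nonneg[of "real m" \<delta>] by linarith
    let ?f = "\<lambda>\<omega>. U s \<omega> - scheme \<delta> m \<omega>"
    define r where "r = sqrt \<delta>"
    have r: "r > 0" "r * r = \<delta>"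
      using \<delta> by (auto simp: r_def)
    have [measurable]: "U s \<in> borel_measurable M" "scheme \<delta> m \<in> borel_measurable M"
      using U_measurable[OF s0] measurable_F[OF scheme_measurable] \<delta> by auto
    have "(\<integral>\<^sup>+\<omega>. ennreal ((norm (?f \<omega>))\<^sup>2) \<partial>M) \<le> ennreal (C * \<delta>)"
      using C(2)[OF \<delta> s] by (simp add: msq_def)
    moreover from this have int2: "integrable M (\<lambda>\<omega>. (norm (?f \<omega>))\<^sup>2)"
      by (intro integrableI_nonneg) (auto intro: le_less_trans)
    ultimately have e2: "(\<integral>\<omega>. (norm (?f \<omega>))\<^sup>2 \<partial>M) \<le> C * \<delta>"
      using C(1) \<delta> by (subst (asm) nn_integral_eq_integral) (auto simp: ennreal_le_iff)
    have amgm: "y \<le> r + y\<^sup>2 / r" for y :: real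
    proof -
      have "0 \<le> (y - r / 2)\<^sup>2 + 3 / 4 * (r * r)"
        using r(1) by (intro add_nonneg_nonneg) auto
      then have "y * r \<le> r * r + y\<^sup>2"
        by (simp add: power2_eq_square algebra_simps)
      then show ?thesis using r by (simp add: field_simps)
    qed
    have int': "integrable M (\<lambda>\<omega>. r + (norm (?f \<omega>))\<^sup>2 / r)"
      using int2 by auto
    have int: "integrable M ?f"
    proof (rule Bochner_Integration.integrable_bound[OF int'])
      have "norm (?f \<omega>) \<le> norm (r + (norm (?f \<omega>))\<^sup>2 / r)" for \<omega>
        using amgm[of "norm (?f \<omega>)"] by simp
      then show "AE \<omega> in M. norm (?f \<omega>) \<le> norm (r + (norm (?f \<omega>))\<^sup>2 / r)"
        by simp
    qed measurable
    have "(\<integral>\<omega>. norm (?f \<omega>) \<partial>M) \<le> (\<integral>\<omega>. r + (norm (?f \<omega>))\<^sup>2 / r \<partial>M)"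
      using int int' amgm by (intro integral_mono) auto
    also have "\<dots> = r + (\<integral>\<omega>. (norm (?f \<omega>))\<^sup>2 \<partial>M) / r"
      using int2 by (simp add: prob_space)
    also have "\<dots> \<le> r + C * (r * r) / r"
      using e2 r by (intro add_left_mono divide_right_mono) auto
    also have "\<dots> = (1 + C) * r"
      using r by (simp add: field_simps)
    finally show ?thesis
      using int by (simp add: r_def)
  qed
  then show ?thesis
    using C(1) by (intro exI[of _ "1 + C"]) auto
qed

end

section \<open>Second order jets of matrix-valued functions\<close>

text \<open>
  \<open>f\<close> has the expansion \<open>f0 + f1 + f2\<close> up to third order in the size
  \<open>h\<close>, uniformly in the parameter \<open>p \<in> D\<close>. The parameter will be a
  pair of the position of the walk and the increment; the bound on \<open>f\<close> makes the
  estimates hold for large \<open>h\<close> too, where the expansion is no approximation.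
\<close>

definition jet ::
    "'p set \<Rightarrow> ('p \<Rightarrow> real) \<Rightarrow> ('p \<Rightarrow> 'n::finite cmat) \<Rightarrow> ('p \<Rightarrow> 'n cmat) \<Rightarrow> ('p \<Rightarrow> 'n cmat) \<Rightarrow>
        ('p \<Rightarrow> 'n cmat) \<Rightarrow> bool" where
  "jet D h f f0 f1 f2 \<longleftrightarrow> (\<exists>K\<ge>0. \<forall>p\<in>D. norm (f p) \<le> K \<and> norm (f0 p) \<le> K \<and> norm (f1 p) \<le> K * h p
     \<and> norm (f2 p) \<le> K * (h p)\<^sup>2 \<and> norm (f p - (f0 p + f1 p + f2 p)) \<le> K * h p ^ 3)"

lemma jetI:
  assumes "\<And>p. p \<in> D \<Longrightarrow> norm (f p) \<le> K" "\<And>p. p \<in> D \<Longrightarrow> norm (f0 p) \<le> K"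
    "\<And>p. p \<in> D \<Longrightarrow> norm (f1 p) \<le> K * h p" "\<And>p. p \<in> D \<Longrightarrow> norm (f2 p) \<le> K * (h p)\<^sup>2"
    "\<And>p. p \<in> D \<Longrightarrow> norm (f p - (f0 p + f1 p + f2 p)) \<le> K * h p ^ 3" "K \<ge> 0"
  shows "jet D h f f0 f1 f2"
  using assms unfolding jet_def by blast

lemma jet_const:
  assumes "\<And>p. p \<in> D \<Longrightarrow> norm (f p) \<le> K" "K \<ge> 0" "\<And>p. p \<in> D \<Longrightarrow> h p \<ge> 0"
  shows "jet D h f f (\<lambda>_. 0) (\<lambda>_. 0)"
  using assms by (intro jetI[where K = K]) auto

lemma jet_cadjoint:
  assumes "jet D h f f0 f1 f2"
  shows "jet D h (\<lambda>p. cadjoint (f p)) (\<lambda>p. cadjoint (f0 p)) (\<lambda>p. cadjoint (f1 p)) (\<lambda>p. cadjoint (f2 p))"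
proof -
  have "norm (cadjoint a - (cadjoint b + cadjoint c + cadjoint d)) = norm (a - (b + c + d))"
      for a b c d :: "'b cmat"
    by (simp flip: cadjoint_simps)
  then show ?thesis
    using assms unfolding jet_def by simp
qed

lemma jet_mult:
  assumes f: "jet D h f f0 f1 f2" and g: "jet D h g g0 g1 g2" and h: "\<And>p. p \<in> D \<Longrightarrow> h p \<ge> 0"
  shows "jet D h (\<lambda>p. f p ** g p) (\<lambda>p. f0 p ** g0 p) (\<lambda>p. f0 p ** g1 p + f1 p ** g0 p)
    (\<lambda>p. f0 p ** g2 p + f1 p ** g1 p + f2 p ** g0 p)"
proof -
  obtain K where K: "K \<ge> 0" and fK: "\<And>p. p \<in> D \<Longrightarrow> norm (f p) \<le> K \<and> norm (f0 p) \<le> K \<and> norm (f1 p) \<le> K * h p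
     \<and> norm (f2 p) \<le> K * (h p)\<^sup>2 \<and> norm (f p - (f0 p + f1 p + f2 p)) \<le> K * h p ^ 3"
    using f unfolding jet_def by blast
  obtain L where L: "L \<ge> 0" and gL: "\<And>p. p \<in> D \<Longrightarrow> norm (g p) \<le> L \<and> norm (g0 p) \<le> L \<and> norm (g1 p) \<le> L * h p
     \<and> norm (g2 p) \<le> L * (h p)\<^sup>2 \<and> norm (g p - (g0 p + g1 p + g2 p)) \<le> L * h p ^ 3"
    using g unfolding jet_def by blast
  show ?thesis
  proof (rule jetI[where K = "7 * (K * L)"])
    fix p assume p: "p \<in> D"
    define H where "H = h p"
    have H: "H \<ge> 0" using h[OF p] by (simp add: H_def)
    note fp = fK[OF p, folded H_def] and gp = gL[OF p, folded H_def]
    have KL: "0 \<le> K * L" "0 \<le> K * L * H" "0 \<le> K * L * H\<^sup>2" "0 \<le> K * L * H ^ 3"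
      using K L H by auto
    have b: "norm (f p ** g p) \<le> K * L" "norm (f0 p ** g0 p) \<le> K * L"
      using fp gp by (auto intro: matmul_mono)
    have b1: "norm (f0 p ** g1 p) \<le> K * L * H" "norm (f1 p ** g0 p) \<le> K * L * H"
      using matmul_mono[of "f0 p" K "g1 p" "L * H"] matmul_mono[of "f1 p" "K * H" "g0 p" L] fp gp
          by (auto simp: mult_ac)
    have b2: "norm (f0 p ** g2 p) \<le> K * L * H\<^sup>2" "norm (f1 p ** g1 p) \<le> K * L * H\<^sup>2"
        "norm (f2 p ** g0 p) \<le> K * L * H\<^sup>2"
      using matmul_mono[of "f0 p" K "g2 p" "L * H\<^sup>2"] matmul_mono[of "f1 p" "K * H" "g1 p" "L * H"]
        matmul_mono[of "f2 p" "K * H\<^sup>2" "g0 p" L] fp gp by (auto simp: mult_ac power2_eq_square)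
    have c1: "norm (f0 p ** g1 p + f1 p ** g0 p) \<le> 2 * (K * L * H)"
      using b1 norm_triangle_ineq[of "f0 p ** g1 p" "f1 p ** g0 p"] by linarith
    have c2: "norm (f0 p ** g2 p + f1 p ** g1 p + f2 p ** g0 p) \<le> 3 * (K * L * H\<^sup>2)"
      using b2 norm_triangle_ineq[of "f0 p ** g2 p + f1 p ** g1 p" "f2 p ** g0 p"]
        norm_triangle_ineq[of "f0 p ** g2 p" "f1 p ** g1 p"] by linarith
    show "norm (f p ** g p) \<le> 7 * (K * L)" "norm (f0 p ** g0 p) \<le> 7 * (K * L)"
      using b KL by linarith+
    show "norm (f0 p ** g1 p + f1 p ** g0 p) \<le> 7 * (K * L) * h p"
      using c1 KL unfolding H_def[symmetric] by (simp add: mult_ac)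
    show "norm (f0 p ** g2 p + f1 p ** g1 p + f2 p ** g0 p) \<le> 7 * (K * L) * (h p)\<^sup>2"
      using c2 KL unfolding H_def[symmetric] by (simp add: mult_ac)
    show "norm (f p ** g p - (f0 p ** g0 p + (f0 p ** g1 p + f1 p ** g0 p)
        + (f0 p ** g2 p + f1 p ** g1 p + f2 p ** g0 p)))
        \<le> 7 * (K * L) * h p ^ 3"
    \<comment> \<open>For small \<open>H\<close> higher powers are absorbed in \<open>H\<^sup>3\<close>; for large \<open>H\<close> all terms are.\<close>
    proof (cases "H \<le> 1")
      case True
      have Hpow: "H\<^sup>2 * H\<^sup>2 \<le> H ^ 3" "H ^ 3 * H \<le> H ^ 3" "H ^ 3 * H\<^sup>2 \<le> H ^ 3"
        using True H by (simp_all add: power_decreasing mult_left_le power_le_one flip: power_add)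
      define e where "e = f p - (f0 p + f1 p + f2 p)"
      define d where "d = g p - (g0 p + g1 p + g2 p)"
      have e: "norm e \<le> K * H ^ 3" and d: "norm d \<le> L * H ^ 3"
        using fp gp by (auto simp: e_def d_def)
      have fe: "f p = f0 p + f1 p + f2 p + e" "g p = g0 p + g1 p + g2 p + d"
        by (simp_all add: e_def d_def)
      have "norm (e ** g p) \<le> K * L * H ^ 3"
        using matmul_mono[OF e, of "g p" L] gp by (simp add: mult_ac)
      moreover have "norm (f0 p ** d) \<le> K * L * H ^ 3"
        using matmul_mono[of "f0 p" K d "L * H ^ 3"] fp d by (simp add: mult_ac)
      moreover have "norm (f1 p ** d) \<le> K * L * H ^ 3"
      proof -
        have "norm (f1 p ** d) \<le> (K * H) * (L * H ^ 3)"
          using fp d by (intro matmul_mono) auto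
        also have "\<dots> = (K * L) * (H ^ 3 * H)" by (simp add: mult_ac)
        also have "\<dots> \<le> (K * L) * H ^ 3" using Hpow KL by (intro mult_left_mono) auto
        finally show ?thesis .
      qed
      moreover have "norm (f2 p ** d) \<le> K * L * H ^ 3"
      proof -
        have "norm (f2 p ** d) \<le> (K * H\<^sup>2) * (L * H ^ 3)"
          using fp d by (intro matmul_mono) auto
        also have "\<dots> = (K * L) * (H ^ 3 * H\<^sup>2)" by (simp add: mult_ac)
        also have "\<dots> \<le> (K * L) * H ^ 3" using Hpow KL by (intro mult_left_mono) auto
        finally show ?thesis .
      qed
      moreover have "norm (f1 p ** g2 p) \<le> K * L * H ^ 3"
        using matmul_mono[of "f1 p" "K * H" "g2 p" "L * H\<^sup>2"] fp gp
            by (simp add: mult_ac power2_eq_square power3_eq_cube)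
      moreover have "norm (f2 p ** g1 p) \<le> K * L * H ^ 3"
        using matmul_mono[of "f2 p" "K * H\<^sup>2" "g1 p" "L * H"] fp gp
            by (simp add: mult_ac power2_eq_square power3_eq_cube)
      moreover have "norm (f2 p ** g2 p) \<le> K * L * H ^ 3"
      proof -
        have "norm (f2 p ** g2 p) \<le> (K * H\<^sup>2) * (L * H\<^sup>2)"
          using fp gp by (intro matmul_mono) auto
        also have "\<dots> = (K * L) * (H\<^sup>2 * H\<^sup>2)" by (simp add: mult_ac)
        also have "\<dots> \<le> (K * L) * H ^ 3" using Hpow KL by (intro mult_left_mono) auto
        finally show ?thesis .
      qed
      moreover have "f p ** g p - (f0 p ** g0 p + (f0 p ** g1 p + f1 p ** g0 p)
          + (f0 p ** g2 p + f1 p ** g1 p + f2 p ** g0 p))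
          = e ** g p + f0 p ** d + f1 p ** d + f2 p ** d + f1 p ** g2 p + f2 p ** g1 p + f2 p ** g2 p"
        by (simp add: fe(1), simp add: fe(2) matmul_simps algebra_simps)
      moreover have "norm (e ** g p + f0 p ** d + f1 p ** d + f2 p ** d + f1 p ** g2 p + f2 p ** g1 p
          + f2 p ** g2 p)
          \<le> norm (e ** g p) + norm (f0 p ** d) + norm (f1 p ** d) + norm (f2 p ** d)
              + norm (f1 p ** g2 p) + norm (f2 p ** g1 p) + norm (f2 p ** g2 p)"
        by (intro norm_add_rule_thm order_refl)
      ultimately show ?thesis
        unfolding H_def[symmetric] by (simp add: mult_ac)
    next
      case False
      then have "1 \<le> H ^ 3" "H \<le> H ^ 3" "H\<^sup>2 \<le> H ^ 3"
        by (auto simp: one_le_power self_le_power intro: power_increasing)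
      then have "K * L * 1 \<le> K * L * H ^ 3" "K * L * H \<le> K * L * H ^ 3" "K * L * H\<^sup>2 \<le> K * L * H ^ 3"
        using KL(1) by (intro mult_left_mono; simp)+
      moreover have "norm (f p ** g p - (f0 p ** g0 p + (f0 p ** g1 p + f1 p ** g0 p)
          + (f0 p ** g2 p + f1 p ** g1 p + f2 p ** g0 p)))
        \<le> norm (f p ** g p) + (norm (f0 p ** g0 p) + norm (f0 p ** g1 p + f1 p ** g0 p)
            + norm (f0 p ** g2 p + f1 p ** g1 p + f2 p ** g0 p))"
        by (rule order_trans[OF norm_triangle_ineq4]) (intro add_left_mono norm_add_rule_thm order_refl)
      ultimately show ?thesis
        using b c1 c2 unfolding H_def[symmetric] by (simp add: mult_ac)
    qed
  qed (use K L in simp)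
qed

lemma jet_matpow:
  assumes A: "jet D h A A0 A1 A2" and h: "\<And>p. p \<in> D \<Longrightarrow> h p \<ge> 0"
  shows "jet D h (\<lambda>p. matpow (A p) n) (\<lambda>p. matpow (A0 p) n) (\<lambda>p. power_lin (A0 p) (A1 p) n)
      (\<lambda>p. power_quad (A0 p) (A1 p) (A2 p) n)"
proof (induction n)
  case 0
  show ?case
    unfolding matpow.simps power_lin.simps power_quad.simps
    by (rule jet_const[OF order_refl norm_ge_zero h])
next
  case (Suc n)
  show ?case
    using jet_mult[OF A Suc h] by (simp add: add.assoc)
qed

definition unitary_skew_pairs :: "('n::finite cmat \<times> 'n cmat) set" where
  "unitary_skew_pairs = {p. unitary (fst p) \<and> skew (snd p)}"

lemma jet_cayley:
  "jet (unitary_skew_pairs :: ('n::finite cmat \<times> 'n cmat) set) (\<lambda>p. norm (snd p)) (\<lambda>p. cayley (snd p))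
      (\<lambda>_. mat 1) snd
    (\<lambda>p. (1/2) *\<^sub>R (snd p ** snd p))"
proof (rule jetI[where K = "CARD('n)"])
  fix p :: "'n cmat \<times> 'n cmat" assume "p \<in> unitary_skew_pairs"
  then have x: "skew (snd p)" by (simp add: unitary_skew_pairs_def)
  have N: "1 \<le> real CARD('n)" by (simp add: Suc_le_eq)
  show "norm (cayley (snd p)) \<le> CARD('n)" "norm (mat 1 :: 'n cmat) \<le> CARD('n)"
    by (auto intro!: norm_unitary_le cayley_unitary[OF x] unitary_one)
  show "norm (snd p) \<le> CARD('n) * norm (snd p)"
    using N mult_right_mono[OF N, of "norm (snd p)"] by simp
  have "norm ((1/2) *\<^sub>R (snd p ** snd p)) = norm (snd p ** snd p) / 2"
    by simp
  then have "norm ((1/2) *\<^sub>R (snd p ** snd p)) \<le> 1 * (norm (snd p))\<^sup>2"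
    using norm_matrix_mult_le[of "snd p" "snd p"] norm_ge_zero[of "snd p ** snd p"]
    unfolding power2_eq_square by linarith
  also have "\<dots> \<le> CARD('n) * (norm (snd p))\<^sup>2"
    by (intro mult_right_mono N) simp
  finally show "norm ((1/2) *\<^sub>R (snd p ** snd p)) \<le> CARD('n) * (norm (snd p))\<^sup>2" .
  show "norm (cayley (snd p) - (mat 1 + snd p + (1/2) *\<^sub>R (snd p ** snd p))) \<le> CARD('n) * norm (snd p) ^ 3"
    using norm_cayley_expand3[OF x] by (simp add: diff_diff_eq add.assoc)
qed simp

text \<open>
  The expansion of a power of \<open>R' c S c\<^sup>*\<close>, where \<open>c\<close> is the Cayley
  transform of \<open>x\<close> and \<open>R' = V\<^sup>* R V\<close>. First and second order terms
  of the base are \<open>R' (x S - S x)\<close> and \<open>R' (x\<^sup>2 S/2 + S x\<^sup>2/2 - x S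
  x)\<close>, as \<open>c\<^sup>* = 1 - x + x\<^sup>2/2\<close> to this order.
\<close>

lemma jet_conjugated_power:
  fixes R S :: "'n::finite cmat"
  shows "jet unitary_skew_pairs (\<lambda>p. norm (snd p))
    (\<lambda>p. matpow (cadjoint (fst p) ** R ** fst p ** (cayley (snd p) ** (S ** cadjoint (cayley (snd p))))) n)
    (\<lambda>p. matpow (cadjoint (fst p) ** R ** fst p ** S) n)
    (\<lambda>p. power_lin (cadjoint (fst p) ** R ** fst p ** S) (cadjoint (fst p) ** R ** fst p ** (snd p ** S
        - S ** snd p)) n)
    (\<lambda>p. power_quad (cadjoint (fst p) ** R ** fst p ** S) (cadjoint (fst p) ** R ** fst p **
        (snd p ** S - S ** snd p))
       (cadjoint (fst p) ** R ** fst p ** ((1/2) *\<^sub>R (snd p ** snd p ** S)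
           + (1/2) *\<^sub>R (S ** snd p ** snd p) - snd p ** S ** snd p)) n)"
proof (rule jet_matpow)
  let ?N = "real CARD('n)"
  let ?h = "\<lambda>p :: 'n cmat \<times> 'n cmat. norm (snd p)"
  have h: "?h p \<ge> 0" for p by simp
  have R': "jet unitary_skew_pairs ?h (\<lambda>p. cadjoint (fst p) ** R ** fst p)
      (\<lambda>p. cadjoint (fst p) ** R ** fst p) (\<lambda>_. 0) (\<lambda>_. 0)"
  proof (rule jet_const[where K = "?N * norm R * ?N"])
    fix p :: "'n cmat \<times> 'n cmat" assume "p \<in> unitary_skew_pairs"
    then show "norm (cadjoint (fst p) ** R ** fst p) \<le> ?N * norm R * ?N"
      by (intro matmul_mono) (auto simp: unitary_skew_pairs_def norm_unitary_le)
  qed auto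
  have S: "jet unitary_skew_pairs ?h (\<lambda>_. S) (\<lambda>_. S) (\<lambda>_. 0) (\<lambda>_. 0)"
    by (rule jet_const[where K = "norm S"]) auto
  have C: "jet unitary_skew_pairs ?h (\<lambda>p. cadjoint (cayley (snd p))) (\<lambda>_. mat 1) (\<lambda>p. - snd p)
      (\<lambda>p. (1/2) *\<^sub>R (snd p ** snd p))"
  proof -
    have "jet unitary_skew_pairs ?h (\<lambda>p. cadjoint (cayley (snd p))) (\<lambda>_. mat 1) (\<lambda>p. cadjoint (snd p))
        (\<lambda>p. cadjoint ((1/2) *\<^sub>R (snd p ** snd p)))"
      using jet_cadjoint[OF jet_cayley] by simp
    moreover have "cadjoint (snd p) = - snd p" "cadjoint ((1/2) *\<^sub>R (snd p ** snd p))
        = (1/2) *\<^sub>R (snd p ** snd p)"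
      if "p \<in> unitary_skew_pairs" for p :: "'n cmat \<times> 'n cmat"
      using that by (auto simp: unitary_skew_pairs_def skew_def cadjoint_simps cadjoint_mult matmul_simps)
    ultimately show ?thesis
      unfolding jet_def by (simp cong: ball_cong)
  qed
  note jet_mult[OF R' jet_mult[OF jet_cayley jet_mult[OF S C h] h] h]
  then show "jet unitary_skew_pairs ?h (\<lambda>p. cadjoint (fst p) ** R ** fst p ** (cayley (snd p) **
      (S ** cadjoint (cayley (snd p)))))
    (\<lambda>p. cadjoint (fst p) ** R ** fst p ** S)
    (\<lambda>p. cadjoint (fst p) ** R ** fst p ** (snd p ** S - S ** snd p))
    (\<lambda>p. cadjoint (fst p) ** R ** fst p ** ((1/2) *\<^sub>R (snd p ** snd p ** S)
        + (1/2) *\<^sub>R (S ** snd p ** snd p) - snd p ** S ** snd p))"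
    by (simp add: matmul_simps matrix_mul_assoc algebra_simps)
qed simp

section \<open>Bounded Lipschitz functions on the unitary group\<close>

text \<open>
  Boundedness is included because it makes the class closed under products. All functions of the
  position of the walk whose expectations occur belong to it.
\<close>

definition unitary_lipschitz :: "('n::finite cmat \<Rightarrow> 'b::real_normed_vector) \<Rightarrow> bool" where
  "unitary_lipschitz f \<longleftrightarrow> (\<exists>K\<ge>0. \<forall>A B. unitary A \<longrightarrow> unitary B \<longrightarrow> norm (f A) \<le> K \<and> norm (f A - f B)
      \<le> K * norm (A - B))"

lemma unitary_lipschitz_const: "unitary_lipschitz (\<lambda>_. c)"
  unfolding unitary_lipschitz_def by (intro exI[of _ "norm c"]) auto

lemma unitary_lipschitz_id: "unitary_lipschitz (\<lambda>A :: 'n::finite cmat. A)"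
proof -
  have "1 \<le> real CARD('n)" by (simp add: Suc_le_eq)
  then have "norm (A - B) \<le> real CARD('n) * norm (A - B)" for A B :: "'n cmat"
    using mult_right_mono[of 1 "real CARD('n)" "norm (A - B)"] by simp
  then show ?thesis
    unfolding unitary_lipschitz_def by (intro exI[of _ "real CARD('n)"]) (auto simp: norm_unitary_le)
qed

lemma unitary_lipschitz_bounded_linear:
  assumes l: "bounded_linear l" and f: "unitary_lipschitz f"
  shows "unitary_lipschitz (\<lambda>A. l (f A))"
proof -
  obtain K where K: "K \<ge> 0" "\<And>A B. unitary A \<Longrightarrow> unitary B \<Longrightarrow> norm (f A) \<le> K \<and> norm (f A - f B) \<le> K * norm (A - B)"
    using f unfolding unitary_lipschitz_def by blast
  obtain c where c: "c \<ge> 0" "\<And>x. norm (l x) \<le> norm x * c"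
    using bounded_linear.nonneg_bounded[OF l] by blast
  have "norm (l (f A)) \<le> K * c \<and> norm (l (f A) - l (f B)) \<le> K * c * norm (A - B)"
      if "unitary A" "unitary B" for A B
  proof
    show "norm (l (f A)) \<le> K * c"
      using c(2)[of "f A"] K(2)[OF that] mult_right_mono[of "norm (f A)" K c] c(1) by linarith
    have "norm (l (f A) - l (f B)) \<le> norm (f A - f B) * c"
      using c(2)[of "f A - f B"] by (simp add: linear_simps[OF l])
    also have "\<dots> \<le> K * norm (A - B) * c"
      using K(2)[OF that] c(1) by (intro mult_right_mono) auto
    finally show "norm (l (f A) - l (f B)) \<le> K * c * norm (A - B)" by (simp add: mult_ac)
  qed
  then show ?thesis
    unfolding unitary_lipschitz_def using K(1) c(1) by (intro exI[of _ "K * c"]) auto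
qed

lemma unitary_lipschitz_add:
  assumes f: "unitary_lipschitz f" and g: "unitary_lipschitz g"
  shows "unitary_lipschitz (\<lambda>A. f A + g A)"
proof -
  obtain K where K: "K \<ge> 0" "\<And>A B. unitary A \<Longrightarrow> unitary B \<Longrightarrow> norm (f A) \<le> K \<and> norm (f A - f B) \<le> K * norm (A - B)"
    using f unfolding unitary_lipschitz_def by blast
  obtain L where L: "L \<ge> 0" "\<And>A B. unitary A \<Longrightarrow> unitary B \<Longrightarrow> norm (g A) \<le> L \<and> norm (g A - g B) \<le> L * norm (A - B)"
    using g unfolding unitary_lipschitz_def by blast
  have "norm (f A + g A) \<le> K + L \<and> norm (f A + g A - (f B + g B)) \<le> (K + L) * norm (A - B)"
      if "unitary A" "unitary B" for A B
    using K(2)[OF that] L(2)[OF that] norm_triangle_ineq[of "f A" "g A"] norm_diff_triangle_ineq[of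
        "f A" "g A" "f B" "g B"]
    by (simp add: distrib_right)
  then show ?thesis
    unfolding unitary_lipschitz_def using K(1) L(1) by (intro exI[of _ "K + L"]) auto
qed

lemma unitary_lipschitz_diff:
  assumes "unitary_lipschitz f" "unitary_lipschitz g"
  shows "unitary_lipschitz (\<lambda>A. f A - g A)"
  using unitary_lipschitz_add[OF assms(1)
      unitary_lipschitz_bounded_linear[OF bounded_linear_minus[OF bounded_linear_ident] assms(2)]]
  by simp

lemma unitary_lipschitz_bilinear:
  assumes pr: "bounded_bilinear pr" and f: "unitary_lipschitz f" and g: "unitary_lipschitz g"
  shows "unitary_lipschitz (\<lambda>A. pr (f A) (g A))"
proof -
  obtain K where K: "K \<ge> 0" "\<And>A B. unitary A \<Longrightarrow> unitary B \<Longrightarrow> norm (f A) \<le> K \<and> norm (f A - f B) \<le> K * norm (A - B)"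
    using f unfolding unitary_lipschitz_def by blast
  obtain L where L: "L \<ge> 0" "\<And>A B. unitary A \<Longrightarrow> unitary B \<Longrightarrow> norm (g A) \<le> L \<and> norm (g A - g B) \<le> L * norm (A - B)"
    using g unfolding unitary_lipschitz_def by blast
  obtain c where c: "c \<ge> 0" "\<And>x y. norm (pr x y) \<le> norm x * norm y * c"
    using bounded_bilinear.nonneg_bounded[OF pr] by blast
  have prb: "norm (pr x y) \<le> a * b * c" if "norm x \<le> a" "norm y \<le> b" for x y a b
  proof -
    have "norm x * norm y * c \<le> a * b * c"
      using that c(1) order_trans[OF norm_ge_zero that(1)] by (intro mult_right_mono mult_mono) auto
    then show ?thesis using c(2)[of x y] by linarith
  qed
  have "norm (pr (f A) (g A)) \<le> 2 * (K * L * c) \<and> norm (pr (f A) (g A) - pr (f B) (g B))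
      \<le> 2 * (K * L * c) * norm (A - B)"
    if "unitary A" "unitary B" for A B
  proof
    have "0 \<le> K * L * c" using K(1) L(1) c(1) by simp
    then show "norm (pr (f A) (g A)) \<le> 2 * (K * L * c)"
      using prb[of "f A" K "g A" L] K(2)[OF that] L(2)[OF that] by linarith
    have split: "pr (f A) (g A) - pr (f B) (g B) = pr (f A - f B) (g A) + pr (f B) (g A - g B)"
      by (simp add: bounded_bilinear.diff_left[OF pr] bounded_bilinear.diff_right[OF pr])
    have n1: "norm (pr (f A - f B) (g A)) \<le> (K * norm (A - B)) * L * c"
      using K(2)[OF that] L(2)[OF that] by (intro prb) auto
    have n2: "norm (pr (f B) (g A - g B)) \<le> K * (L * norm (A - B)) * c"
      using K(2)[OF that(2,1)] L(2)[OF that] by (intro prb) auto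
    have "norm (pr (f A) (g A) - pr (f B) (g B)) \<le> (K * norm (A - B)) * L * c + K * (L * norm (A - B)) * c"
      unfolding split by (rule order_trans[OF norm_triangle_ineq add_mono[OF n1 n2]])
    then show "norm (pr (f A) (g A) - pr (f B) (g B)) \<le> 2 * (K * L * c) * norm (A - B)"
      by (simp add: algebra_simps)
  qed
  then show ?thesis
    unfolding unitary_lipschitz_def using K(1) L(1) c(1) by (intro exI[of _ "2 * (K * L * c)"]) auto
qed

lemma unitary_lipschitz_sum:
  "(\<And>i. i \<in> I \<Longrightarrow> unitary_lipschitz (f i)) \<Longrightarrow> unitary_lipschitz (\<lambda>A. \<Sum>i\<in>I. f i A)"
  by (induction I rule: infinite_finite_induct) (auto intro: unitary_lipschitz_const unitary_lipschitz_add)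

lemmas unitary_lipschitz_mult = unitary_lipschitz_bilinear[OF bounded_bilinear_mult]
lemmas unitary_lipschitz_matmul = unitary_lipschitz_bilinear[OF matmul.bounded_bilinear_axioms]

lemma unitary_lipschitz_matpow: "unitary_lipschitz f \<Longrightarrow> unitary_lipschitz (\<lambda>A. matpow (f A) n)"
  by (induction n) (auto intro: unitary_lipschitz_const unitary_lipschitz_matmul)

text \<open>
  \<open>R A S A\<^sup>*\<close> as a function of the matrix \<open>A\<close>; its value at \<open>U
  t \<omega>\<close> is \<open>sym_process R S U t \<omega>\<close>.
\<close>

definition conj_product :: "'n::finite cmat \<Rightarrow> 'n cmat \<Rightarrow> 'n cmat \<Rightarrow> 'n cmat" where
  "conj_product R S A = R ** A ** S ** cadjoint A"

lemma unitary_lipschitz_conj_product: "unitary_lipschitz (conj_product R S)"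
  unfolding conj_product_def[abs_def]
  by (intro unitary_lipschitz_matmul unitary_lipschitz_const unitary_lipschitz_id
      unitary_lipschitz_bounded_linear[OF bounded_linear_cadjoint])

lemma unitary_lipschitz_trace_power: "unitary_lipschitz (\<lambda>A. trace (matpow (conj_product R S A) n))"
  by (intro unitary_lipschitz_bounded_linear[OF bounded_linear_trace] unitary_lipschitz_matpow
      unitary_lipschitz_conj_product)

lemma unitary_lipschitz_ntrace_power: "unitary_lipschitz (\<lambda>A. ntrace (matpow (conj_product R S A) n))"
  unfolding ntrace_def divide_inverse
  by (intro unitary_lipschitz_mult unitary_lipschitz_trace_power unitary_lipschitz_const)

lemma unitary_lipschitz_drift: "unitary_lipschitz (\<lambda>A. moment_drift (conj_product R S A) \<alpha> \<beta> n)"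
  unfolding moment_drift_def
  by (intro unitary_lipschitz_add unitary_lipschitz_diff unitary_lipschitz_mult unitary_lipschitz_sum
      unitary_lipschitz_const
      unitary_lipschitz_ntrace_power)

lemma continuous_on_conj_product [continuous_intros]:
  "continuous_on s f \<Longrightarrow> continuous_on s (\<lambda>x. conj_product R S (f x))"
  unfolding conj_product_def by (intro continuous_intros matmul.continuous_on)

lemma continuous_on_ntrace [continuous_intros]:
  "continuous_on s f \<Longrightarrow> continuous_on s (\<lambda>x. ntrace (f x :: 'n::finite cmat))"
  unfolding ntrace_def by (intro continuous_intros) auto

lemma continuous_on_drift:
  "continuous_on s f \<Longrightarrow> continuous_on s (\<lambda>x. moment_drift (conj_product R S (f x)) \<alpha> \<beta> n)"
  unfolding moment_drift_def by (intro continuous_intros)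

section \<open>Evolution of the trace moments\<close>

context brownian_family
begin

lemma bounded_adapted_matpow: "bounded_adapted s Z \<Longrightarrow> bounded_adapted s (\<lambda>\<omega>. matpow (Z \<omega>) n)"
  by (induction n) (auto intro: bounded_adapted_one bounded_adapted_mult)

lemma bounded_adapted_const: "bounded_adapted s (\<lambda>_. c)"
  unfolding bounded_adapted_def by auto

lemma bounded_adapted_diff:
  assumes "bounded_adapted s Z" "bounded_adapted s V"
  shows "bounded_adapted s (\<lambda>\<omega>. Z \<omega> - V \<omega>)"
proof -
  obtain C D where C: "\<And>\<omega>. \<omega> \<in> space M \<Longrightarrow> norm (Z \<omega>) \<le> C" and D: "\<And>\<omega>. \<omega> \<in> space M \<Longrightarrow> norm (V \<omega>) \<le> D"
    using assms unfolding bounded_adapted_def by blast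
  have "norm (Z \<omega> - V \<omega>) \<le> C + D" if "\<omega> \<in> space M" for \<omega>
    using norm_triangle_ineq4[of "Z \<omega>" "V \<omega>"] C[OF that] D[OF that] by linarith
  then show ?thesis
    using assms unfolding bounded_adapted_def by (auto intro!: exI[of _ "C + D"])
qed

text \<open>
  The centered form of \<open>trace_incr_second\<close>: a mean zero statement that can be added up
  over the terms of the second order form.
\<close>

lemma contraction_centered:
  assumes st: "0 \<le> s" "s \<le> t" and P: "bounded_adapted s P" and Q: "bounded_adapted s Q"
  shows "has_bochner_integral M (\<lambda>\<omega>. trace (P \<omega> ** dX s t \<omega> ** Q \<omega> ** dX s t \<omega>)
     - of_real (t - s) * (- (trace (P \<omega>) * trace (Q \<omega>)) / of_nat CARD('n))) 0"
proof -
  obtain C D where C: "\<And>\<omega>. \<omega> \<in> space M \<Longrightarrow> norm (P \<omega>) \<le> C" and D: "\<And>\<omega>. \<omega> \<in> space M \<Longrightarrow> norm (Q \<omega>) \<le> D"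
    using P Q unfolding bounded_adapted_def by blast
  have [measurable]: "P \<in> borel_measurable M" "Q \<in> borel_measurable M"
    using P Q bounded_adapted_measurable by auto
  have int: "integrable M (\<lambda>\<omega>. P \<omega> $ i $ j * Q \<omega> $ k $ l)" for i j k l
  proof (rule integrable_const_bound[where B = "C * D"])
    show "AE \<omega> in M. norm (P \<omega> $ i $ j * Q \<omega> $ k $ l) \<le> C * D"
    proof (rule AE_I2)
      fix \<omega> assume w: "\<omega> \<in> space M"
      have "norm (P \<omega> $ i $ j) \<le> C" "norm (Q \<omega> $ k $ l) \<le> D"
        using norm_entry_le C[OF w] D[OF w] by (blast intro: order_trans)+
      then show "norm (P \<omega> $ i $ j * Q \<omega> $ k $ l) \<le> C * D"
        unfolding norm_mult by (intro mult_mono) (auto intro: order_trans[OF norm_ge_zero])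
    qed
  qed measurable
  have "integrable M (\<lambda>\<omega>. \<Sum>i\<in>UNIV. \<Sum>k\<in>UNIV. P \<omega> $ i $ i * Q \<omega> $ k $ k)"
    by (intro Bochner_Integration.integrable_sum int)
  then have int': "integrable M (\<lambda>\<omega>. - (trace (P \<omega>) * trace (Q \<omega>)) / of_nat CARD('n))"
    unfolding trace_def sum_product by simp
  have "has_bochner_integral M (\<lambda>\<omega>. of_real (t - s) * (- (trace (P \<omega>) * trace (Q \<omega>)) / of_nat CARD('n)))
     (of_real (t - s) * (\<integral>\<omega>. - (trace (P \<omega>) * trace (Q \<omega>)) / of_nat CARD('n) \<partial>M))"
    using int' by (intro has_bochner_integral_mult_right has_bochner_integral_integrable)
  moreover have "has_bochner_integral M (\<lambda>\<omega>. trace (P \<omega> ** dX s t \<omega> ** Q \<omega> ** dX s t \<omega>))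
    (of_real (t - s) * (\<integral>\<omega>. - (trace (P \<omega>) * trace (Q \<omega>)) / of_nat CARD('n) \<partial>M))"
    using P Q int by (intro trace_incr_second[OF st]) (auto simp: bounded_adapted_def)
  ultimately show ?thesis
    using has_bochner_integral_diff by fastforce
qed

lemma second_order_form_linear:
  "second_order_form (\<lambda>P Q. t P Q - c * u P Q) R S n = second_order_form t R S n
      - c * second_order_form u R S n"
proof -
  have sums: "(\<Sum>i<n. \<Sum>j<i. (a i j - c * a' i j) - (b i j - c * b' i j) - (d i j - c * d' i j)
      + (e i j - c * e' i j))
     = (\<Sum>i<n. \<Sum>j<i. a i j - b i j - d i j + e i j) - c * (\<Sum>i<n. \<Sum>j<i. a' i j - b' i j - d' i j + e' i j)"
    for a a' b b' d d' e e' :: "nat \<Rightarrow> nat \<Rightarrow> complex"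
    unfolding sum_distrib_left sum_subtractf[symmetric] by (intro sum.cong refl) (simp add: algebra_simps)
  have "of_nat n * ((a - c * a') / 2 + (b - c * b') / 2 - (d - c * d')) + (e - c * e')
     = of_nat n * (a / 2 + b / 2 - d) + e - c * (of_nat n * (a' / 2 + b' / 2 - d') + e')"
    for a a' b b' d d' e e' :: complex
    by (simp add: field_simps)
  then show ?thesis
    unfolding second_order_form_def Let_def sums by (simp only:)
qed

lemma second_order_centered:
  assumes st: "0 \<le> s" "s \<le> t" and R: "bounded_adapted s R"
  shows "has_bochner_integral M (\<lambda>\<omega>. second_order_form (\<lambda>P Q. trace (P ** dX s t \<omega> ** Q ** dX s t \<omega>)) (R \<omega>) S n
     - of_real (t - s) * second_order_form (\<lambda>P Q. - (trace P * trace Q) / of_nat CARD('n)) (R \<omega>) S n) 0"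
proof -
  let ?t = "\<lambda>\<omega> P Q. trace (P ** dX s t \<omega> ** Q ** dX s t \<omega>) - of_real (t - s) *
      (- (trace P * trace Q) / of_nat CARD('n))"
  have hb: "has_bochner_integral M (\<lambda>\<omega>. ?t \<omega> (P \<omega>) (Q \<omega>)) 0" if "bounded_adapted s P"
      "bounded_adapted s Q" for P Q
    by (rule contraction_centered[OF st that])
  have A: "bounded_adapted s (\<lambda>\<omega>. matpow (R \<omega> ** S) k)" for k
    by (intro bounded_adapted_matpow bounded_adapted_mult R bounded_adapted_const)
  note ba = bounded_adapted_mult bounded_adapted_const A R
  have "has_bochner_integral M (\<lambda>\<omega>. second_order_form (?t \<omega>) (R \<omega>) S n)
    (of_nat n * (0 / 2 + 0 / 2 - 0) + (\<Sum>i<n. \<Sum>j<i. 0 - 0 - 0 + 0))"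
    unfolding second_order_form_def Let_def
    by (intro has_bochner_integral_add has_bochner_integral_diff has_bochner_integral_mult_right
        has_bochner_integral_divide has_bochner_integral_sum hb ba)
  then show ?thesis
    unfolding second_order_form_linear by simp
qed

end

lemma (in prob_space) integrable_of_unitary:
  fixes f :: "'n::finite cmat \<Rightarrow> complex"
  assumes f: "unitary_lipschitz f" "continuous_on UNIV f" and Y: "Y \<in> borel_measurable M" "AE \<omega>
      in M. unitary (Y \<omega>)"
  shows "integrable M (\<lambda>\<omega>. f (Y \<omega>))"
proof -
  obtain K where K: "\<And>A. unitary A \<Longrightarrow> norm (f A) \<le> K"
    using f(1) unfolding unitary_lipschitz_def by blast
  show ?thesis
  proof (rule integrable_const_bound[where B = K])
    show "AE \<omega> in M. norm (f (Y \<omega>)) \<le> K"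
      using Y(2) by eventually_elim (rule K)
    show "(\<lambda>\<omega>. f (Y \<omega>)) \<in> borel_measurable M"
      by (rule borel_measurable_continuous_on[OF f(2) Y(1)])
  qed
qed

lemma conj_product_conjugate:
  assumes V: "unitary V"
  shows "conj_product R S (V ** C) = V ** (cadjoint V ** R ** V ** (C ** (S ** cadjoint C))) ** cadjoint V"
proof -
  have "V ** (cadjoint V ** R ** V ** (C ** (S ** cadjoint C))) ** cadjoint V
      = (V ** cadjoint V) ** R ** V ** C ** S ** cadjoint C ** cadjoint V"
    by (simp add: matrix_mul_assoc)
  then show ?thesis
    using V by (simp add: unitary_def conj_product_def cadjoint_mult matrix_mul_assoc)
qed

lemma trace_matpow_conjugate:
  assumes V: "unitary V"
  shows "trace (matpow (V ** Y ** cadjoint V) n) = trace (matpow Y n)"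
proof -
  have "trace (matpow (V ** Y ** cadjoint V) n) = trace (V ** matpow Y n ** cadjoint V)"
    using matpow_conj[OF unitary_cadjoint_mult[OF V]] by simp
  also have "\<dots> = trace (cadjoint V ** (V ** matpow Y n))"
    by (rule trace_mul_sym)
  finally show ?thesis
    using unitary_cadjoint_mult[OF V] by (simp add: matrix_mul_assoc)
qed

lemma trace_conj_product_scheme:
  assumes V: "unitary V"
  shows "trace (matpow (conj_product R S (V ** C)) n)
      = trace (matpow (cadjoint V ** R ** V ** (C ** (S ** cadjoint C))) n)"
    and "trace (matpow (conj_product R S V) n) = trace (matpow (cadjoint V ** R ** V ** S) n)"
  using trace_matpow_conjugate[OF V] conj_product_conjugate[OF V, of R S C] conj_product_conjugate[OF
      V, of R S "mat 1"]
  by simp_all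

lemma moment_drift_conjugate:
  assumes V: "unitary V"
  shows "moment_drift (cadjoint V ** R ** V ** S) \<alpha> \<beta> n = moment_drift (conj_product R S V) \<alpha> \<beta> n"
  unfolding moment_drift_def ntrace_def trace_conj_product_scheme(2)[OF V] ..

lemma ntrace_conjugate: "unitary V \<Longrightarrow> ntrace (cadjoint V ** R ** V) = ntrace R"
  unfolding ntrace_def by (simp add: trace_cycle3[of "cadjoint V"] trace_cycle3[of R] unitary_def)

context brownian_family
begin

text \<open>
  One step of the walk changes the moment by \<open>\<delta>\<close> times the mean drift, up to
  \<open>\<delta>\<^sup>3\<^sup>/\<^sup>2\<close>. In the second order expansion the first order
  term has mean zero and the second order term has the mean of its contraction; the error is the
  third moment of the increment.
\<close>

lemma scheme_moment_step:
  assumes R: "R ** R = mat 1" and S: "S ** S = mat 1" and n: "n \<ge> 2"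
  shows "\<exists>C\<ge>0. \<forall>\<delta> k. 0 \<le> \<delta> \<longrightarrow>
    norm ((\<integral>\<omega>. trace (matpow (conj_product R S (scheme \<delta> (Suc k) \<omega>)) n) \<partial>M)
      - (\<integral>\<omega>. trace (matpow (conj_product R S (scheme \<delta> k \<omega>)) n) \<partial>M)
      - of_real \<delta> * of_nat CARD('n) * (\<integral>\<omega>. moment_drift (conj_product R S (scheme \<delta> k \<omega>)) (ntrace R)
          (ntrace S) n \<partial>M))
    \<le> C * sqrt \<delta> ^ 3"
proof -
  let ?G = "\<lambda>A :: 'n cmat. trace (matpow (conj_product R S A) n)"
  let ?Dr = "\<lambda>A :: 'n cmat. moment_drift (conj_product R S A) (ntrace R) (ntrace S) n"
  let ?N = "of_nat CARD('n) :: complex"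
  obtain C3 where C3: "C3 \<ge> 0" "\<And>s t. 0 \<le> s \<Longrightarrow> s \<le> t \<Longrightarrow>
    integrable M (\<lambda>\<omega>. norm (dX s t \<omega>) ^ 3) \<and> (\<integral>\<omega>. norm (dX s t \<omega>) ^ 3 \<partial>M) \<le> C3 * sqrt (t - s) ^ 3"
    using dX_third_moment by blast
  define A0 where "A0 V = cadjoint V ** R ** V ** S" for V :: "'n cmat"
  define A1 where "A1 V x = cadjoint V ** R ** V ** (x ** S - S ** x)" for V x :: "'n cmat"
  define A2 where "A2 V x = cadjoint V ** R ** V ** ((1/2) *\<^sub>R (x ** x ** S) + (1/2) *\<^sub>R (S ** x ** x)
      - x ** S ** x)" for V x :: "'n cmat"
  obtain K where K: "K \<ge> 0" "\<And>V x. unitary V \<Longrightarrow> skew x \<Longrightarrow>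
      norm (matpow (cadjoint V ** R ** V ** (cayley x ** (S ** cadjoint (cayley x)))) n
        - (matpow (A0 V) n + power_lin (A0 V) (A1 V x) n + power_quad (A0 V) (A1 V x) (A2 V x) n))
            \<le> K * norm x ^ 3"
    using jet_conjugated_power[of R S n] unfolding jet_def unitary_skew_pairs_def A0_def A1_def A2_def by force
  define C where "C = real CARD('n) * K * C3"
  have "norm ((\<integral>\<omega>. ?G (scheme \<delta> (Suc k) \<omega>) \<partial>M) - (\<integral>\<omega>. ?G (scheme \<delta> k \<omega>) \<partial>M)
      - of_real \<delta> * ?N * (\<integral>\<omega>. ?Dr (scheme \<delta> k \<omega>) \<partial>M)) \<le> C * sqrt \<delta> ^ 3"
    if \<delta>: "0 \<le> \<delta>" for \<delta> k
  proof -
    define s where "s = real k * \<delta>"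
    define t where "t = real (Suc k) * \<delta>"
    have st: "0 \<le> s" "s \<le> t" "t - s = \<delta>"
      using \<delta> by (auto simp: s_def t_def algebra_simps)
    let ?V = "scheme \<delta> k"
    let ?x = "dX s t"
    have V: "bounded_adapted s ?V"
      unfolding s_def by (rule scheme_bounded_adapted[OF \<delta>])
    have uV: "unitary (?V \<omega>)" for \<omega>
      by (rule scheme_unitary)
    have meas: "scheme \<delta> j \<in> borel_measurable M" for j
      by (rule measurable_F[OF scheme_measurable[OF \<delta>]])
    have contG: "continuous_on UNIV ?G" and contD: "continuous_on UNIV ?Dr"
      by (intro continuous_intros, intro continuous_on_drift continuous_intros)
    have intG: "integrable M (\<lambda>\<omega>. ?G (scheme \<delta> j \<omega>))" for j
      by (rule integrable_of_unitary[OF unitary_lipschitz_trace_power contG meas]) (simp add: scheme_unitary)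
    have intD: "integrable M (\<lambda>\<omega>. ?Dr (scheme \<delta> k \<omega>))"
      by (rule integrable_of_unitary[OF unitary_lipschitz_drift contD meas]) (simp add: scheme_unitary)
    let ?R' = "\<lambda>\<omega>. cadjoint (?V \<omega>) ** R ** ?V \<omega>"
    have R': "bounded_adapted s ?R'"
      by (intro bounded_adapted_mult bounded_adapted_cadjoint bounded_adapted_const V)
    have A0: "bounded_adapted s (\<lambda>\<omega>. matpow (A0 (?V \<omega>)) j)" for j
      unfolding A0_def by (intro bounded_adapted_matpow bounded_adapted_mult R' bounded_adapted_const)
    let ?L = "\<lambda>\<omega>. trace (power_lin (A0 (?V \<omega>)) (A1 (?V \<omega>) (?x \<omega>)) n)"
    let ?Q = "\<lambda>\<omega>. trace (power_quad (A0 (?V \<omega>)) (A1 (?V \<omega>) (?x \<omega>)) (A2 (?V \<omega>) (?x \<omega>)) n)"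
    have L: "has_bochner_integral M ?L 0"
    proof -
      let ?P = "\<lambda>\<omega>. S ** matpow (A0 (?V \<omega>)) (n - 1) ** ?R' \<omega> - matpow (A0 (?V \<omega>)) (n - 1) ** ?R' \<omega> ** S"
      have P: "bounded_adapted s ?P"
        by (intro bounded_adapted_diff bounded_adapted_mult A0 R' bounded_adapted_const)
      have "has_bochner_integral M (\<lambda>\<omega>. of_nat n * trace (?P \<omega> ** ?x \<omega>)) (of_nat n * 0)"
        by (rule has_bochner_integral_mult_right)
           (rule trace_incr_first[OF st(1,2) P[unfolded bounded_adapted_def, THEN conjunct1]
               bounded_adapted_integrable[OF P]])
      moreover have "?L \<omega> = of_nat n * trace (?P \<omega> ** ?x \<omega>)" for \<omega>
      proof -
        let ?W = "matpow (A0 (?V \<omega>)) (n - 1)"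
        have "?L \<omega> = of_nat n * trace (A1 (?V \<omega>) (?x \<omega>) ** ?W)"
          using trace_power_lin[of "A0 (?V \<omega>)" 0] by simp
        also have "trace (A1 (?V \<omega>) (?x \<omega>) ** ?W) = trace (?P \<omega> ** ?x \<omega>)"
          using trace_mul_sym[of "?R' \<omega> ** ?x \<omega>" "S ** ?W"] trace_mul_sym[of "?R' \<omega> ** S ** ?x \<omega>" ?W]
          by (simp add: A1_def matmul_simps trace_simps matrix_mul_assoc)
        finally show ?thesis .
      qed
      ultimately show ?thesis by simp
    qed
    have Q: "has_bochner_integral M (\<lambda>\<omega>. ?Q \<omega> - of_real \<delta> * (?N * ?Dr (?V \<omega>))) 0"
    proof -
      have "?Q \<omega> = second_order_form (\<lambda>P Q. trace (P ** ?x \<omega> ** Q ** ?x \<omega>)) (?R' \<omega>) S n" for \<omega>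
        unfolding A0_def A1_def A2_def by (rule trace_power_quad_form)
      moreover have "second_order_form (\<lambda>P Q. - (trace P * trace Q) / ?N) (?R' \<omega>) S n = ?N * ?Dr (?V \<omega>)" for \<omega>
      proof -
        have "?R' \<omega> ** ?R' \<omega> = cadjoint (?V \<omega>) ** R ** (?V \<omega> ** cadjoint (?V \<omega>)) ** R ** ?V \<omega>"
          by (simp add: matrix_mul_assoc)
        also have "\<dots> = cadjoint (?V \<omega>) ** (R ** R) ** ?V \<omega>"
          using uV[of \<omega>] by (simp add: unitary_def matrix_mul_assoc)
        also have "\<dots> = mat 1"
          using R unitary_cadjoint_mult[OF uV] by simp
        finally have "second_order_form (\<lambda>P Q. - (trace P * trace Q) / ?N) (?R' \<omega>) S n
            = ?N * moment_drift (?R' \<omega> ** S) (ntrace (?R' \<omega>)) (ntrace S) n"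
          by (rule second_order_form_drift[OF _ S n])
        then show ?thesis
          by (simp only: ntrace_conjugate[OF uV] moment_drift_conjugate[OF uV])
      qed
      ultimately show ?thesis
        using second_order_centered[OF st(1,2) R', of S n] by (simp only: st(3))
    qed
    have D: "has_bochner_integral M (\<lambda>\<omega>. of_real \<delta> * (?N * ?Dr (?V \<omega>)))
        (of_real \<delta> * (?N * (\<integral>\<omega>. ?Dr (?V \<omega>) \<partial>M)))"
      using intD by (intro has_bochner_integral_mult_right has_bochner_integral_integrable)
    \<comment> \<open>The pointwise remainder, grouped so that each bracket has a known mean.\<close>
    define e where "e \<omega> = ?G (scheme \<delta> (Suc k) \<omega>) - ?G (?V \<omega>) - ?L \<omega> - (?Q \<omega> - of_real \<delta> * (?N * ?Dr (?V \<omega>)))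
        - of_real \<delta> * (?N * ?Dr (?V \<omega>))" for \<omega>
    have e: "has_bochner_integral M e ((\<integral>\<omega>. ?G (scheme \<delta> (Suc k) \<omega>) \<partial>M) - (\<integral>\<omega>. ?G (?V \<omega>) \<partial>M) - 0 - 0
        - of_real \<delta> * (?N * (\<integral>\<omega>. ?Dr (?V \<omega>) \<partial>M)))"
      unfolding e_def by (intro has_bochner_integral_diff L Q D has_bochner_integral_integrable intG)
    have e_bound: "norm (e \<omega>) \<le> real CARD('n) * K * norm (?x \<omega>) ^ 3" for \<omega>
    proof -
      let ?E = "matpow (?R' \<omega> ** (cayley (?x \<omega>) ** (S ** cadjoint (cayley (?x \<omega>))))) n
        - (matpow (A0 (?V \<omega>)) n + power_lin (A0 (?V \<omega>)) (A1 (?V \<omega>) (?x \<omega>)) n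
          + power_quad (A0 (?V \<omega>)) (A1 (?V \<omega>) (?x \<omega>)) (A2 (?V \<omega>) (?x \<omega>)) n)"
      have "scheme \<delta> (Suc k) \<omega> = ?V \<omega> ** cayley (?x \<omega>)"
        by (simp add: s_def t_def)
      then have "e \<omega> = trace ?E"
        unfolding e_def A0_def by (simp add: trace_conj_product_scheme[OF uV] trace_simps)
      then have "norm (e \<omega>) \<le> real CARD('n) * norm ?E"
        using norm_trace_le[of ?E] by simp
      also have "\<dots> \<le> real CARD('n) * (K * norm (?x \<omega>) ^ 3)"
        by (intro mult_left_mono K(2)[OF uV dX_skew]) simp
      finally show ?thesis by (simp add: mult.assoc)
    qed
    have "norm (\<integral>\<omega>. e \<omega> \<partial>M) \<le> (\<integral>\<omega>. norm (e \<omega>) \<partial>M)"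
      by (rule integral_norm_bound)
    also have "\<dots> \<le> (\<integral>\<omega>. real CARD('n) * K * norm (?x \<omega>) ^ 3 \<partial>M)"
    proof (rule integral_mono)
      show "integrable M (\<lambda>\<omega>. norm (e \<omega>))"
        using e by (intro integrable_norm integrable.intros)
      show "integrable M (\<lambda>\<omega>. real CARD('n) * K * norm (?x \<omega>) ^ 3)"
        using C3(2)[OF st(1,2)] by simp
    qed (rule e_bound)
    also have "\<dots> = real CARD('n) * K * (\<integral>\<omega>. norm (?x \<omega>) ^ 3 \<partial>M)"
      by simp
    also have "\<dots> \<le> real CARD('n) * K * (C3 * sqrt (t - s) ^ 3)"
      using C3(2)[OF st(1,2)] K(1) by (intro mult_left_mono) auto
    also have "\<dots> = C * sqrt \<delta> ^ 3"
      by (simp add: C_def st(3))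
    finally have "norm (\<integral>\<omega>. e \<omega> \<partial>M) \<le> C * sqrt \<delta> ^ 3" .
    then show ?thesis
      unfolding has_bochner_integral_integral_eq[OF e] by (simp add: mult.assoc)
  qed
  moreover have "C \<ge> 0"
    using K(1) C3(1) by (simp add: C_def)
  ultimately show ?thesis by blast
qed

end

context unitary_bm
begin

lemma expectation_scheme_error:
  fixes f :: "'n cmat \<Rightarrow> complex"
  assumes f: "unitary_lipschitz f" "continuous_on UNIV f" and T: "0 \<le> T"
  shows "\<exists>C\<ge>0. \<forall>\<delta> m s. 0 < \<delta> \<longrightarrow> \<delta> \<le> 1 \<longrightarrow> real m * \<delta> \<le> s \<longrightarrow> s \<le> real (Suc m) * \<delta> \<longrightarrow> s \<le> T \<longrightarrow>
    norm ((\<integral>\<omega>. f (U s \<omega>) \<partial>M) - (\<integral>\<omega>. f (scheme \<delta> m \<omega>) \<partial>M)) \<le> C * sqrt \<delta>"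
proof -
  obtain K where K: "K \<ge> 0" "\<And>A B. unitary A \<Longrightarrow> unitary B \<Longrightarrow> norm (f A - f B) \<le> K * norm (A - B)"
    using f(1) unfolding unitary_lipschitz_def by blast
  obtain C where C: "C > 0" "\<And>\<delta> m s. 0 < \<delta> \<Longrightarrow> \<delta> \<le> 1 \<Longrightarrow> real m * \<delta> \<le> s \<Longrightarrow> s \<le> real (Suc m) * \<delta> \<Longrightarrow> s \<le> T \<Longrightarrow>
    integrable M (\<lambda>\<omega>. U s \<omega> - scheme \<delta> m \<omega>) \<and> (\<integral>\<omega>. norm (U s \<omega> - scheme \<delta> m \<omega>) \<partial>M) \<le> C * sqrt \<delta>"
    using scheme_error_L1[OF T] by blast
  have "norm ((\<integral>\<omega>. f (U s \<omega>) \<partial>M) - (\<integral>\<omega>. f (scheme \<delta> m \<omega>) \<partial>M)) \<le> K * C * sqrt \<delta>"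
    if \<delta>: "0 < \<delta>" "\<delta> \<le> 1" and s: "real m * \<delta> \<le> s" "s \<le> real (Suc m) * \<delta>" "s \<le> T" for \<delta> m s
  proof -
    have s0: "0 \<le> s"
      using s(1) \<delta> mult_nonneg_nonneg[of "real m" \<delta>] by linarith
    have iU: "integrable M (\<lambda>\<omega>. f (U s \<omega>))"
      by (rule integrable_of_unitary[OF f U_measurable[OF s0] U_unitary[OF s0]])
    have iV: "integrable M (\<lambda>\<omega>. f (scheme \<delta> m \<omega>))"
      by (rule integrable_of_unitary[OF f measurable_F[OF scheme_measurable]]) (use \<delta> scheme_unitary in auto)
    have "norm (\<integral>\<omega>. f (U s \<omega>) - f (scheme \<delta> m \<omega>) \<partial>M) \<le> (\<integral>\<omega>. norm (f (U s \<omega>) - f (scheme \<delta> m \<omega>)) \<partial>M)"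
      by (rule integral_norm_bound)
    also have "\<dots> \<le> (\<integral>\<omega>. K * norm (U s \<omega> - scheme \<delta> m \<omega>) \<partial>M)"
    proof (rule integral_mono_AE)
      show "integrable M (\<lambda>\<omega>. norm (f (U s \<omega>) - f (scheme \<delta> m \<omega>)))"
        using iU iV by auto
      show "integrable M (\<lambda>\<omega>. K * norm (U s \<omega> - scheme \<delta> m \<omega>))"
        using C(2)[OF \<delta> s] by auto
      show "AE \<omega> in M. norm (f (U s \<omega>) - f (scheme \<delta> m \<omega>)) \<le> K * norm (U s \<omega> - scheme \<delta> m \<omega>)"
        using U_unitary[OF s0] by eventually_elim (rule K(2)[OF _ scheme_unitary])
    qed
    also have "\<dots> = K * (\<integral>\<omega>. norm (U s \<omega> - scheme \<delta> m \<omega>) \<partial>M)"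
      by simp
    also have "\<dots> \<le> K * (C * sqrt \<delta>)"
      using C(2)[OF \<delta> s] K(1) by (intro mult_left_mono) auto
    finally show ?thesis
      using iU iV by (simp add: mult.assoc)
  qed
  then show ?thesis
    using K(1) C(1) by (intro exI[of _ "K * C"]) auto
qed

text \<open>
  Continuity of the paths and the uniform bound on unitary matrices give continuity of the
  expectation.
\<close>

lemma expectation_continuous:
  fixes f :: "'n cmat \<Rightarrow> complex"
  assumes f: "unitary_lipschitz f" "continuous_on UNIV f"
  shows "continuous_on {0..} (\<lambda>s. \<integral>\<omega>. f (U s \<omega>) \<partial>M)"
proof (rule continuous_on_sequentiallyI)
  fix u :: "nat \<Rightarrow> real" and a
  assume u: "\<forall>i. u i \<in> {0..}" and a: "a \<in> {0..}" and lim: "u \<longlonglongrightarrow> a"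
  obtain K where K: "\<And>A. unitary A \<Longrightarrow> norm (f A) \<le> K"
    using f(1) unfolding unitary_lipschitz_def by blast
  have meas: "(\<lambda>\<omega>. f (U s \<omega>)) \<in> borel_measurable M" if "0 \<le> s" for s
    by (rule borel_measurable_continuous_on[OF f(2) U_measurable[OF that]])
  show "(\<lambda>i. \<integral>\<omega>. f (U (u i) \<omega>) \<partial>M) \<longlonglongrightarrow> (\<integral>\<omega>. f (U a \<omega>) \<partial>M)"
  proof (rule integral_dominated_convergence[where w = "\<lambda>_. K"])
    show "AE \<omega> in M. (\<lambda>i. f (U (u i) \<omega>)) \<longlonglongrightarrow> f (U a \<omega>)"
      using U_continuous
    proof eventually_elim
      case (elim \<omega>)
      then have "(\<lambda>i. U (u i) \<omega>) \<longlonglongrightarrow> U a \<omega>"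
        using u a lim by (auto simp: continuous_on_sequentially comp_def)
      moreover have "isCont f (U a \<omega>)"
        using f(2) by (simp add: continuous_on_eq_continuous_at)
      ultimately show ?case
        by (rule isCont_tendsto_compose[rotated])
    qed
    show "AE \<omega> in M. norm (f (U (u i) \<omega>)) \<le> K" for i
      using U_unitary[of "u i"] u by (auto elim!: eventually_mono intro: K)
  qed (use meas u a in auto)
qed

text \<open>
  The integrated moment equation. Summing the steps over a grid of mesh \<open>t/k\<close> leaves
  errors of total order \<open>k \<delta>\<^sup>3\<^sup>/\<^sup>2\<close>, from the steps and from
  replacing the walk by \<open>U\<close> under the integral; at the final time the replacement costs
  another \<open>\<delta>\<^sup>1\<^sup>/\<^sup>2\<close>. As \<open>k \<delta> = t\<close>, all of
  this vanishes in the limit.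
\<close>

lemma trace_power_integral:
  assumes R: "R ** R = mat 1" and S: "S ** S = mat 1" and n: "n \<ge> 2" and t: "0 \<le> t"
  shows "(\<integral>\<omega>. trace (matpow (conj_product R S (U t \<omega>)) n) \<partial>M)
    = trace (matpow (conj_product R S (mat 1)) n)
      + integral {0..t} (\<lambda>s. of_nat CARD('n) * (\<integral>\<omega>. moment_drift (conj_product R S (U s \<omega>)) (ntrace R)
          (ntrace S) n \<partial>M))"
proof -
  let ?G = "\<lambda>A :: 'n cmat. trace (matpow (conj_product R S A) n)"
  let ?Dr = "\<lambda>A :: 'n cmat. of_nat CARD('n) * moment_drift (conj_product R S A) (ntrace R) (ntrace S) n"
  let ?g = "\<lambda>A. \<integral>\<omega>. ?G (A \<omega>) \<partial>M" and ?d = "\<lambda>A. \<integral>\<omega>. ?Dr (A \<omega>) \<partial>M"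
  let ?h = "\<lambda>s. ?d (U s)"
  have G: "unitary_lipschitz ?G" "continuous_on UNIV ?G"
    by (rule unitary_lipschitz_trace_power, intro continuous_intros)
  have D: "unitary_lipschitz ?Dr" "continuous_on UNIV ?Dr"
    by (intro unitary_lipschitz_mult unitary_lipschitz_const unitary_lipschitz_drift,
        intro continuous_intros continuous_on_drift)
  obtain C1 where C1: "C1 \<ge> 0" "\<And>\<delta> k. 0 \<le> \<delta> \<Longrightarrow>
    norm (?g (scheme \<delta> (Suc k)) - ?g (scheme \<delta> k) - of_real \<delta> * ?d (scheme \<delta> k)) \<le> C1 * sqrt \<delta> ^ 3"
    using scheme_moment_step[OF R S n] by (auto simp: mult.assoc)
  obtain C2 where C2: "C2 \<ge> 0" "\<And>\<delta> m s. 0 < \<delta> \<Longrightarrow> \<delta> \<le> 1 \<Longrightarrow> real m * \<delta> \<le> s \<Longrightarrow> s \<le> real (Suc m) * \<delta> \<Longrightarrow> s \<le> t \<Longrightarrow>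
    norm (?g (U s) - ?g (scheme \<delta> m)) \<le> C2 * sqrt \<delta>"
    using expectation_scheme_error[OF G t] by blast
  obtain C3 where C3: "C3 \<ge> 0" "\<And>\<delta> m s. 0 < \<delta> \<Longrightarrow> \<delta> \<le> 1 \<Longrightarrow> real m * \<delta> \<le> s \<Longrightarrow> s \<le> real (Suc m) * \<delta> \<Longrightarrow> s \<le> t \<Longrightarrow>
    norm (?h s - ?d (scheme \<delta> m)) \<le> C3 * sqrt \<delta>"
    using expectation_scheme_error[OF D t] by blast
  have h_cont: "continuous_on {0..} ?h"
    by (rule expectation_continuous[OF D])
  have h_int: "?h integrable_on {a..b}" if "0 \<le> a" for a b
    by (rule integrable_continuous_real, rule continuous_on_subset[OF h_cont]) (use that in auto)
  define err where "err = ?g (U t) - ?G (mat 1) - integral {0..t} ?h"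
  have bound: "norm err \<le> (C2 + (C1 + C3) * t) * sqrt (t / real k)" if k: "0 < k" "t \<le> real k"
      and t0: "0 < t" for k
  proof -
    \<comment> \<open>With this mesh \<open>t\<close> is the grid point number \<open>k\<close>.\<close>
    define \<delta> where "\<delta> = t / real k"
    have \<delta>: "0 < \<delta>" "\<delta> \<le> 1" "real k * \<delta> = t"
      using k t0 by (auto simp: \<delta>_def)
    have cub: "sqrt \<delta> ^ 3 = \<delta> * sqrt \<delta>"
      using \<delta> by (simp add: power3_eq_cube)
    have "norm (?g (scheme \<delta> m) - ?G (mat 1) - integral {0..real m * \<delta>} ?h)
        \<le> real m * ((C1 + C3) * (\<delta> * sqrt \<delta>))"
      if "m \<le> k" for m
      using that
    proof (induction m)
      case 0
      show ?case by (simp add: prob_space)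
    next
      case (Suc m)
      let ?a = "real m * \<delta>" and ?b = "real (Suc m) * \<delta>"
      have ab: "0 \<le> ?a" "?a \<le> ?b" "?b \<le> t" "?b - ?a = \<delta>"
        using \<delta> Suc.prems mult_right_mono[of "real (Suc m)" "real k" \<delta>]
        by (auto simp: algebra_simps)
      have split: "integral {0..?b} ?h = integral {0..?a} ?h + integral {?a..?b} ?h"
        by (rule Henstock_Kurzweil_Integration.integral_combine[symmetric]) (use ab h_int in auto)
      have "norm (integral {?a..?b} (\<lambda>s. ?h s - ?d (scheme \<delta> m))) \<le> C3 * sqrt \<delta> * (?b - ?a)"
      proof (rule integral_bound[OF ab(2)])
        show "continuous_on {?a..?b} (\<lambda>s. ?h s - ?d (scheme \<delta> m))"
          by (intro continuous_intros continuous_on_subset[OF h_cont]) (use ab in auto)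
        show "norm (?h s - ?d (scheme \<delta> m)) \<le> C3 * sqrt \<delta>" if "s \<in> {?a..?b}" for s
          using that ab by (intro C3(2)[OF \<delta>(1,2)]) auto
      qed
      moreover have "integral {?a..?b} (\<lambda>s. ?h s - ?d (scheme \<delta> m))
          = integral {?a..?b} ?h - of_real \<delta> * ?d (scheme \<delta> m)"
        using h_int[OF ab(1), of ?b] ab
        by (subst Henstock_Kurzweil_Integration.integral_diff) (auto simp: scaleR_conv_of_real)
      ultimately have 1: "norm (integral {?a..?b} ?h - of_real \<delta> * ?d (scheme \<delta> m)) \<le> C3 * (\<delta> * sqrt \<delta>)"
        by (simp only: ab(4)) (simp add: mult_ac)
      have 2: "norm (?g (scheme \<delta> (Suc m)) - ?g (scheme \<delta> m) - of_real \<delta> * ?d (scheme \<delta> m)) \<le> C1 * (\<delta> * sqrt \<delta>)"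
        using C1(2)[of \<delta> m] \<delta>(1) unfolding cub by simp
      have 3: "norm (?g (scheme \<delta> m) - ?G (mat 1) - integral {0..?a} ?h) \<le> real m * ((C1 + C3) * (\<delta> * sqrt \<delta>))"
        using Suc by simp
      have tri: "norm (y - g - (i + j)) \<le> norm (x - g - i) + norm (y - x - d) + norm (j - d)"
          for x y g i j d :: complex
      proof -
        have split: "y - g - (i + j) = (x - g - i) + (y - x - d) - (j - d)" by simp
        show ?thesis
          unfolding split
          using norm_triangle_ineq4[of "(x - g - i) + (y - x - d)" "j - d"] norm_triangle_ineq[of
              "x - g - i" "y - x - d"]
          by linarith
      qed
      have "norm (?g (scheme \<delta> (Suc m)) - ?G (mat 1) - integral {0..?b} ?h)
          \<le> real m * ((C1 + C3) * (\<delta> * sqrt \<delta>)) + C1 * (\<delta> * sqrt \<delta>) + C3 * (\<delta> * sqrt \<delta>)"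
        unfolding split by (rule order_trans[OF tri add_mono[OF add_mono[OF 3 2] 1]])
      also have "\<dots> = real (Suc m) * ((C1 + C3) * (\<delta> * sqrt \<delta>))"
        by (simp add: algebra_simps)
      finally show ?case .
    qed
    from this[of k] have "norm (?g (scheme \<delta> k) - ?G (mat 1) - integral {0..t} ?h)
        \<le> real k * ((C1 + C3) * (\<delta> * sqrt \<delta>))"
      by (simp add: \<delta>(3))
    also have "\<dots> = (C1 + C3) * t * sqrt \<delta>"
      unfolding \<delta>(3)[symmetric] by simp
    finally have 1: "norm (?g (scheme \<delta> k) - ?G (mat 1) - integral {0..t} ?h) \<le> (C1 + C3) * t * sqrt \<delta>" .
    have 2: "norm (?g (U t) - ?g (scheme \<delta> k)) \<le> C2 * sqrt \<delta>"
      by (rule C2(2)[OF \<delta>(1,2)]) (use \<delta> in \<open>auto simp: algebra_simps\<close>)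
    have split: "err = (?g (U t) - ?g (scheme \<delta> k)) + (?g (scheme \<delta> k) - ?G (mat 1) - integral {0..t} ?h)"
      by (simp add: err_def)
    have "norm err \<le> C2 * sqrt \<delta> + (C1 + C3) * t * sqrt \<delta>"
      unfolding split by (rule order_trans[OF norm_triangle_ineq add_mono[OF 2 1]])
    then show ?thesis
      by (simp add: \<delta>_def distrib_right)
  qed
  have "err = 0"
  proof (cases "t = 0")
    case True
    have "AE \<omega> in M. ?G (U t \<omega>) = ?G (mat 1)"
      using U_start by eventually_elim (simp add: True)
    then have "?g (U t) = (\<integral>\<omega>. ?G (mat 1) \<partial>M)"
      using borel_measurable_continuous_on[OF G(2) U_measurable[OF t]] by (intro integral_cong_AE) auto
    then show ?thesis
      by (simp add: err_def prob_space True)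
  next
    case False
    then have t0: "0 < t" using t by simp
    have "(\<lambda>k. t * inverse (real (Suc k))) \<longlonglongrightarrow> t * 0"
      by (intro tendsto_mult tendsto_const LIMSEQ_inverse_real_of_nat)
    then have "(\<lambda>k. (C2 + (C1 + C3) * t) * sqrt (t / real (Suc k))) \<longlonglongrightarrow> (C2 + (C1 + C3) * t) * sqrt 0"
      by (intro tendsto_mult tendsto_const tendsto_real_sqrt) (simp add: divide_inverse)
    moreover obtain k0 :: nat where k0: "t \<le> real k0"
      using real_arch_simple by blast
    have "\<exists>K. \<forall>k\<ge>K. norm err \<le> (C2 + (C1 + C3) * t) * sqrt (t / real (Suc k))"
      using k0 by (intro exI[of _ k0] allI impI bound t0) auto
    ultimately have "norm err \<le> (C2 + (C1 + C3) * t) * sqrt 0"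
      by (rule LIMSEQ_le_const)
    then show ?thesis by simp
  qed
  then show ?thesis
    by (simp add: err_def algebra_simps)
qed

end

theorem theorem1p1:
  fixes M :: "'a measure"
    and B :: "'n::{finite,linorder} cmat \<Rightarrow> real \<Rightarrow> 'a \<Rightarrow> real"
    and U :: "real \<Rightarrow> 'a \<Rightarrow> 'n cmat"
    and R S :: "'n cmat"
    and \<alpha> \<beta> :: complex
    and n :: nat and t :: real
  assumes "prob_space M"
    and "unitary_brownian_motion M B U"
    and "self_adjoint_symmetry R" and "self_adjoint_symmetry S"
    and "\<alpha> = (1 / of_nat CARD('n)) * trace R" and "\<beta> = (1 / of_nat CARD('n)) * trace S"
    and "n \<ge> 2" and "t \<ge> 0"
  shows "((\<lambda>u. trace_moment M R S U n u) has_vector_derivative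
      (- of_nat n * trace_moment M R S U n t
       - of_nat n * (\<Sum>p=1..n-1. \<integral>\<omega>. ntrace (matpow (sym_process R S U t \<omega>) p)
                                    * ntrace (matpow (sym_process R S U t \<omega>) (n - p)) \<partial>M)
       + (if odd n then (of_nat n)\<^sup>2 * \<alpha> * \<beta>
          else (of_nat n)\<^sup>2 / 2 * (\<alpha>\<^sup>2 + \<beta>\<^sup>2)))) (at t within {0..})"
proof -
  interpret unitary_bm M B U
  proof -
    interpret prob_space M by fact
    show "unitary_bm M B U"
      by standard (use assms(2) in \<open>auto simp: unitary_brownian_motion_def\<close>)
  qed
  have R: "R ** R = mat 1" and S: "S ** S = mat 1"
    using assms(3,4) by (auto simp: self_adjoint_symmetry_def)
  have \<alpha>: "ntrace R = \<alpha>" and \<beta>: "ntrace S = \<beta>"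
    using assms(5,6) by (auto simp: ntrace_def)
  let ?N = "of_nat CARD('n) :: complex"
  let ?d = "\<lambda>s. \<integral>\<omega>. moment_drift (conj_product R S (U s \<omega>)) \<alpha> \<beta> n \<partial>M"
  have sym: "sym_process R S U s \<omega> = conj_product R S (U s \<omega>)" for s \<omega>
    by (simp add: sym_process_def conj_product_def)
  have drift: "unitary_lipschitz (\<lambda>A. moment_drift (conj_product R S A) \<alpha> \<beta> n)"
      "continuous_on UNIV (\<lambda>A. moment_drift (conj_product R S A) \<alpha> \<beta> n)"
    by (rule unitary_lipschitz_drift, intro continuous_on_drift continuous_intros)
  have d_cont: "continuous_on {0..} ?d"
    by (rule expectation_continuous[OF drift])
  have formula: "trace_moment M R S U n u
      = (1 / ?N) * trace (matpow (conj_product R S (mat 1)) n) + integral {0..u} ?d" if "0 \<le> u" for u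
    using trace_power_integral[OF R S assms(7) that]
    by (simp add: trace_moment_def sym \<alpha> \<beta> distrib_left add_divide_distrib)
  \<comment> \<open>The fundamental theorem of calculus is applied on \<open>[0, t + 1]\<close>, a neighbourhood of \<open>t\<close> in the half-line.\<close>
  have "((\<lambda>u. integral {0..u} ?d) has_vector_derivative ?d t) (at t within {0..t + 1})"
    by (rule integral_has_vector_derivative) (use assms(8) in \<open>auto intro: continuous_on_subset[OF d_cont]\<close>)
  then have "((\<lambda>u. integral {0..u} ?d) has_vector_derivative ?d t) (at t within {0..})"
    by (subst at_within_nhd[of t "{..<t + 1}" "{0..}" "{0..t + 1}"]) auto
  then have "((\<lambda>u. (1 / ?N) * trace (matpow (conj_product R S (mat 1)) n) + integral {0..u} ?d)
      has_vector_derivative (0 + ?d t))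
      (at t within {0..})"
    by (intro has_vector_derivative_add has_vector_derivative_const)
  then have "((\<lambda>u. trace_moment M R S U n u) has_vector_derivative (0 + ?d t)) (at t within {0..})"
    by (rule has_vector_derivative_transform[rotated 2]) (use assms(8) formula in auto)
  then have deriv: "((\<lambda>u. trace_moment M R S U n u) has_vector_derivative ?d t) (at t within {0..})"
    by (simp only: add_0)
  have int1: "integrable M (\<lambda>\<omega>. ntrace (matpow (conj_product R S (U t \<omega>)) p))" for p
    by (rule integrable_of_unitary[OF unitary_lipschitz_ntrace_power _ U_measurable[OF assms(8)]
        U_unitary[OF assms(8)]])
       (intro continuous_intros)
  have int2: "integrable M (\<lambda>\<omega>. ntrace (matpow (conj_product R S (U t \<omega>)) p) * ntrace
      (matpow (conj_product R S (U t \<omega>)) q))" for p q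
    by (rule integrable_of_unitary[where f = "\<lambda>A. ntrace (matpow (conj_product R S A) p) * ntrace
        (matpow (conj_product R S A) q)",
        OF unitary_lipschitz_mult[OF unitary_lipschitz_ntrace_power unitary_lipschitz_ntrace_power] _
            U_measurable[OF assms(8)] U_unitary[OF assms(8)]])
       (intro continuous_intros)
  let ?c = "if odd n then (of_nat n)\<^sup>2 * \<alpha> * \<beta> else (of_nat n)\<^sup>2 / 2 * (\<alpha>\<^sup>2 + \<beta>\<^sup>2)"
  have hb: "has_bochner_integral M (\<lambda>\<omega>. moment_drift (conj_product R S (U t \<omega>)) \<alpha> \<beta> n)
     (- of_nat n * (\<integral>\<omega>. ntrace (matpow (conj_product R S (U t \<omega>)) n) \<partial>M)
       - of_nat n * (\<Sum>p=1..n-1. \<integral>\<omega>. ntrace (matpow (conj_product R S (U t \<omega>)) p)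
                                    * ntrace (matpow (conj_product R S (U t \<omega>)) (n - p)) \<partial>M) + (\<integral>\<omega>. ?c \<partial>M))"
    unfolding moment_drift_def
    by (intro has_bochner_integral_add has_bochner_integral_diff has_bochner_integral_mult_right
        has_bochner_integral_sum has_bochner_integral_integrable int1 int2) simp
  have first: "(\<integral>\<omega>. ntrace (matpow (conj_product R S (U t \<omega>)) n) \<partial>M) = trace_moment M R S U n t"
    by (simp add: trace_moment_def sym ntrace_def)
  have const: "(\<integral>\<omega>. ?c \<partial>M) = ?c"
    by (simp add: prob_space)
  have "?d t = - of_nat n * trace_moment M R S U n t
       - of_nat n * (\<Sum>p=1..n-1. \<integral>\<omega>. ntrace (matpow (sym_process R S U t \<omega>) p)
                                    * ntrace (matpow (sym_process R S U t \<omega>) (n - p)) \<partial>M) + ?c"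
    by (simp only: sym has_bochner_integral_integral_eq[OF hb] first const)
  with deriv show ?thesis
    by (simp only:)
qed

end
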